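(* Let $\mathbb{A}=(A,f,g)$ be a minimal bounded width algebra whose basic operations $f,g$ form a standard pair (in the sense defined in the context) with the clone generated by $g$ minimal among bounded width clones, and let $\mathbb{A}_f=(A,f)$. Then $\mathbb{A}_f$ is hereditarily yellow connected.
   Context: Bounded width: a finite idempotent algebra (or a clone of idempotent operations on a finite set) has bounded width if it has terms $g_0$ (ternary), $h_0$ ($4$-ary) with $g_0(x,x,y)\approx g_0(x,y,x)\approx g_0(y,x,x)\approx h_0(x,x,x,y)\approx h_0(x,x,y,x)\approx h_0(x,y,x,x)\approx h_0(y,x,x,x)$. The clone $\operatorname{Clo}(g)$ generated by $g$ is minimal if it has bounded width and no proper subclone of it has bounded width. Minimal bounded width algebra: let $\mathcal{G}_k$ be the set of pairs $f,g$ with $g:\{1,\dots,k\}^3\to\{1,\dots,k\}$ idempotent and $g(x,x,y)\approx g(x,y,x)\approx g(y,x,x)\approx f(x,y)$, $f(f(x,y),f(y,x))\approx f(x,y)$, $g(g(x,y,z),g(y,z,x),g(z,x,y))\approx g(x,y,z)$; write $g'\preceq g$ if $g'\in\operatorname{Clo}(g)$, and call $g$ minimal if $g'\preceq g$, $g'\in\mathcal{G}_k$ imply $g\preceq g'$. A finite algebra $\mathbb{A}$ is a minimal bounded width algebra if it is isomorphic to an algebra with the same term operations as $(\{1,\dots,|\mathbb{A}|\},g)$ for some minimal $g\in\mathcal{G}_{|\mathbb{A}|}$. Intersecting families: a family $\mathcal{F}$ of subsets of $\{1,\dots,n\}$ is intersecting if $X\cap Y\ne\emptyset$ for all $X,Y\in\mathcal{F}$,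 and maximal if maximal under containment among such families. Standard pair: idempotent $f$ (binary), $g$ (ternary) form a standard pair if they satisfy the three identities in the definition of $\mathcal{G}_k$ and there is a family of idempotent terms $h_{\mathcal{F}}\in\operatorname{Clo}(g)$, indexed by the maximal intersecting families $\mathcal{F}$ of subsets of $\{1,\dots,n\}$, $n\ge2$, with $h_{\mathcal{F}}$ of arity $n$, such that: $h_{\mathcal{F}}(a_1,\dots,a_n)\approx f(x,y)$ whenever $\{a_1,\dots,a_n\}=\{x,y\}$ and $\{i\mid a_i=x\}\in\mathcal{F}$; $g=h_{\mathcal{M}}$ for $\mathcal{M}=\{\{1,2\},\{1,3\},\{2,3\},\{1,2,3\}\}$; and for any binary term $t$ in the clone generated by the $h_{\mathcal{F}}$ and any distinct $a,b$ in an algebra of the variety generated by $\mathbb{A}$, $t(a,b)=t(b,a)=a$ implies $f(a,b)=f(b,a)=a$. Yellow connectivity: for a subalgebra $\mathbb{B}$ of $\mathbb{A}_f$ and $x,y\in\mathbb{B}$ write $x\to y$ if $f(x,y)=f(y,x)=y$. A subset $U\subseteq\mathbb{B}$ is upwards closed if $x\in U$, $y\in\mathbb{B}$, $x\to y$ imply $y\in U$. $\mathbb{B}$ is yellow connected if for any pair of nonempty upwards closed subsets $U,V$ of $\mathbb{B}$ there are $u\in U$ and $v\in V$ such that $f$ acts as first projection on $\{u,v\}$, that is, $f(u,v)=u$ and $f(v,u)=v$. $\mathbb{A}_f$ is hereditarily yellow connected if every (nonempty) subalgebra of $\mathbb{A}_f$ is yellow connected. *)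

theory Defs
  imports Main "HOL-Library.FuncSet" "HOL-Library.Countable_Set"
begin
text \<open>An \<open>n\<close>-ary operation on \<open>A\<close> is a function on lists of length \<open>n\<close>. Operations are
  extensional, so that equality of operations is equality on all tuples from \<open>A\<close>. Sets of
  operations consist of pairs of an arity and an operation of that arity.\<close>

definition tuples :: "'a set \<Rightarrow> nat \<Rightarrow> 'a list set" where
  "tuples A n = {xs. length xs = n \<and> set xs \<subseteq> A}"

definition operations :: "'a set \<Rightarrow> nat \<Rightarrow> ('a list \<Rightarrow> 'a) set" where
  "operations A n = tuples A n \<rightarrow>\<^sub>E A"

definition projection :: "'a set \<Rightarrow> nat \<Rightarrow> nat \<Rightarrow> 'a list \<Rightarrow> 'a" where
  "projection A n i = (\<lambda>xs\<in>tuples A n. xs ! i)"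

definition composition ::
    "'a set \<Rightarrow> nat \<Rightarrow> ('a list \<Rightarrow> 'a) \<Rightarrow> ('a list \<Rightarrow> 'a) list \<Rightarrow> 'a list \<Rightarrow> 'a" where
  "composition A n p qs = (\<lambda>xs\<in>tuples A n. p (map (\<lambda>q. q xs) qs))"

definition op2 :: "'a set \<Rightarrow> ('a \<Rightarrow> 'a \<Rightarrow> 'a) \<Rightarrow> 'a list \<Rightarrow> 'a" where
  "op2 A f = (\<lambda>xs\<in>tuples A 2. f (xs ! 0) (xs ! 1))"

definition op3 :: "'a set \<Rightarrow> ('a \<Rightarrow> 'a \<Rightarrow> 'a \<Rightarrow> 'a) \<Rightarrow> 'a list \<Rightarrow> 'a" where
  "op3 A g = (\<lambda>xs\<in>tuples A 3. g (xs ! 0) (xs ! 1) (xs ! 2))"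

definition clone :: "'a set \<Rightarrow> (nat \<times> ('a list \<Rightarrow> 'a)) set \<Rightarrow> bool" where
  "clone A C \<longleftrightarrow>
     (\<forall>n p. (n, p) \<in> C \<longrightarrow> p \<in> operations A n) \<and>
     (\<forall>n i. i < n \<longrightarrow> (n, projection A n i) \<in> C) \<and>
     (\<forall>n k p qs. (k, p) \<in> C \<longrightarrow> length qs = k \<longrightarrow> (\<forall>q\<in>set qs. (n, q) \<in> C) \<longrightarrow>
        (n, composition A n p qs) \<in> C)"

inductive_set Clo :: "'a set \<Rightarrow> (nat \<times> ('a list \<Rightarrow> 'a)) set \<Rightarrow> (nat \<times> ('a list \<Rightarrow> 'a)) set"
  for A :: "'a set" and R :: "(nat \<times> ('a list \<Rightarrow> 'a)) set" where
  proj: "i < n \<Longrightarrow> (n, projection A n i) \<in> Clo A R"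
| comp: "(k, p) \<in> R \<Longrightarrow> length qs = k \<Longrightarrow> \<forall>q\<in>set qs. (n, q) \<in> Clo A R \<Longrightarrow>
    (n, composition A n p qs) \<in> Clo A R"

lemma Clo_least:
  assumes "clone A C" and "R \<subseteq> C"
  shows "Clo A R \<subseteq> C"
proof -
  have "(n, p) \<in> C" if "(n, p) \<in> Clo A R" for n p
    using that
  proof (induction rule: Clo.induct)
    case (proj i n)
    then show ?case using assms(1) by (simp add: clone_def)
  next
    case (comp k p qs n)
    then have "(k, p) \<in> C" "\<forall>q\<in>set qs. (n, q) \<in> C" using assms(2) by auto
    then show ?case using assms(1) comp(2) unfolding clone_def by blast
  qed
  then show ?thesis by auto
qed

lemma Clo_operations:
  assumes R: "\<And>n p. (n, p) \<in> R \<Longrightarrow> p \<in> operations A n" and "(n, p) \<in> Clo A R"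
  shows "p \<in> operations A n"
  using assms(2)
proof (induction rule: Clo.induct)
  case (proj i n)
  then have "\<And>xs. xs \<in> tuples A n \<Longrightarrow> xs ! i \<in> A" by (force simp: tuples_def)
  then show ?case
    unfolding operations_def projection_def by (intro restrict_PiE_iff[THEN iffD2] ballI)
next
  case (comp k p qs n)
  have "p (map (\<lambda>q. q xs) qs) \<in> A" if "xs \<in> tuples A n" for xs
  proof -
    have "map (\<lambda>q. q xs) qs \<in> tuples A k"
      using comp(2,3) that unfolding tuples_def operations_def by fastforce
    then show ?thesis using R[OF comp(1)] unfolding operations_def by blast
  qed
  then show ?case
    unfolding operations_def composition_def by (intro restrict_PiE_iff[THEN iffD2] ballI)
qed

lemma clone_Clo:
  assumes R: "\<And>n p. (n, p) \<in> R \<Longrightarrow> p \<in> operations A n"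
  shows "clone A (Clo A R)" and "R \<subseteq> Clo A R"
proof -
  have sup: "(m, composition A m p qs) \<in> Clo A R"
    if "(n, p) \<in> Clo A R" "length qs = n" "\<forall>q\<in>set qs. (m, q) \<in> Clo A R" for n m p qs
    using that
  proof (induction arbitrary: qs rule: Clo.induct)
    case (proj i n)
    have qi: "(m, qs ! i) \<in> Clo A R" using proj by auto
    have ops: "q \<in> operations A m" if "q \<in> set qs" for q
      using Clo_operations[OF R] proj(3) that by blast
    have "composition A m (projection A n i) qs = qs ! i"
    proof
      fix xs
      show "composition A m (projection A n i) qs xs = (qs ! i) xs"
      proof (cases "xs \<in> tuples A m")
        case True
        then have "map (\<lambda>q. q xs) qs \<in> tuples A n"
          using ops proj(2) unfolding tuples_def operations_def by fastforce
        then show ?thesis using True proj by (simp add: composition_def projection_def)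
      next
        case False
        have "qs ! i \<in> operations A m" using ops proj by auto
        then show ?thesis using False
          by (auto simp: composition_def operations_def PiE_def extensional_def)
      qed
    qed
    then show ?case using qi by simp
  next
    case (comp k p rs n)
    have ops: "q \<in> operations A m" if "q \<in> set qs" for q
      using Clo_operations[OF R] comp.prems(2) that by blast
    let ?rs = "map (\<lambda>r. composition A m r qs) rs"
    have "(m, composition A m p ?rs) \<in> Clo A R"
      by (rule Clo.comp[OF comp(1)]) (use comp in auto)
    moreover have "composition A m (composition A n p rs) qs = composition A m p ?rs"
    proof
      fix xs
      show "composition A m (composition A n p rs) qs xs = composition A m p ?rs xs"
      proof (cases "xs \<in> tuples A m")
        case True
        then have "map (\<lambda>q. q xs) qs \<in> tuples A n"
          using ops comp.prems(1) unfolding tuples_def operations_def by fastforce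
        then show ?thesis using True by (simp add: composition_def comp_def)
      qed (simp add: composition_def)
    qed
    ultimately show ?case by simp
  qed
  show "clone A (Clo A R)"
    unfolding clone_def
  proof (intro conjI allI impI)
    show "p \<in> operations A n" if "(n, p) \<in> Clo A R" for n p
      by (rule Clo_operations[OF _ that]) (rule R)
    show "(n, projection A n i) \<in> Clo A R" if "i < n" for n i
      using that by (rule Clo.proj)
    show "(n, composition A n p qs) \<in> Clo A R"
      if "(k, p) \<in> Clo A R" "length qs = k" "\<forall>q\<in>set qs. (n, q) \<in> Clo A R" for n k p qs
      using that by (rule sup)
  qed
  show "R \<subseteq> Clo A R"
  proof
    fix np assume "np \<in> R"
    then obtain n p where np: "np = (n, p)" "(n, p) \<in> R" by (cases np) auto
    let ?qs = "map (projection A n) [0..<n]"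
    have "(n, composition A n p ?qs) \<in> Clo A R"
      by (rule Clo.comp[OF np(2)]) (auto intro: Clo.proj)
    moreover have "composition A n p ?qs = p"
    proof
      fix xs
      show "composition A n p ?qs xs = p xs"
      proof (cases "xs \<in> tuples A n")
        case True
        then have "map (\<lambda>q. q xs) ?qs = map ((!) xs) [0..<length xs]"
          by (auto simp: projection_def tuples_def)
        then have "map (\<lambda>q. q xs) ?qs = xs" by (simp only: map_nth)
        then show ?thesis using True by (simp add: composition_def)
      next
        case False
        then show ?thesis using R[OF np(2)]
          by (auto simp: composition_def operations_def PiE_def extensional_def)
      qed
    qed
    ultimately show "np \<in> Clo A R" using np by simp
  qed
qed

definition bounded_width :: "'a set \<Rightarrow> (nat \<times> ('a list \<Rightarrow> 'a)) set \<Rightarrow> bool" where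
  "bounded_width A C \<longleftrightarrow>
     finite A \<and> clone A C \<and>
     (\<forall>n p. (n, p) \<in> C \<longrightarrow> (\<forall>x\<in>A. p (replicate n x) = x)) \<and>
     (\<exists>g0 h0. (3, g0) \<in> C \<and> (4, h0) \<in> C \<and>
        (\<forall>x\<in>A. \<forall>y\<in>A.
           g0 [x, x, y] = g0 [x, y, x] \<and>
           g0 [x, y, x] = g0 [y, x, x] \<and>
           g0 [y, x, x] = h0 [x, x, x, y] \<and>
           h0 [x, x, x, y] = h0 [x, x, y, x] \<and>
           h0 [x, x, y, x] = h0 [x, y, x, x] \<and>
           h0 [x, y, x, x] = h0 [y, x, x, x]))"

definition minimal_bounded_width_clone :: "'a set \<Rightarrow> (nat \<times> ('a list \<Rightarrow> 'a)) set \<Rightarrow> bool" where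
  "minimal_bounded_width_clone A C \<longleftrightarrow>
     bounded_width A C \<and> (\<forall>D. clone A D \<longrightarrow> D \<subset> C \<longrightarrow> \<not> bounded_width A D)"

definition fg_algebra :: "'a set \<Rightarrow> ('a \<Rightarrow> 'a \<Rightarrow> 'a) \<Rightarrow> ('a \<Rightarrow> 'a \<Rightarrow> 'a \<Rightarrow> 'a) \<Rightarrow> bool" where
  "fg_algebra A f g \<longleftrightarrow>
     A \<noteq> {} \<and> (\<forall>x\<in>A. \<forall>y\<in>A. f x y \<in> A) \<and> (\<forall>x\<in>A. \<forall>y\<in>A. \<forall>z\<in>A. g x y z \<in> A)"

definition fg_identities :: "'a set \<Rightarrow> ('a \<Rightarrow> 'a \<Rightarrow> 'a) \<Rightarrow> ('a \<Rightarrow> 'a \<Rightarrow> 'a \<Rightarrow> 'a) \<Rightarrow> bool" where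
  "fg_identities A f g \<longleftrightarrow>
     (\<forall>x\<in>A. \<forall>y\<in>A. g x x y = f x y \<and> g x y x = f x y \<and> g y x x = f x y) \<and>
     (\<forall>x\<in>A. \<forall>y\<in>A. f (f x y) (f y x) = f x y) \<and>
     (\<forall>x\<in>A. \<forall>y\<in>A. \<forall>z\<in>A. g (g x y z) (g y z x) (g z x y) = g x y z)"

definition calG :: "nat \<Rightarrow> ((nat \<Rightarrow> nat \<Rightarrow> nat) \<times> (nat \<Rightarrow> nat \<Rightarrow> nat \<Rightarrow> nat)) set" where
  "calG k = {(f, g).
     (\<forall>x\<in>{1..k}. \<forall>y\<in>{1..k}. \<forall>z\<in>{1..k}. g x y z \<in> {1..k}) \<and>
     (\<forall>x\<in>{1..k}. g x x x = x) \<and>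
     fg_identities {1..k} f g}"

definition preceq :: "nat \<Rightarrow> (nat \<Rightarrow> nat \<Rightarrow> nat \<Rightarrow> nat) \<Rightarrow> (nat \<Rightarrow> nat \<Rightarrow> nat \<Rightarrow> nat) \<Rightarrow> bool" where
  "preceq k g' g \<longleftrightarrow> (3, op3 {1..k} g') \<in> Clo {1..k} {(3, op3 {1..k} g)}"

definition minimal_in_calG :: "nat \<Rightarrow> (nat \<Rightarrow> nat \<Rightarrow> nat \<Rightarrow> nat) \<Rightarrow> bool" where
  "minimal_in_calG k g \<longleftrightarrow>
     (\<exists>f. (f, g) \<in> calG k) \<and>
     (\<forall>f' g'. (f', g') \<in> calG k \<longrightarrow> preceq k g' g \<longrightarrow> preceq k g g')"

definition fg_isomorphism where
  "fg_isomorphism \<phi> A f g B f' g' \<longleftrightarrow>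
     bij_betw \<phi> A B \<and>
     (\<forall>x\<in>A. \<forall>y\<in>A. \<phi> (f x y) = f' (\<phi> x) (\<phi> y)) \<and>
     (\<forall>x\<in>A. \<forall>y\<in>A. \<forall>z\<in>A. \<phi> (g x y z) = g' (\<phi> x) (\<phi> y) (\<phi> z))"

definition minimal_bounded_width_algebra ::
    "'a set \<Rightarrow> ('a \<Rightarrow> 'a \<Rightarrow> 'a) \<Rightarrow> ('a \<Rightarrow> 'a \<Rightarrow> 'a \<Rightarrow> 'a) \<Rightarrow> bool" where
  "minimal_bounded_width_algebra A f g \<longleftrightarrow>
     finite A \<and> fg_algebra A f g \<and>
     (\<exists>\<phi> f1 g1 g0. let K = {1..card A} in
        fg_isomorphism \<phi> A f g K f1 g1 \<and>
        minimal_in_calG (card A) g0 \<and>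
        Clo K {(2, op2 K f1), (3, op3 K g1)} = Clo K {(3, op3 K g0)})"

datatype trm = Var nat | F trm trm | G trm trm trm

primrec vars :: "trm \<Rightarrow> nat set" where
  "vars (Var i) = {i}"
| "vars (F s t) = vars s \<union> vars t"
| "vars (G s t u) = vars s \<union> vars t \<union> vars u"

primrec eval ::
    "('a \<Rightarrow> 'a \<Rightarrow> 'a) \<Rightarrow> ('a \<Rightarrow> 'a \<Rightarrow> 'a \<Rightarrow> 'a) \<Rightarrow> (nat \<Rightarrow> 'a) \<Rightarrow> trm \<Rightarrow> 'a" where
  "eval f g \<rho> (Var i) = \<rho> i"
| "eval f g \<rho> (F s t) = f (eval f g \<rho> s) (eval f g \<rho> t)"
| "eval f g \<rho> (G s t u) = g (eval f g \<rho> s) (eval f g \<rho> t) (eval f g \<rho> u)"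

definition term_operation ::
    "'a set \<Rightarrow> ('a \<Rightarrow> 'a \<Rightarrow> 'a) \<Rightarrow> ('a \<Rightarrow> 'a \<Rightarrow> 'a \<Rightarrow> 'a) \<Rightarrow> nat \<Rightarrow> trm \<Rightarrow> 'a list \<Rightarrow> 'a" where
  "term_operation A f g n t = (\<lambda>xs\<in>tuples A n. eval f g ((!) xs) t)"

definition satisfies ::
    "'a set \<Rightarrow> ('a \<Rightarrow> 'a \<Rightarrow> 'a) \<Rightarrow> ('a \<Rightarrow> 'a \<Rightarrow> 'a \<Rightarrow> 'a) \<Rightarrow> trm \<Rightarrow> trm \<Rightarrow> bool" where
  "satisfies A f g s t \<longleftrightarrow> (\<forall>\<rho>. range \<rho> \<subseteq> A \<longrightarrow> eval f g \<rho> s = eval f g \<rho> t)"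

definition in_variety ::
    "'a set \<Rightarrow> ('a \<Rightarrow> 'a \<Rightarrow> 'a) \<Rightarrow> ('a \<Rightarrow> 'a \<Rightarrow> 'a \<Rightarrow> 'a) \<Rightarrow>
     'b set \<Rightarrow> ('b \<Rightarrow> 'b \<Rightarrow> 'b) \<Rightarrow> ('b \<Rightarrow> 'b \<Rightarrow> 'b \<Rightarrow> 'b) \<Rightarrow> bool" where
  "in_variety A f g B f' g' \<longleftrightarrow>
     fg_algebra B f' g' \<and> (\<forall>s t. satisfies A f g s t \<longrightarrow> satisfies B f' g' s t)"

definition intersecting :: "nat \<Rightarrow> nat set set \<Rightarrow> bool" where
  "intersecting n \<F> \<longleftrightarrow> \<F> \<subseteq> Pow {1..n} \<and> (\<forall>X\<in>\<F>. \<forall>Y\<in>\<F>. X \<inter> Y \<noteq> {})"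

definition maximal_intersecting :: "nat \<Rightarrow> nat set set \<Rightarrow> bool" where
  "maximal_intersecting n \<F> \<longleftrightarrow>
     intersecting n \<F> \<and> (\<forall>\<F>'. intersecting n \<F>' \<longrightarrow> \<F> \<subseteq> \<F>' \<longrightarrow> \<F>' = \<F>)"

text \<open>Any two elements of an algebra generate a countable subalgebra, so nothing is lost by
  taking the algebras of the variety below on subsets of \<^typ>\<open>nat\<close>; see
  \<open>binary_absorption_any_type\<close>. Being a term, \<open>t\<close> has an interpretation in each of them; that
  it lies in the clone generated by the operations \<open>h\<close> is a condition on its operation on \<open>A\<close>.\<close>

definition binary_absorption ::
    "'b itself \<Rightarrow> 'a set \<Rightarrow> ('a \<Rightarrow> 'a \<Rightarrow> 'a) \<Rightarrow> ('a \<Rightarrow> 'a \<Rightarrow> 'a \<Rightarrow> 'a) \<Rightarrow>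
     (nat \<times> ('a list \<Rightarrow> 'a)) set \<Rightarrow> bool" where
  "binary_absorption _ A f g C \<longleftrightarrow>
     (\<forall>t. vars t \<subseteq> {..<2} \<longrightarrow> (2, term_operation A f g 2 t) \<in> C \<longrightarrow>
       (\<forall>(B :: 'b set) f' g' a b. in_variety A f g B f' g' \<longrightarrow> a \<in> B \<longrightarrow> b \<in> B \<longrightarrow> a \<noteq> b \<longrightarrow>
          eval f' g' ((!) [a, b]) t = a \<longrightarrow> eval f' g' ((!) [b, a]) t = a \<longrightarrow>
          f' a b = a \<and> f' b a = a))"

definition standard_pair :: "'a set \<Rightarrow> ('a \<Rightarrow> 'a \<Rightarrow> 'a) \<Rightarrow> ('a \<Rightarrow> 'a \<Rightarrow> 'a \<Rightarrow> 'a) \<Rightarrow> bool" where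
  "standard_pair A f g \<longleftrightarrow>
     (\<forall>x\<in>A. f x x = x) \<and> (\<forall>x\<in>A. g x x x = x) \<and> fg_identities A f g \<and>
     (\<exists>h :: nat \<Rightarrow> nat set set \<Rightarrow> 'a list \<Rightarrow> 'a.
        (\<forall>n \<F>. n \<ge> 2 \<longrightarrow> maximal_intersecting n \<F> \<longrightarrow>
           (n, h n \<F>) \<in> Clo A {(3, op3 A g)} \<and>
           (\<forall>x\<in>A. h n \<F> (replicate n x) = x) \<and>
           (\<forall>x\<in>A. \<forall>y\<in>A. \<forall>as\<in>tuples A n.
              set as = {x, y} \<longrightarrow> {i \<in> {1..n}. as ! (i - 1) = x} \<in> \<F> \<longrightarrow> h n \<F> as = f x y)) \<and>
        h 3 {{1, 2}, {1, 3}, {2, 3}, {1, 2, 3}} = op3 A g \<and>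
        binary_absorption TYPE(nat) A f g
          (Clo A {(n, h n \<F>) | n \<F>. n \<ge> 2 \<and> maximal_intersecting n \<F>}))"

instance trm :: countable
  by countable_datatype

lemma binary_absorption_any_type:
  assumes nat: "binary_absorption TYPE(nat) A f g C"
  shows "binary_absorption TYPE('b) A f g C"
  unfolding binary_absorption_def
proof (intro allI impI)
  fix t and B :: "'b set" and f' g' a b
  assume t: "vars t \<subseteq> {..<2}" "(2, term_operation A f g 2 t) \<in> C"
    and B: "in_variety A f g B f' g'" and ab: "a \<in> B" "b \<in> B" "a \<noteq> b"
    and ta: "eval f' g' ((!) [a, b]) t = a" "eval f' g' ((!) [b, a]) t = a"
  define \<rho> where "\<rho> i = (if i = 0 then a else b)" for i :: nat
  define S where "S = range (eval f' g' \<rho>)"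
  have "countable S" unfolding S_def by simp
  then have inj: "inj_on (to_nat_on S) S" by (rule inj_on_to_nat_on)
  define e where "e = to_nat_on S"
  define d where "d = inv_into S e"
  have de: "d (e x) = x" if "x \<in> S" for x
    using inj that by (simp add: d_def e_def)
  have fS: "f' x y \<in> S" if xy: "x \<in> S" "y \<in> S" for x y
  proof -
    obtain s u where "x = eval f' g' \<rho> s" "y = eval f' g' \<rho> u" using xy by (auto simp: S_def)
    then have "f' x y = eval f' g' \<rho> (F s u)" by simp
    then show ?thesis unfolding S_def by blast
  qed
  have gS: "g' x y z \<in> S" if xyz: "x \<in> S" "y \<in> S" "z \<in> S" for x y z
  proof -
    obtain s u v where "x = eval f' g' \<rho> s" "y = eval f' g' \<rho> u" "z = eval f' g' \<rho> v"
      using xyz by (auto simp: S_def)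
    then have "g' x y z = eval f' g' \<rho> (G s u v)" by simp
    then show ?thesis unfolding S_def by blast
  qed
  have "a = eval f' g' \<rho> (Var 0)" "b = eval f' g' \<rho> (Var 1)" by (simp_all add: \<rho>_def)
  then have aS: "a \<in> S" and bS: "b \<in> S" unfolding S_def by blast+
  have evalB: "eval f' g' \<sigma> s \<in> B" if "range \<sigma> \<subseteq> B" for \<sigma> s
    using that B by (induction s) (auto simp: in_variety_def fg_algebra_def)
  have SB: "S \<subseteq> B" unfolding S_def using ab evalB[of \<rho>] by (auto simp: \<rho>_def)
  define fn where "fn x y = e (f' (d x) (d y))" for x y
  define gn where "gn x y z = e (g' (d x) (d y) (d z))" for x y z
  have ev: "eval f' g' \<sigma> s \<in> S \<and> eval fn gn \<tau> s = e (eval f' g' \<sigma> s)"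
    if "\<forall>i\<in>vars s. \<sigma> i \<in> S \<and> \<tau> i = e (\<sigma> i)" for \<sigma> \<tau> s
    using that by (induction s) (auto simp: fn_def gn_def de fS gS)
  have pair: "\<forall>i\<in>vars t. [x, y] ! i \<in> S \<and> [e x, e y] ! i = e ([x, y] ! i)"
    if "x \<in> S" "y \<in> S" for x y
  proof
    fix i assume "i \<in> vars t"
    then have "i = 0 \<or> i = 1" using t(1) by fastforce
    then show "[x, y] ! i \<in> S \<and> [e x, e y] ! i = e ([x, y] ! i)" using that by auto
  qed
  have "in_variety A f g (e ` S) fn gn"
    unfolding in_variety_def
  proof (intro conjI allI impI)
    show "fg_algebra (e ` S) fn gn"
      using aS by (auto simp: fg_algebra_def fn_def gn_def de fS gS)
    fix s u assume "satisfies A f g s u"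
    then have su: "satisfies B f' g' s u" using B by (simp add: in_variety_def)
    show "satisfies (e ` S) fn gn s u"
      unfolding satisfies_def
    proof (intro allI impI)
      fix \<tau> :: "nat \<Rightarrow> nat" assume \<tau>: "range \<tau> \<subseteq> e ` S"
      define \<sigma> where "\<sigma> = d \<circ> \<tau>"
      have \<sigma>: "\<sigma> i \<in> S \<and> \<tau> i = e (\<sigma> i)" for i
      proof -
        obtain x where "x \<in> S" "\<tau> i = e x" using \<tau> by blast
        then show ?thesis by (simp add: \<sigma>_def de)
      qed
      then have "range \<sigma> \<subseteq> B" using SB by auto
      then have "eval f' g' \<sigma> s = eval f' g' \<sigma> u" using su by (simp add: satisfies_def)
      then show "eval fn gn \<tau> s = eval fn gn \<tau> u" using ev \<sigma> by metis
    qed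
  qed
  moreover have "eval fn gn ((!) [e a, e b]) t = e a" "eval fn gn ((!) [e b, e a]) t = e a"
    using ev[OF pair[OF aS bS]] ev[OF pair[OF bS aS]] ta by simp_all
  moreover have "e a \<noteq> e b" using de aS bS ab by metis
  ultimately have "fn (e a) (e b) = e a \<and> fn (e b) (e a) = e a"
    using nat t aS bS unfolding binary_absorption_def by blast
  then have "e (f' a b) = e a" "e (f' b a) = e a" by (simp_all add: fn_def de aS bS)
  then show "f' a b = a \<and> f' b a = a" using de fS aS bS by metis
qed

definition subalgebra :: "'a set \<Rightarrow> ('a \<Rightarrow> 'a \<Rightarrow> 'a) \<Rightarrow> 'a set \<Rightarrow> bool" where
  "subalgebra A f B \<longleftrightarrow> B \<subseteq> A \<and> (\<forall>x\<in>B. \<forall>y\<in>B. f x y \<in> B)"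

definition arrow :: "('a \<Rightarrow> 'a \<Rightarrow> 'a) \<Rightarrow> 'a \<Rightarrow> 'a \<Rightarrow> bool" where
  "arrow f x y \<longleftrightarrow> f x y = y \<and> f y x = y"

definition upwards_closed :: "('a \<Rightarrow> 'a \<Rightarrow> 'a) \<Rightarrow> 'a set \<Rightarrow> 'a set \<Rightarrow> bool" where
  "upwards_closed f B U \<longleftrightarrow> U \<subseteq> B \<and> (\<forall>x\<in>U. \<forall>y\<in>B. arrow f x y \<longrightarrow> y \<in> U)"

definition yellow_connected :: "('a \<Rightarrow> 'a \<Rightarrow> 'a) \<Rightarrow> 'a set \<Rightarrow> bool" where
  "yellow_connected f B \<longleftrightarrow>
     (\<forall>U V. upwards_closed f B U \<longrightarrow> U \<noteq> {} \<longrightarrow> upwards_closed f B V \<longrightarrow> V \<noteq> {} \<longrightarrow>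
        (\<exists>u\<in>U. \<exists>v\<in>V. f u v = u \<and> f v u = v))"

definition hereditarily_yellow_connected :: "'a set \<Rightarrow> ('a \<Rightarrow> 'a \<Rightarrow> 'a) \<Rightarrow> bool" where
  "hereditarily_yellow_connected A f \<longleftrightarrow>
     (\<forall>B. subalgebra A f B \<longrightarrow> B \<noteq> {} \<longrightarrow> yellow_connected f B)"

end

(*
  Call f-terms in two variables p and q a pattern if, for every odd n, some terms of the algebra turn
  each n-tuple consisting of a majority of x and a minority of y into one with p(x, y) at the places of
  the majority and q(x, y) at those of the minority. A value k(x, y) with (k, k) a pattern is global.
  The terms of the standard pair make (f, f) a pattern, and voting over lists of tuple entries gives
  closure rules for patterns. Minimality of the clone says that a global k can only be the first
  projection on {u, v} if f is. The absorption property of the standard pair gives a binary term s with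
  x -> s(x, y) for all x, y and s(x, y) = y whenever x -> y.

  By induction on |B|, every subalgebra B is yellow connected and, for U upwards closed in B, a in U and
  b in B, some global value of (a, b) lies in U. For the second property one minimises the down-closure
  of the global values, then the set of patterns, and a yellow edge inside a smaller subalgebra
  yields an edge x -> w out of U. For the first property, suppose U and V have no yellow edge between
  them. Choose (a, b) in U x V with the fewest patterns in the square; then no global value of the square
  lies in U x V. If all elements of V generate B as a right ideal, a yellow edge in a subalgebra of the
  square moves (a, w) with w in V to a place where the second property applies; the same holds for U.
  Otherwise U and V meet proper right ideals, which are yellow connected with their product, so an
  exact triple climbs to a global value in U x V.
*)
theory Submission
  imports Defs
begin

section \<open>Binary terms, reachability and yellow edges\<close>

text \<open>Minimality can be used only by exhibiting a subclone of bounded width, which a single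
  binary term does not provide. A global \<open>k\<close> provides one: its terms for three and for
  five variables return \<open>k(x, y)\<close> whenever \<open>x\<close> holds the majority and
  \<open>y\<close> the remaining places, and this gives the identities of bounded width. To obtain a
  yellow edge it is therefore enough to find one global term with \<open>k(u, v) = u\<close> and
  \<open>k(v, u) = v\<close>. This explains the square and its generators \<open>(a, b)\<close> and
  \<open>(b, a)\<close>: its global values record \<open>k(a, b)\<close> and \<open>k(b, a)\<close>
  together. The obstacle is that a wanted value is often reached only at the majority places or only
  at the minority places. Patterns keep track of such partial successes. Exact triples refine them,
  since a vote over several places has a third outcome when the places disagree. Choosing a pair
  with fewest patterns makes the moves that stay inside the allowed sets reversible: a value
  obtained from the original pair is then also obtained from the new one.\<close>

datatype bt = VX | VY | App bt bt

primrec bev :: "('x \<Rightarrow> 'x \<Rightarrow> 'x) \<Rightarrow> bt \<Rightarrow> 'x \<Rightarrow> 'x \<Rightarrow> 'x" where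
  "bev M VX x y = x"
| "bev M VY x y = y"
| "bev M (App s t) x y = M (bev M s x y) (bev M t x y)"

primrec sub :: "bt \<Rightarrow> bt \<Rightarrow> bt \<Rightarrow> bt" where
  "sub VX p q = p"
| "sub VY p q = q"
| "sub (App s t) p q = App (sub s p q) (sub t p q)"

text \<open>On a yellow pair every term returns its leftmost variable, so these are the terms that
  act there as first projection.\<close>

primrec leftmost :: "bt \<Rightarrow> bool" where
  "leftmost VX = True"
| "leftmost VY = False"
| "leftmost (App s t) = leftmost s"

lemma bev_sub [simp]: "bev M (sub t p q) x y = bev M t (bev M p x y) (bev M q x y)"
  by (induction t) auto

lemma leftmost_sub: "leftmost t \<Longrightarrow> leftmost p \<Longrightarrow> leftmost (sub t p q)"
  by (induction t) auto

section \<open>Generated subalgebras, yellow pairs and upward closures\<close>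

definition op_closed :: "('x \<Rightarrow> 'x \<Rightarrow> 'x) \<Rightarrow> 'x set \<Rightarrow> bool" where
  "op_closed M S \<longleftrightarrow> (\<forall>x\<in>S. \<forall>y\<in>S. M x y \<in> S)"

definition gen :: "('x \<Rightarrow> 'x \<Rightarrow> 'x) \<Rightarrow> 'x \<Rightarrow> 'x \<Rightarrow> 'x set" where
  "gen M x y = range (\<lambda>t. bev M t x y)"

definition yellow :: "('x \<Rightarrow> 'x \<Rightarrow> 'x) \<Rightarrow> 'x \<Rightarrow> 'x \<Rightarrow> bool" where
  "yellow M u v \<longleftrightarrow> M u v = u \<and> M v u = v"

definition up :: "('x \<Rightarrow> 'x \<Rightarrow> 'x) \<Rightarrow> 'x set \<Rightarrow> 'x \<Rightarrow> 'x set" where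
  "up M K u = {v. (u, v) \<in> {(x, y). x \<in> K \<and> y \<in> K \<and> arrow M x y}\<^sup>*}"

definition hyc :: "('x \<Rightarrow> 'x \<Rightarrow> 'x) \<Rightarrow> 'x set \<Rightarrow> bool" where
  "hyc M K \<longleftrightarrow> (\<forall>L. L \<subseteq> K \<longrightarrow> op_closed M L \<longrightarrow> L \<noteq> {} \<longrightarrow> yellow_connected M L)"

lemma op_closedD: "op_closed M S \<Longrightarrow> x \<in> S \<Longrightarrow> y \<in> S \<Longrightarrow> M x y \<in> S"
  by (simp add: op_closed_def)

lemma op_closed_bev: "op_closed M S \<Longrightarrow> x \<in> S \<Longrightarrow> y \<in> S \<Longrightarrow> bev M t x y \<in> S"
  by (induction t) (auto simp: op_closed_def)

lemma bev_idem: "M x x = x \<Longrightarrow> bev M t x x = x"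
  by (induction t) auto

lemma bev_yellow: "M u u = u \<Longrightarrow> M v v = v \<Longrightarrow> yellow M u v \<Longrightarrow> bev M t u v = (if leftmost t then u else v)"
  by (induction t) (auto simp: yellow_def)

lemma op_closed_gen: "op_closed M (gen M x y)"
  unfolding op_closed_def
proof (intro ballI)
  fix u v assume "u \<in> gen M x y" "v \<in> gen M x y"
  then obtain s t where "u = bev M s x y" "v = bev M t x y" by (auto simp: gen_def)
  then have "M u v = bev M (App s t) x y" by simp
  then show "M u v \<in> gen M x y" unfolding gen_def by blast
qed

lemma gen_bev: "bev M t x y \<in> gen M x y"
  by (simp add: gen_def)

lemma genE: assumes "u \<in> gen M x y" obtains t where "u = bev M t x y"
  using assms by (auto simp: gen_def)

lemma gen_left: "x \<in> gen M x y" and gen_right: "y \<in> gen M x y"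
  using gen_bev[of M VX x y] gen_bev[of M VY x y] by simp_all

lemma gen_least: "op_closed M S \<Longrightarrow> x \<in> S \<Longrightarrow> y \<in> S \<Longrightarrow> gen M x y \<subseteq> S"
  by (auto simp: gen_def op_closed_bev)

lemma gen_subset: "u \<in> gen M x y \<Longrightarrow> v \<in> gen M x y \<Longrightarrow> gen M u v \<subseteq> gen M x y"
  by (intro gen_least op_closed_gen)

lemma up_refl: "u \<in> up M K u"
  by (simp add: up_def)

lemma up_step: "v \<in> up M K u \<Longrightarrow> v \<in> K \<Longrightarrow> w \<in> K \<Longrightarrow> arrow M v w \<Longrightarrow> w \<in> up M K u"
  unfolding up_def by (auto intro: rtrancl_into_rtrancl)

lemma up_trans: "v \<in> up M K u \<Longrightarrow> w \<in> up M K v \<Longrightarrow> w \<in> up M K u"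
  unfolding up_def by (auto intro: rtrancl_trans)

lemma up_induct [consumes 1, case_names base step]:
  assumes "v \<in> up M K u" and "P u"
    and "\<And>x y. x \<in> up M K u \<Longrightarrow> x \<in> K \<Longrightarrow> y \<in> K \<Longrightarrow> arrow M x y \<Longrightarrow> P x \<Longrightarrow> P y"
  shows "P v"
proof -
  have "(u, v) \<in> {(x, y). x \<in> K \<and> y \<in> K \<and> arrow M x y}\<^sup>*" using assms(1) by (simp add: up_def)
  then show ?thesis
  proof (induction rule: rtrancl_induct)
    case base show ?case by (rule assms(2))
  next
    case (step y z)
    then show ?case by (intro assms(3)[of y z]) (auto simp: up_def)
  qed
qed

lemma up_mono: assumes "K \<subseteq> L" shows "up M K u \<subseteq> up M L u"
proof
  fix v assume "v \<in> up M K u"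
  then show "v \<in> up M L u"
  proof (induction rule: up_induct)
    case base show ?case by (rule up_refl)
  next
    case (step x y) then show ?case using assms by (auto intro: up_step)
  qed
qed

lemma up_least:
  assumes U: "upwards_closed M B U" and "u \<in> U" and "K \<subseteq> B"
  shows "up M K u \<subseteq> U"
proof
  fix v assume "v \<in> up M K u"
  then show "v \<in> U"
  proof (induction rule: up_induct)
    case base show ?case by (rule assms(2))
  next
    case (step x y) then show ?case using U assms(3) by (auto simp: upwards_closed_def)
  qed
qed

lemma upwards_closed_self: "upwards_closed M K K"
  by (simp add: upwards_closed_def)

lemma up_subset: "u \<in> K \<Longrightarrow> up M K u \<subseteq> K"
  by (rule up_least[OF upwards_closed_self]) auto

lemma upwards_closed_up: "u \<in> K \<Longrightarrow> upwards_closed M K (up M K u)"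
  using up_subset[of u K M] by (auto simp: upwards_closed_def intro: up_step)

lemma upwards_closed_Int: "upwards_closed M B U \<Longrightarrow> K \<subseteq> B \<Longrightarrow> upwards_closed M K (U \<inter> K)"
  by (auto simp: upwards_closed_def)

lemma yellow_connectedD:
  assumes "yellow_connected M B" "upwards_closed M B U" "u \<in> U" "upwards_closed M B V" "v \<in> V"
  obtains x y where "x \<in> U" "y \<in> V" "yellow M x y"
  using assms unfolding yellow_connected_def yellow_def by blast

lemma hyc_mono: "hyc M K \<Longrightarrow> L \<subseteq> K \<Longrightarrow> hyc M L"
  unfolding hyc_def by blast

text \<open>If \<open>gen M u z\<close> is as small as possible, moving along arrows inside it does not change it; choosing
  in addition \<open>u\<close> in a maximal strong component makes all pairs in the product of the two
  upward closures reachable.\<close>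

lemma climb:
  fixes M :: "'x \<Rightarrow> 'x \<Rightarrow> 'x" and w c :: 'x
  defines "K \<equiv> gen M w c"
  assumes fin: "finite K" and hyc: "hyc M K" and start: "St w c"
    and m1: "\<And>u z u'. St u z \<Longrightarrow> u \<in> K \<Longrightarrow> z \<in> K \<Longrightarrow> u' \<in> gen M u z \<Longrightarrow> arrow M u u' \<Longrightarrow> St u' z"
    and m2: "\<And>u z z'. St u z \<Longrightarrow> u \<in> K \<Longrightarrow> z \<in> K \<Longrightarrow> z' \<in> gen M u z \<Longrightarrow> arrow M z z' \<Longrightarrow>
      \<exists>u'\<in>gen M u z. arrow M u u' \<and> St u' z'"
  obtains u z where "St u z" "u \<in> up M K w" "z \<in> K" "yellow M u z"
proof -
  define N where "N = card K"
  \<comment> \<open>This is the lexicographic order on the two cardinalities: the second one never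
    exceeds \<open>N\<close>, so the factor \<open>N + 1\<close> lets the first one
    dominate.\<close>
  define m where "m = (\<lambda>(u, z). card (gen M u z) * (N + 1) + card (up M (gen M u z) u))"
  define P where "P = (\<lambda>(u, z). St u z \<and> u \<in> up M K w \<and> z \<in> K)"
  have wK: "w \<in> K" and cK: "c \<in> K" by (simp_all add: K_def gen_left gen_right)
  have "P (w, c)" using start cK by (simp add: P_def up_refl)
  then have "\<exists>p. P p \<and> (\<forall>q. P q \<longrightarrow> m p \<le> m q)" by (rule ex_has_least_nat)
  then obtain u z where uz: "P (u, z)" and least: "\<And>u' z'. P (u', z') \<Longrightarrow> m (u, z) \<le> m (u', z')"
    by (elim exE) auto
  define S0 where "S0 = gen M u z"
  have upK: "up M K w \<subseteq> K" using wK by (rule up_subset)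
  have uK: "u \<in> K" and zK: "z \<in> K" using uz upK by (auto simp: P_def)
  have GK: "S0 \<subseteq> K" unfolding S0_def using uK zK unfolding K_def by (rule gen_subset)
  have finG: "finite S0" using GK fin finite_subset by blast
  have uG: "u \<in> S0" and zG: "z \<in> S0" by (simp_all add: S0_def gen_left gen_right)
  have key: "gen M u' z' = S0 \<and> up M S0 u' = up M S0 u"
    if p: "P (u', z')" and u': "u' \<in> up M S0 u" and z': "z' \<in> S0" for u' z'
  proof -
    have u'S0: "u' \<in> S0" using u' up_subset[OF uG] by blast
    have sub: "gen M u' z' \<subseteq> S0" using u'S0 z' unfolding S0_def by (rule gen_subset)
    have "\<not> card (gen M u' z') < card S0"
    proof
      assume less: "card (gen M u' z') < card S0"
      have "card (up M (gen M u' z') u') \<le> card (gen M u' z')"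
        using finG sub by (intro card_mono up_subset gen_left) (rule finite_subset)
      also have "\<dots> \<le> N" unfolding N_def using sub GK by (intro card_mono fin) auto
      finally have 1: "card (up M (gen M u' z') u') \<le> N" .
      have "(card (gen M u' z') + 1) * (N + 1) \<le> card S0 * (N + 1)"
        using less by (intro mult_right_mono) auto
      then have "m (u', z') < m (u, z)" using 1 by (simp add: m_def S0_def)
      then show False using least[OF p] by simp
    qed
    moreover have "card (gen M u' z') \<le> card S0" by (rule card_mono[OF finG sub])
    ultimately have g: "gen M u' z' = S0" using card_subset_eq[OF finG sub] by simp
    have "up M S0 u' \<subseteq> up M S0 u" using u' up_trans by fast
    moreover have "card (up M S0 u) \<le> card (up M S0 u')"
      using least[OF p] g by (simp add: m_def S0_def)
    moreover have "finite (up M S0 u)" using up_subset[OF uG] finG finite_subset by blast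
    ultimately have "up M S0 u' = up M S0 u" using card_seteq by blast
    with g show ?thesis by simp
  qed
  \<comment> \<open>When the second entry follows an arrow, the first one may be forced to move. By
    \<open>key\<close> the generated subalgebra does not shrink on the way, so each further arrow of
    \<open>S0\<close> remains available.\<close>
  have A: "\<exists>u'. P (u', z') \<and> u' \<in> up M S0 u" if "z' \<in> up M S0 z" for z'
    using that
  proof (induction rule: up_induct)
    case base show ?case by (intro exI[of _ u] conjI uz up_refl)
  next
    case (step z1 z2)
    then obtain u' where u': "P (u', z1)" "u' \<in> up M S0 u" by blast
    have u'S0: "u' \<in> S0" using u' up_subset[OF uG] by blast
    have g: "gen M u' z1 = S0" using key[OF u'] step by blast
    obtain u'' where u'': "u'' \<in> S0" "arrow M u' u''" "St u'' z2"
      using m2[of u' z1 z2] u' step u'S0 GK g by (auto simp: P_def)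
    have "P (u'', z2)" using u' u'' u'S0 step GK by (auto simp: P_def intro: up_step)
    moreover have "u'' \<in> up M S0 u" using u' u'' u'S0 by (auto intro: up_step)
    ultimately show ?case by blast
  qed
  have B: "P (v, z') \<and> v \<in> up M S0 u"
    if "v \<in> up M S0 u'" and p: "P (u', z')" "u' \<in> up M S0 u" "z' \<in> S0" for u' z' v
    using that(1)
  proof (induction rule: up_induct)
    case base show ?case using p by simp
  next
    case (step x y)
    have g: "gen M x z' = S0" using key[of x z'] step p by blast
    have "St y z'" using m1[of x z' y] step g p GK by (auto simp: P_def)
    then show ?case using step GK by (auto simp: P_def intro: up_step)
  qed
  have "op_closed M S0" unfolding S0_def by (rule op_closed_gen)
  then have "yellow_connected M S0" using hyc GK uG unfolding hyc_def by auto
  then obtain x y where xy: "x \<in> up M S0 u" "y \<in> up M S0 z" "yellow M x y"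
    using upwards_closed_up[OF uG] up_refl upwards_closed_up[OF zG] up_refl by (rule yellow_connectedD)
  obtain u' where u': "P (u', y)" "u' \<in> up M S0 u" using A[OF xy(2)] by blast
  have yG: "y \<in> S0" using xy(2) up_subset[OF zG] by blast
  \<comment> \<open>While the second entry climbed to \<open>y\<close>, the first was displaced to
    \<open>u'\<close>. It can still reach \<open>x\<close>, because \<open>key\<close> makes the
    upward closures of \<open>u\<close> and \<open>u'\<close> equal.\<close>
  have "x \<in> up M S0 u'" using key[OF u' yG] xy(1) by simp
  then have "P (x, y)" using B u' yG by blast
  then show thesis using that xy(3) by (auto simp: P_def)
qed

section \<open>Direct squares\<close>

definition prod_op :: "('x \<Rightarrow> 'x \<Rightarrow> 'x) \<Rightarrow> 'x \<times> 'x \<Rightarrow> 'x \<times> 'x \<Rightarrow> 'x \<times> 'x" where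
  "prod_op M p q = (M (fst p) (fst q), M (snd p) (snd q))"

lemma bev_prod_op [simp]:
  "bev (prod_op M) t p q = (bev M t (fst p) (fst q), bev M t (snd p) (snd q))"
  by (induction t) (auto simp: prod_op_def)

lemma prod_op_simp [simp]: "prod_op M (x, x') (y, y') = (M x y, M x' y')"
  by (simp add: prod_op_def)

lemma arrow_prod_op: "arrow (prod_op M) p q \<longleftrightarrow> arrow M (fst p) (fst q) \<and> arrow M (snd p) (snd q)"
  by (auto simp: arrow_def prod_op_def prod_eq_iff)

lemma op_closed_Times: "op_closed M S \<Longrightarrow> op_closed M T \<Longrightarrow> op_closed (prod_op M) (S \<times> T)"
  by (auto simp: op_closed_def)

lemma upwards_closed_Times:
  "upwards_closed M B U \<Longrightarrow> upwards_closed M B V \<Longrightarrow> upwards_closed (prod_op M) (B \<times> B) (U \<times> V)"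
  by (auto simp: upwards_closed_def arrow_prod_op)

text \<open>The term \<open>sg\<close> makes arrows liftable: if \<open>x\<close> has an arrow to
  \<open>y\<close> and \<open>(x, x')\<close>, \<open>(y, y')\<close> lie in a subalgebra of the
  square, then so does \<open>(y, sg(x', y'))\<close>, and it is the target of an arrow from
  \<open>(x, x')\<close>.\<close>

locale psemilattice =
  fixes X :: "'x set" and M :: "'x \<Rightarrow> 'x \<Rightarrow> 'x" and sg :: bt
  assumes finX: "finite X" and clX: "op_closed M X"
    and idem: "\<And>x. x \<in> X \<Longrightarrow> M x x = x"
    and sg_arrow: "\<And>x y. x \<in> X \<Longrightarrow> y \<in> X \<Longrightarrow> arrow M x (bev M sg x y)"
    and sg_eq: "\<And>x y. x \<in> X \<Longrightarrow> y \<in> X \<Longrightarrow> arrow M x y \<Longrightarrow> bev M sg x y = y"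
begin

lemma sg_in_upwards_closed:
  assumes "upwards_closed M B U" "op_closed M B" "B \<subseteq> X" "x \<in> U" "y \<in> B"
  shows "bev M sg x y \<in> U"
proof -
  have "x \<in> B" using assms by (auto simp: upwards_closed_def)
  moreover have "bev M sg x y \<in> B" using assms \<open>x \<in> B\<close> by (intro op_closed_bev)
  ultimately show ?thesis using assms sg_arrow[of x y] by (auto simp: upwards_closed_def)
qed

lemma psemilattice_prod: "psemilattice (X \<times> X) (prod_op M) sg"
proof
  show "finite (X \<times> X)" using finX by simp
  show "op_closed (prod_op M) (X \<times> X)" using clX by (intro op_closed_Times)
qed (auto simp: idem arrow_prod_op sg_arrow sg_eq)

text \<open>The second coordinates that occur over a first coordinate in \<open>U1\<close>, or in
  \<open>U2\<close>, form upwards closed sets, since \<open>sg\<close> follows an arrow in the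
  second coordinate and moves the first along an arrow. The gain is that yellow connectivity is
  asked of \<open>gen M p2 q2\<close>, which can be proper even when the first coordinates generate
  everything.\<close>

lemma yellow_second_coordinate:
  assumes B: "B \<subseteq> X" "op_closed M B" and p: "p1 \<in> U1" "p2 \<in> W1" and q: "q1 \<in> U2" "q2 \<in> B"
    and up: "upwards_closed M B U1" "upwards_closed M B U2" "upwards_closed M B W1"
    and yc: "yellow_connected M (gen M p2 q2)"
  obtains x1 w1 x2 w2 where "x1 \<in> U1" "w1 \<in> W1" "x2 \<in> U2" "yellow M w1 w2" "w1 \<in> B" "w2 \<in> B"
    "(x1, w1) \<in> gen (prod_op M) (p1, p2) (q1, q2)" "(x2, w2) \<in> gen (prod_op M) (p1, p2) (q1, q2)"
proof -
  let ?N = "gen (prod_op M) (p1, p2) (q1, q2)" and ?K = "gen M p2 q2"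
  have in_B: "p1 \<in> B" "p2 \<in> B" "q1 \<in> B" using p q up by (auto simp: upwards_closed_def)
  have K: "?K \<subseteq> B" using B in_B q by (intro gen_least)
  have N: "?N \<subseteq> B \<times> B" using B in_B q by (intro gen_least op_closed_Times) auto
  have step: "\<exists>x'\<in>U. (x', w') \<in> ?N"
    if U: "upwards_closed M B U" and x: "x \<in> U" "(x, w) \<in> ?N" and w': "w' \<in> ?K" "arrow M w w'"
    for U x w w'
  proof -
    obtain t where t: "w' = bev M t p2 q2" using w'(1) by (rule genE)
    define y where "y = bev M t p1 q1"
    have yN: "(y, w') \<in> ?N" using gen_bev[of "prod_op M" t "(p1, p2)" "(q1, q2)"] by (simp add: t y_def)
    then have "bev (prod_op M) sg (x, w) (y, w') \<in> ?N" using x by (intro op_closed_bev op_closed_gen)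
    moreover have "bev M sg w w' = w'" using N B yN x w' by (intro sg_eq) auto
    moreover have "bev M sg x y \<in> U" using U B x yN N by (intro sg_in_upwards_closed) auto
    ultimately show ?thesis by auto
  qed
  let ?F1 = "{w \<in> ?K \<inter> W1. \<exists>x\<in>U1. (x, w) \<in> ?N}" and ?F2 = "{w \<in> ?K. \<exists>x\<in>U2. (x, w) \<in> ?N}"
  have "upwards_closed M ?K ?F1"
    unfolding upwards_closed_def
  proof (intro conjI ballI impI)
    fix w w' assume w: "w \<in> ?F1" and w': "w' \<in> ?K" "arrow M w w'"
    then have "\<exists>x\<in>U1. (x, w') \<in> ?N" using step[OF up(1)] by blast
    moreover have "w' \<in> W1" using up(3) w w' K by (auto simp: upwards_closed_def)
    ultimately show "w' \<in> ?F1" using w' by blast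
  qed blast
  moreover have "p2 \<in> ?F1" using p gen_left[of p2 M q2] gen_left[of "(p1, p2)"] by blast
  moreover have "upwards_closed M ?K ?F2"
    unfolding upwards_closed_def
  proof (intro conjI ballI impI)
    fix w w' assume "w \<in> ?F2" and w': "w' \<in> ?K" "arrow M w w'"
    then have "\<exists>x\<in>U2. (x, w') \<in> ?N" using step[OF up(2)] by blast
    then show "w' \<in> ?F2" using w' by blast
  qed blast
  moreover have "q2 \<in> ?F2" using q gen_right[of q2 M p2] gen_right[of "(q1, q2)"] by blast
  ultimately obtain w1 w2 where "w1 \<in> ?F1" "w2 \<in> ?F2" "yellow M w1 w2"
    by (rule yellow_connectedD[OF yc])
  then show thesis using that K by blast
qed

text \<open>A yellow edge is found coordinate by coordinate: first between the projections of
  \<open>U\<close> and \<open>V\<close>, which are upwards closed because \<open>sg\<close> lifts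
  arrows, then between the fibres over its two ends.\<close>

lemma hyc_Times:
  assumes J: "J1 \<subseteq> X" "J2 \<subseteq> X" "op_closed M J1" "op_closed M J2" and h: "hyc M J1" "hyc M J2"
  shows "hyc (prod_op M) (J1 \<times> J2)"
  unfolding hyc_def
proof (intro allI impI)
  fix R assume R: "R \<subseteq> J1 \<times> J2" and cl: "op_closed (prod_op M) R" and ne: "R \<noteq> {}"
  have RX: "x \<in> X" "y \<in> X" if "(x, y) \<in> R" for x y using that R J by auto
  show "yellow_connected (prod_op M) R"
    unfolding yellow_connected_def
  proof (intro allI impI)
    fix U V assume U: "upwards_closed (prod_op M) R U" "U \<noteq> {}" and V: "upwards_closed (prod_op M) R V" "V \<noteq> {}"
    have clR1: "op_closed M (fst ` R)"
      unfolding op_closed_def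
    proof (intro ballI)
      fix x y assume "x \<in> fst ` R" "y \<in> fst ` R"
      then obtain x' y' where "(x, x') \<in> R" "(y, y') \<in> R" by auto
      then have "prod_op M (x, x') (y, y') \<in> R" by (rule op_closedD[OF cl])
      then have "(M x y, M x' y') \<in> R" by simp
      then show "M x y \<in> fst ` R" by (rule image_eqI[rotated]) simp
    qed
    have up1: "upwards_closed M (fst ` R) (fst ` S)" if S: "upwards_closed (prod_op M) R S" for S
      unfolding upwards_closed_def
    proof (intro conjI ballI impI)
      show "fst ` S \<subseteq> fst ` R" using S by (auto simp: upwards_closed_def)
      fix x y assume "x \<in> fst ` S" "y \<in> fst ` R" and a: "arrow M x y"
      then obtain x' y' where x': "(x, x') \<in> S" and y': "(y, y') \<in> R" by auto
      have xR: "(x, x') \<in> R" using x' S by (auto simp: upwards_closed_def)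
      have "bev (prod_op M) sg (x, x') (y, y') \<in> R" using xR y' cl by (intro op_closed_bev)
      moreover have "bev M sg x y = y" using a RX xR y' by (intro sg_eq) auto
      ultimately have "(y, bev M sg x' y') \<in> R" by simp
      moreover have "arrow (prod_op M) (x, x') (y, bev M sg x' y')"
        using a sg_arrow[of x' y'] RX xR y' by (auto simp: arrow_prod_op)
      ultimately have "(y, bev M sg x' y') \<in> S" using S x' by (auto simp: upwards_closed_def)
      then show "y \<in> fst ` S" by (rule image_eqI[rotated]) simp
    qed
    have "fst ` R \<subseteq> J1" "fst ` R \<noteq> {}" using R ne by auto
    then have yc1: "yellow_connected M (fst ` R)" using h(1) clR1 unfolding hyc_def by blast
    obtain u v where uv: "u \<in> fst ` U" "v \<in> fst ` V" using U V by blast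
    obtain u1 v1 where u1: "u1 \<in> fst ` U" and v1: "v1 \<in> fst ` V" and y1: "yellow M u1 v1"
      by (rule yellow_connectedD[OF yc1 up1[OF U(1)] uv(1) up1[OF V(1)] uv(2)])
    obtain u2 v2 where u2: "(u1, u2) \<in> U" and v2: "(v1, v2) \<in> V" using u1 v1 by auto
    have uvR: "(u1, u2) \<in> R" "(v1, v2) \<in> R" using u2 v2 U V by (auto simp: upwards_closed_def)
    have i1: "M u1 u1 = u1" "M v1 v1 = v1" using idem RX uvR by auto
    have y1': "M u1 v1 = u1" "M v1 u1 = v1" using y1 by (auto simp: yellow_def)
    \<comment> \<open>Since \<open>M\<close> is the first projection on \<open>{u1, v1}\<close>,
      multiplying a point over \<open>u1\<close> by a point over \<open>u1\<close> or
      \<open>v1\<close> gives a point over \<open>u1\<close>. So the union of the two fibres is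
      closed, and an arrow that starts in one fibre ends in the same fibre.\<close>
    let ?Yu = "{y. (u1, y) \<in> R}" and ?Yv = "{y. (v1, y) \<in> R}"
    have Y: "M y y' \<in> ?Yu" if "y \<in> ?Yu" "y' \<in> ?Yu \<union> ?Yv" for y y'
      using that op_closedD[OF cl, of "(u1, y)" "(u1, y')"] op_closedD[OF cl, of "(u1, y)" "(v1, y')"]
        i1 y1' by auto
    have Y': "M y y' \<in> ?Yv" if "y \<in> ?Yv" "y' \<in> ?Yu \<union> ?Yv" for y y'
      using that op_closedD[OF cl, of "(v1, y)" "(u1, y')"] op_closedD[OF cl, of "(v1, y)" "(v1, y')"]
        i1 y1' by auto
    have "op_closed M (?Yu \<union> ?Yv)" unfolding op_closed_def using Y Y' by blast
    moreover have "?Yu \<union> ?Yv \<subseteq> J2" using R by auto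
    ultimately have yc: "yellow_connected M (?Yu \<union> ?Yv)" using h(2) uvR unfolding hyc_def by blast
    have upU: "upwards_closed M (?Yu \<union> ?Yv) {y. (u1, y) \<in> U}"
      unfolding upwards_closed_def
    proof (intro conjI ballI impI)
      show "{y. (u1, y) \<in> U} \<subseteq> ?Yu \<union> ?Yv" using U by (auto simp: upwards_closed_def)
      fix y y' assume y: "y \<in> {y. (u1, y) \<in> U}" and y': "y' \<in> ?Yu \<union> ?Yv" and a: "arrow M y y'"
      have "(u1, y) \<in> R" using y U by (auto simp: upwards_closed_def)
      then have "M y y' \<in> ?Yu" using Y y' by blast
      then have "(u1, y') \<in> R" using a by (simp add: arrow_def)
      moreover have "arrow (prod_op M) (u1, y) (u1, y')" using a i1 by (auto simp: arrow_def)
      ultimately show "y' \<in> {y. (u1, y) \<in> U}" using y U by (auto simp: upwards_closed_def)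
    qed
    have upV: "upwards_closed M (?Yu \<union> ?Yv) {y. (v1, y) \<in> V}"
      unfolding upwards_closed_def
    proof (intro conjI ballI impI)
      show "{y. (v1, y) \<in> V} \<subseteq> ?Yu \<union> ?Yv" using V by (auto simp: upwards_closed_def)
      fix y y' assume y: "y \<in> {y. (v1, y) \<in> V}" and y': "y' \<in> ?Yu \<union> ?Yv" and a: "arrow M y y'"
      have "(v1, y) \<in> R" using y V by (auto simp: upwards_closed_def)
      then have "M y y' \<in> ?Yv" using Y' y' by blast
      then have "(v1, y') \<in> R" using a by (simp add: arrow_def)
      moreover have "arrow (prod_op M) (v1, y) (v1, y')" using a i1 by (auto simp: arrow_def)
      ultimately show "y' \<in> {y. (v1, y) \<in> V}" using y V by (auto simp: upwards_closed_def)
    qed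
    obtain z1 z2 where "(u1, z1) \<in> U" "(v1, z2) \<in> V" "yellow M z1 z2"
      using yellow_connectedD[OF yc upU _ upV] u2 v2 by blast
    then show "\<exists>u\<in>U. \<exists>v\<in>V. prod_op M u v = u \<and> prod_op M v u = v"
      using y1 by (intro bexI[of _ "(u1, z1)"] bexI[of _ "(v1, z2)"]) (auto simp: yellow_def)
  qed
qed

end

section \<open>Patterns and exact triples\<close>

text \<open>In an exact triple \<open>(w, z, v)\<close> the parts \<open>w\<close>, \<open>v\<close>, \<open>z\<close> are the values at lists of places that lie
  in the majority, that avoid it, and that do neither.\<close>

locale voting =
  fixes pat :: "(bt \<times> bt) set" and ex :: "(bt \<times> bt \<times> bt) set"
  assumes pat_leftmost: "(p, q) \<in> pat \<Longrightarrow> leftmost p"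
    and pat_base: "(VX, VY) \<in> pat"
    and pat_basic: "(App VX VY, App VX VY) \<in> pat"
    and pat_App: "(p, q) \<in> pat \<Longrightarrow> (p', q') \<in> pat \<Longrightarrow> (App p p', App q q') \<in> pat"
    and pat_sub: "(p', q') \<in> pat \<Longrightarrow> (p, q) \<in> pat \<Longrightarrow> (sub p' p q, sub q' p q) \<in> pat"
    and pat_star: "(k, k) \<in> pat \<Longrightarrow> (sub k VX t, sub k VY (sub t VY VX)) \<in> pat"
    and ex_mixed: "(w, z, v) \<in> ex \<Longrightarrow> (z, z) \<in> pat"
    and ex_const: "(d, d) \<in> pat \<Longrightarrow> (d, d, d) \<in> ex"
    and ex_App: "(w, z, v) \<in> ex \<Longrightarrow> (w', z', v') \<in> ex \<Longrightarrow> (App w w', App z z', App v v') \<in> ex"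
    and ex_pat: "(w, z, v) \<in> ex \<Longrightarrow> (w, v) \<in> pat"
    and ex_row: "(w, z, v) \<in> ex \<Longrightarrow> (k, k) \<in> pat \<Longrightarrow> (sub k w z, z, sub k z v) \<in> ex"
    and ex_vote: "(w, z, v) \<in> ex \<Longrightarrow> (k, k) \<in> pat \<Longrightarrow> (sub k z w, sub k z w) \<in> pat"
begin

text \<open>Here \<open>a\<close> is the majority value and \<open>b\<close> the minority value;
  both parts of a pattern are evaluated at \<open>(a, b)\<close>, without a swap. Passing from terms
  to values gives finite sets over a finite algebra, so a pair with fewest patterns exists.\<close>

definition Pi :: "('x \<Rightarrow> 'x \<Rightarrow> 'x) \<Rightarrow> 'x \<Rightarrow> 'x \<Rightarrow> ('x \<times> 'x) set" where
  "Pi M a b = (\<lambda>(p, q). (bev M p a b, bev M q a b)) ` pat"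

definition Dl :: "('x \<Rightarrow> 'x \<Rightarrow> 'x) \<Rightarrow> 'x \<Rightarrow> 'x \<Rightarrow> 'x set" where
  "Dl M a b = {bev M k a b | k. (k, k) \<in> pat}"

definition Xs :: "('x \<Rightarrow> 'x \<Rightarrow> 'x) \<Rightarrow> 'x \<Rightarrow> 'x \<Rightarrow> ('x \<times> 'x \<times> 'x) set" where
  "Xs M a b = (\<lambda>(w, z, v). (bev M w a b, bev M z a b, bev M v a b)) ` ex"

lemma PiI: "(p, q) \<in> pat \<Longrightarrow> (bev M p a b, bev M q a b) \<in> Pi M a b"
  unfolding Pi_def by force

lemma PiE:
  assumes "(x, y) \<in> Pi M a b"
  obtains p q where "(p, q) \<in> pat" "x = bev M p a b" "y = bev M q a b"
  using assms unfolding Pi_def by auto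

lemma DlI: "(k, k) \<in> pat \<Longrightarrow> bev M k a b \<in> Dl M a b"
  unfolding Dl_def by blast

lemma DlE: assumes "d \<in> Dl M a b" obtains k where "(k, k) \<in> pat" "d = bev M k a b"
  using assms unfolding Dl_def by auto

lemma XsI: "(w, z, v) \<in> ex \<Longrightarrow> (bev M w a b, bev M z a b, bev M v a b) \<in> Xs M a b"
  unfolding Xs_def by force

lemma XsE:
  assumes "(x, y, z) \<in> Xs M a b"
  obtains p q r where "(p, q, r) \<in> ex" "x = bev M p a b" "y = bev M q a b" "z = bev M r a b"
  using assms unfolding Xs_def by auto

lemma Pi_base: "(a, b) \<in> Pi M a b"
  using PiI[OF pat_base, of M a b] by simp

lemma Pi_op:
  assumes "(x, y) \<in> Pi M a b" "(x', y') \<in> Pi M a b"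
  shows "(M x x', M y y') \<in> Pi M a b"
proof -
  obtain p q where 1: "(p, q) \<in> pat" "x = bev M p a b" "y = bev M q a b" using assms(1) by (rule PiE)
  obtain p' q' where 2: "(p', q') \<in> pat" "x' = bev M p' a b" "y' = bev M q' a b" using assms(2) by (rule PiE)
  show ?thesis using PiI[OF pat_App[OF 1(1) 2(1)], of M a b] 1 2 by simp
qed

lemma Pi_bev: "(x, y) \<in> Pi M a b \<Longrightarrow> (x', y') \<in> Pi M a b \<Longrightarrow> (bev M t x x', bev M t y y') \<in> Pi M a b"
  by (induction t) (auto intro: Pi_op)

text \<open>A pattern turns a majority tuple into one with the same set of majority places, so
  patterns compose. Thus \<open>Pi\<close> can only shrink along its own elements, and at a minimal
  choice it stays the same.\<close>

lemma Pi_trans: assumes "(x, y) \<in> Pi M a b" shows "Pi M x y \<subseteq> Pi M a b"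
proof
  fix r assume "r \<in> Pi M x y"
  then obtain p q where pq: "(p, q) \<in> pat" "r = (bev M p x y, bev M q x y)" unfolding Pi_def by auto
  obtain p' q' where "(p', q') \<in> pat" "x = bev M p' a b" "y = bev M q' a b" using assms by (rule PiE)
  then show "r \<in> Pi M a b" using PiI[OF pat_sub[OF pq(1)], of p' q' M a b] pq(2) by simp
qed

lemma Dl_trans: assumes "(x, y) \<in> Pi M a b" shows "Dl M x y \<subseteq> Dl M a b"
proof
  fix d assume "d \<in> Dl M x y"
  then obtain k where k: "(k, k) \<in> pat" "d = bev M k x y" by (rule DlE)
  obtain p q where "(p, q) \<in> pat" "x = bev M p a b" "y = bev M q a b" using assms by (rule PiE)
  then show "d \<in> Dl M a b" using DlI[OF pat_sub[OF k(1)], of p q M a b] k(2) by simp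
qed

lemma Dl_bev: "(x, y) \<in> Pi M a b \<Longrightarrow> (k, k) \<in> pat \<Longrightarrow> bev M k x y \<in> Dl M a b"
  by (rule subsetD[OF Dl_trans DlI])

lemma Dl_op: "(x, y) \<in> Pi M a b \<Longrightarrow> M x y \<in> Dl M a b"
  using Dl_bev[OF _ pat_basic] by simp

lemma Dl_diag: "d \<in> Dl M a b \<Longrightarrow> (d, d) \<in> Pi M a b"
  by (elim DlE) (simp add: PiI)

text \<open>The two parts of a pattern may agree in value at \<open>(a, b)\<close> and still be
  different terms. Applying the global pattern of \<open>M\<close> to them gives one term for all
  places, and idempotence keeps the value \<open>d\<close>.\<close>

lemma Dl_iff_diag: assumes "M d d = d" shows "d \<in> Dl M a b \<longleftrightarrow> (d, d) \<in> Pi M a b"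
  using Dl_diag Dl_op[of d d M a b] assms by auto

lemma Dl_closed: "op_closed M (Dl M a b)"
  unfolding op_closed_def
proof (intro ballI)
  fix x y assume x: "x \<in> Dl M a b" and y: "y \<in> Dl M a b"
  obtain j where 1: "(j, j) \<in> pat" "x = bev M j a b" using x by (rule DlE)
  obtain k where 2: "(k, k) \<in> pat" "y = bev M k a b" using y by (rule DlE)
  show "M x y \<in> Dl M a b" using DlI[OF pat_App[OF 1(1) 2(1)], of M a b] 1 2 by simp
qed

lemma Pi_star:
  assumes "(x, y) \<in> Pi M a b" "(k, k) \<in> pat"
  shows "(bev M k x (bev M t x y), bev M k y (bev M t y x)) \<in> Pi M a b"
proof -
  have "(bev M k x (bev M t x y), bev M k y (bev M t y x)) \<in> Pi M x y"
    using PiI[OF pat_star[OF assms(2), of t], of M x y] by simp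
  then show ?thesis using Pi_trans[OF assms(1)] by blast
qed

lemma Xs_op:
  assumes "(w, z, v) \<in> Xs M a b" "(w', z', v') \<in> Xs M a b"
  shows "(M w w', M z z', M v v') \<in> Xs M a b"
proof -
  obtain p q r where 1: "(p, q, r) \<in> ex" "w = bev M p a b" "z = bev M q a b" "v = bev M r a b"
    using assms(1) by (rule XsE)
  obtain p' q' r' where 2: "(p', q', r') \<in> ex" "w' = bev M p' a b" "z' = bev M q' a b" "v' = bev M r' a b"
    using assms(2) by (rule XsE)
  show ?thesis using XsI[OF ex_App[OF 1(1) 2(1)], of M a b] 1 2 by simp
qed

lemma Xs_bev:
  "(w, z, v) \<in> Xs M a b \<Longrightarrow> (w', z', v') \<in> Xs M a b \<Longrightarrow>
   (bev M t w w', bev M t z z', bev M t v v') \<in> Xs M a b"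
  by (induction t) (auto intro: Xs_op)

lemma Xs_Pi: "(w, z, v) \<in> Xs M a b \<Longrightarrow> (w, v) \<in> Pi M a b"
  by (elim XsE) (simp add: PiI ex_pat)

lemma Xs_Dl: "(w, z, v) \<in> Xs M a b \<Longrightarrow> z \<in> Dl M a b"
  by (elim XsE) (simp add: DlI[OF ex_mixed])

lemma Xs_const: "d \<in> Dl M a b \<Longrightarrow> (d, d, d) \<in> Xs M a b"
  by (elim DlE) (simp add: XsI ex_const)

lemma Xs_row:
  assumes "(w, z, v) \<in> Xs M a b" "(k, k) \<in> pat"
  shows "(bev M k w z, z, bev M k z v) \<in> Xs M a b"
proof -
  obtain p q r where 1: "(p, q, r) \<in> ex" "w = bev M p a b" "z = bev M q a b" "v = bev M r a b"
    using assms(1) by (rule XsE)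
  show ?thesis using XsI[OF ex_row[OF 1(1) assms(2)], of M a b] 1 by simp
qed

lemma Xs_vote:
  assumes "(w, z, v) \<in> Xs M a b" "(k, k) \<in> pat"
  shows "bev M k z w \<in> Dl M a b"
proof -
  obtain p q r where 1: "(p, q, r) \<in> ex" "w = bev M p a b" "z = bev M q a b" "v = bev M r a b"
    using assms(1) by (rule XsE)
  show ?thesis using DlI[OF ex_vote[OF 1(1) assms(2)], of M a b] 1 by simp
qed

text \<open>The mixed part \<open>z\<close> is global, so \<open>(z, z, z)\<close> is an exact
  triple. Combining with it moves the pure part freely inside \<open>gen M w z\<close> while
  idempotence holds the mixed part fixed.\<close>

lemma Xs_gen:
  assumes "(w, z, v) \<in> Xs M a b" "M z z = z" "x \<in> gen M w z"
  obtains v' where "(x, z, v') \<in> Xs M a b" "v' \<in> gen M v z"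
proof -
  obtain t where "x = bev M t w z" using assms(3) by (rule genE)
  moreover have "(bev M t w z, bev M t z z, bev M t v z) \<in> Xs M a b"
    using assms(1) Xs_const[OF Xs_Dl[OF assms(1)]] by (rule Xs_bev)
  ultimately show thesis using that[of "bev M t v z"] bev_idem[of M z t] assms(2) by (simp add: gen_bev)
qed

end

locale voting_psemilattice = voting + psemilattice
begin

lemma in_X:
  assumes "a \<in> X" "b \<in> X"
  shows "(x, y) \<in> Pi M a b \<Longrightarrow> x \<in> X" "(x, y) \<in> Pi M a b \<Longrightarrow> y \<in> X"
    "d \<in> Dl M a b \<Longrightarrow> d \<in> X" "(w, z, v) \<in> Xs M a b \<Longrightarrow> w \<in> X \<and> z \<in> X \<and> v \<in> X"
  by (elim PiE DlE XsE; simp add: op_closed_bev[OF clX assms])+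

text \<open>A pattern whose minority part is a global value can be improved until it is yellow, and then
  the majority part is itself a global value.\<close>

lemma global_above:
  assumes ab: "a \<in> X" "b \<in> X" and pq: "(p, q) \<in> Pi M a b" "q \<in> Dl M a b" and h: "hyc M (gen M p q)"
  shows "up M (gen M p q) p \<inter> Dl M a b \<noteq> {}"
proof -
  let ?K = "gen M p q"
  let ?St = "\<lambda>u z. (u, z) \<in> Pi M a b \<and> z \<in> Dl M a b"
  have K: "?K \<subseteq> X" using in_X[OF ab] pq clX by (intro gen_least) auto
  have fin: "finite ?K" using K finX finite_subset by blast
  have gz: "(x, z) \<in> Pi M a b" if st: "?St u z" and z: "z \<in> ?K" and x: "x \<in> gen M u z" for u z x
  proof -
    obtain t where t: "x = bev M t u z" using x by (rule genE)
    have "(bev M t u z, bev M t z z) \<in> Pi M a b"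
      by (rule Pi_bev[OF conjunct1[OF st] Dl_diag[OF conjunct2[OF st]]])
    moreover have "M z z = z" using idem K z by blast
    ultimately show ?thesis by (simp add: t bev_idem)
  qed
  obtain u z where "?St u z" "u \<in> up M ?K p" "yellow M u z"
  proof (rule climb[of M p q ?St, OF fin h])
    show "?St p q" using pq by simp
    show "?St u' z" if "?St u z" "u \<in> ?K" "z \<in> ?K" "u' \<in> gen M u z" "arrow M u u'" for u z u'
      using gz that by blast
    show "\<exists>u'\<in>gen M u z. arrow M u u' \<and> ?St u' z'"
      if st: "?St u z" and uz: "u \<in> ?K" "z \<in> ?K" and z': "z' \<in> gen M u z" "arrow M z z'" for u z z'
    proof -
      have z'X: "z' \<in> X" using gen_subset[OF uz] z' K by blast
      \<comment> \<open>The arrow gives \<open>z' = M z' z\<close>, the value of a global term on a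
        pattern, so \<open>z'\<close> is global as well. Then \<open>sg\<close> can be applied to
        the pattern \<open>(u, z)\<close> and the constant pattern \<open>(z', z')\<close>.\<close>
      have "(z', z) \<in> Pi M a b" using gz[OF st uz(2) z'(1)] .
      then have d: "z' \<in> Dl M a b" using Dl_op[of z' z M a b] z'(2) by (simp add: arrow_def)
      have "(bev M sg u z', bev M sg z z') \<in> Pi M a b" using conjunct1[OF st] Dl_diag[OF d] by (rule Pi_bev)
      moreover have "bev M sg z z' = z'" using uz K z'X z'(2) by (intro sg_eq) auto
      moreover have "arrow M u (bev M sg u z')" using uz K z'X by (intro sg_arrow) auto
      moreover have "bev M sg u z' \<in> gen M u z" using z'(1) by (intro op_closed_bev op_closed_gen gen_left)
      ultimately show ?thesis using d by auto
    qed
  qed auto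
  then have "u \<in> Dl M a b" using Dl_op[of u z M a b] by (simp add: yellow_def)
  then show ?thesis using \<open>u \<in> up M ?K p\<close> by blast
qed

text \<open>Rows of an exact triple whose pure part and mixed part are yellow keep the pure part, while
  the part of the minority becomes a global value after three steps.\<close>

lemma exact_to_pattern:
  assumes ab: "a \<in> X" "b \<in> X" and ex0: "(w, c, v) \<in> Xs M a b" and h: "hyc M (gen M w c)"
  obtains u q where "u \<in> up M (gen M w c) w" "(u, q) \<in> Pi M a b" "q \<in> Dl M a b"
proof -
  let ?K = "gen M w c"
  let ?St = "\<lambda>u z. \<exists>q. (u, z, q) \<in> Xs M a b"
  have K: "?K \<subseteq> X" using in_X[OF ab] ex0 clX by (intro gen_least) auto
  have fin: "finite ?K" using K finX finite_subset by blast
  have gz: "?St x z" if st: "?St u z" and z: "z \<in> ?K" and x: "x \<in> gen M u z" for u z x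
  proof -
    obtain q where "(u, z, q) \<in> Xs M a b" using st by blast
    moreover have "M z z = z" using idem K z by blast
    ultimately show ?thesis using x by (rule Xs_gen) blast
  qed
  obtain u z where uz: "?St u z" "u \<in> up M ?K w" "z \<in> ?K" "yellow M u z"
  proof (rule climb[of M w c ?St, OF fin h])
    show "?St w c" using ex0 by blast
    show "?St u' z" if "?St u z" "u \<in> ?K" "z \<in> ?K" "u' \<in> gen M u z" "arrow M u u'" for u z u'
      using gz that by blast
    show "\<exists>u'\<in>gen M u z. arrow M u u' \<and> ?St u' z'"
      if st: "?St u z" and uz: "u \<in> ?K" "z \<in> ?K" and z': "z' \<in> gen M u z" "arrow M z z'" for u z z'
    proof -
      have z'X: "z' \<in> X" using gen_subset[OF uz] z' K by blast
      obtain q where "(z', z, q) \<in> Xs M a b" using gz[OF st uz(2) z'(1)] by blast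
      then have d: "z' \<in> Dl M a b" using Xs_vote[OF _ pat_basic, of z' z q M a b] z'(2) by (simp add: arrow_def)
      obtain q' where "(u, z, q') \<in> Xs M a b" using st by blast
      then have "(bev M sg u z', bev M sg z z', bev M sg q' z') \<in> Xs M a b"
        using Xs_const[OF d] by (rule Xs_bev)
      moreover have "bev M sg z z' = z'" using uz K z'X z'(2) by (intro sg_eq) auto
      moreover have "arrow M u (bev M sg u z')" using uz K z'X by (intro sg_arrow) auto
      moreover have "bev M sg u z' \<in> gen M u z" using z'(1) by (intro op_closed_bev op_closed_gen gen_left)
      ultimately show ?thesis by auto
    qed
  qed auto
  then obtain q where q: "(u, z, q) \<in> Xs M a b" by blast
  have y: "M u z = u" "M z u = z" using uz by (auto simp: yellow_def)
  have z2: "M z z = z" using uz K idem by blast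
  \<comment> \<open>Each row keeps \<open>u\<close> and \<open>z\<close>, which are yellow, and
    multiplies the minority part by \<open>z\<close>. In parallel, multiplying by the constant
    triple turns \<open>u\<close> into \<open>z\<close>, and a row then gives the pattern
    \<open>(z, q2)\<close>. The third product \<open>q3\<close> is therefore a value of
    \<open>M\<close> on a pattern, hence global.\<close>
  define q1 where "q1 = M z q"
  define q2 where "q2 = M z q1"
  define q3 where "q3 = M z q2"
  have 1: "(u, z, q1) \<in> Xs M a b" using Xs_row[OF q pat_basic] y by (simp add: q1_def)
  have 2: "(u, z, q2) \<in> Xs M a b" using Xs_row[OF 1 pat_basic] y by (simp add: q2_def)
  have 3: "(u, z, q3) \<in> Xs M a b" using Xs_row[OF 2 pat_basic] y by (simp add: q3_def)
  have "(M z u, M z z, M z q) \<in> Xs M a b" using Xs_const[OF Xs_Dl[OF q]] q by (rule Xs_op)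
  then have "(z, z, q1) \<in> Xs M a b" using y z2 by (simp add: q1_def)
  from Xs_row[OF this pat_basic] have "(z, q2) \<in> Pi M a b" using z2 by (intro Xs_Pi) (simp add: q2_def)
  then have "q3 \<in> Dl M a b" using Dl_op by (simp add: q3_def)
  then show thesis using that[OF uz(2) Xs_Pi[OF 3]] by blast
qed

end

section \<open>Global values in upwards closed sets\<close>

text \<open>The connectivity argument sees the algebra only through these properties:
  \<open>absorption\<close> comes from the standard pair, \<open>yellow_of_pat\<close> from
  minimality, and \<open>ex_yellow\<close> supplies the initial exact triples besides the constant
  ones.\<close>

locale bw_algebra = voting_psemilattice pat ex A f sg
  for pat ex and A :: "'a set" and f sg +
  assumes basic_yellow: "\<And>x y. x \<in> A \<Longrightarrow> y \<in> A \<Longrightarrow> yellow f (f x y) (f y x)"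
    and absorption: "\<And>t x y. x \<in> A \<Longrightarrow> y \<in> A \<Longrightarrow> x \<noteq> y \<Longrightarrow> bev f t x y = y \<Longrightarrow> bev f t y x = y \<Longrightarrow> arrow f x y"
    and yellow_of_pat: "\<And>k u v. (k, k) \<in> pat \<Longrightarrow> u \<in> A \<Longrightarrow> v \<in> A \<Longrightarrow> bev f k u v = u \<Longrightarrow> bev f k v u = v \<Longrightarrow> yellow f u v"
    and ex_yellow: "\<And>j k. (j, j) \<in> pat \<Longrightarrow> (k, k) \<in> pat \<Longrightarrow>
      (\<And>x y. x \<in> A \<Longrightarrow> y \<in> A \<Longrightarrow> yellow f (bev f k x y) (bev f k y x)) \<Longrightarrow> (sub j VX k, k, sub j VY k) \<in> ex"
begin

definition hits :: "'a set \<Rightarrow> bool" where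
  "hits B \<longleftrightarrow> (\<forall>U a b. upwards_closed f B U \<longrightarrow> a \<in> U \<longrightarrow> b \<in> B \<longrightarrow> Dl f a b \<inter> U \<noteq> {})"

lemma hitsD:
  assumes "hits B" "upwards_closed f B U" "a \<in> U" "b \<in> B"
  obtains k where "(k, k) \<in> pat" "bev f k a b \<in> U"
proof -
  obtain d where "d \<in> Dl f a b" "d \<in> U" using assms unfolding hits_def by blast
  then show thesis using that by (elim DlE) blast
qed

text \<open>The subalgebra of the square generated by two opposite pairs is used to find the
  identification to which absorption applies.\<close>

lemma hits_step:
  assumes BA: "B \<subseteq> A" and clB: "op_closed f B"
    and yc: "\<And>K. K \<subset> B \<Longrightarrow> op_closed f K \<Longrightarrow> K \<noteq> {} \<Longrightarrow> yellow_connected f K"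
    and hits: "\<And>K. K \<subset> B \<Longrightarrow> op_closed f K \<Longrightarrow> hits K"
  shows "hits B"
  unfolding hits_def
proof (intro allI impI, rule ccontr)
  fix U a0 b0
  assume U: "upwards_closed f B U" and a0: "a0 \<in> U" and b0: "b0 \<in> B" and "\<not> Dl f a0 b0 \<inter> U \<noteq> {}"
  have UB: "U \<subseteq> B" using U by (simp add: upwards_closed_def)
  have finB: "finite B" using BA finX finite_subset by blast
  have hycK: "hyc f K" if "K \<subset> B" for K unfolding hyc_def using yc that by blast
  define Fail where "Fail = (\<lambda>(a, b). a \<in> U \<and> b \<in> B \<and> Dl f a b \<inter> U = {})"
  have fail0: "Fail (a0, b0)" using a0 b0 \<open>\<not> _\<close> by (simp add: Fail_def)
  have FU: "a \<in> U" "a \<in> B" "b \<in> B" "a \<in> A" "b \<in> A" "Dl f a b \<inter> U = {}" if "Fail (a, b)" for a b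
    using that UB BA by (auto simp: Fail_def)
  have gen_all: "gen f a b = B" if F: "Fail (a, b)" for a b
  proof (rule ccontr)
    let ?K = "gen f a b"
    have "?K \<subseteq> B" using FU[OF F] clB by (intro gen_least)
    moreover assume "?K \<noteq> B"
    ultimately have K: "?K \<subset> B" by blast
    have "hits ?K" using K op_closed_gen by (rule hits)
    moreover have "upwards_closed f ?K (U \<inter> ?K)" using U K by (intro upwards_closed_Int) auto
    moreover have "a \<in> U \<inter> ?K" using FU(1)[OF F] gen_left[of a f b] by blast
    ultimately have "Dl f a b \<inter> (U \<inter> ?K) \<noteq> {}" using gen_right[of b f a] unfolding hits_def by blast
    then show False using FU(6)[OF F] by blast
  qed
  have PiB: "p \<in> B \<and> q \<in> B" if pq: "(p, q) \<in> Pi f a b" and F: "Fail (a, b)" for a b p q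
  proof -
    obtain s t where "p = bev f s a b" "q = bev f t a b" using pq by (rule PiE)
    then show ?thesis using op_closed_bev[OF clB FU(2,3)[OF F]] by simp
  qed
  have DlB: "d \<in> B" if d: "d \<in> Dl f a b" and F: "Fail (a, b)" for a b d
  proof -
    obtain k where "d = bev f k a b" using d by (rule DlE)
    then show ?thesis using op_closed_bev[OF clB FU(2,3)[OF F]] by simp
  qed
  have fail_trans: "Fail (p, q)" if "Fail (a, b)" "(p, q) \<in> Pi f a b" "p \<in> U" for a b p q
    using Dl_trans[OF that(2)] PiB[OF that(2,1)] FU(6)[OF that(1)] that(3) by (auto simp: Fail_def)
  \<comment> \<open>The down-closure is measured instead of \<open>Dl\<close> because of the later
    passage from \<open>(a, b)\<close> to \<open>(a, f a b)\<close>. The new global values need not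
    be global for \<open>(a, b)\<close>; they are only shown to lie below such values.\<close>
  define D where "D = (\<lambda>(a, b). {w \<in> B. up f B w \<inter> Dl f a b \<noteq> {}})"
  have D_fin: "finite (D p)" for p using finB by (cases p) (simp add: D_def)
  have Dl_D: "Dl f a b \<subseteq> D (a, b)" if "Fail (a, b)" for a b
  proof
    fix d assume "d \<in> Dl f a b"
    then show "d \<in> D (a, b)" using DlB[OF _ that, of d] up_refl[of d f B] by (auto simp: D_def)
  qed
  obtain ab where ab0: "Fail ab" and Dmin: "\<And>p. Fail p \<Longrightarrow> card (D ab) \<le> card (D p)"
    using ex_has_least_nat[of Fail "(a0, b0)" "\<lambda>p. card (D p)"] fail0 by blast
  define n where "n = card (D ab)"
  have D_eq: "D p = D q" if "Fail p" "card (D q) = n" "D p \<subseteq> D q" for p q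
    using card_seteq[OF D_fin that(3)] Dmin[OF that(1)] that(2) by (simp add: n_def)
  have D_trans: "D (p, q) \<subseteq> D (a, b)" if "(p, q) \<in> Pi f a b" for a b p q
    using Dl_trans[OF that] by (auto simp: D_def)
  \<comment> \<open>The condition \<open>b \<in> D (a, b)\<close> provides a chain of arrows from
    \<open>b\<close> to a global value; following it makes \<open>T\<close> nonempty below.\<close>
  define Good where "Good = (\<lambda>(a, b). Fail (a, b) \<and> card (D (a, b)) = n \<and> b \<in> D (a, b))"
  have good_trans: "Good (p, q)"
    if F: "Fail (a, b)" "card (D (a, b)) = n" and pq: "(p, q) \<in> Pi f a b" "p \<in> U" "q \<in> D (a, b)" for a b p q
  proof -
    have "Fail (p, q)" using fail_trans F(1) pq by blast
    moreover from this have "D (p, q) = D (a, b)" using D_eq F D_trans pq by blast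
    ultimately show ?thesis using F pq by (simp add: Good_def)
  qed
  text \<open>Either a pattern with majority part in \<open>U\<close> and global minority part exists, or
    one may pass from \<open>(a, b)\<close> to \<open>(a, f a b)\<close>.\<close>
  have "\<exists>p. Good p"
  proof -
    obtain a b where Fab: "Fail (a, b)" and n: "card (D (a, b)) = n" using ab0 by (cases ab) (auto simp: n_def)
    note ab = FU[OF Fab]
    show ?thesis
    proof (cases "\<exists>p q. (p, q) \<in> Pi f a b \<and> p \<in> U \<and> q \<in> Dl f a b")
      case True
      then show ?thesis using good_trans[OF Fab n] Dl_D[OF Fab] by blast
    next
      case False
      define c where "c = f a b"
      have cDl: "c \<in> Dl f a b" using Dl_op[OF Pi_base] by (simp add: c_def)
      have cB: "c \<in> B" using DlB cDl Fab by blast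
      have cA: "c \<in> A" using cB BA by blast
      \<comment> \<open>The elements \<open>d\<close>, \<open>c\<close>, \<open>v\<close> form an
        exact triple. If \<open>d\<close> and \<open>c\<close> generate \<open>B\<close>, every
        element of \<open>B\<close> is a pure part over \<open>c\<close>, and voting yields a
        pattern \<open>(d, q)\<close> with \<open>q\<close> global; the term that expresses
        \<open>a\<close> by \<open>d\<close> and \<open>c\<close> then produces a pattern excluded
        in this case. Otherwise the climb takes place in proper subalgebras.\<close>
      have above: "up f B d \<inter> Dl f a b \<noteq> {}" if dac: "d \<in> Dl f a c" for d
      proof -
        obtain k where k: "(k, k) \<in> pat" "d = bev f k a c" using dac by (rule DlE)
        have dB: "d \<in> B" using k op_closed_bev[OF clB ab(2) cB] by simp
        define v where "v = bev f k b c"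
        have vB: "v \<in> B" unfolding v_def using op_closed_bev[OF clB ab(3) cB] .
        have "(sub k VX (App VX VY), App VX VY, sub k VY (App VX VY)) \<in> ex"
          using k(1) pat_basic basic_yellow by (intro ex_yellow) simp_all
        from XsI[OF this, of f a b] have ex1: "(d, c, v) \<in> Xs f a b" by (simp add: k v_def c_def)
        show ?thesis
        proof (cases "gen f d c = B")
          case True
          have all: "\<exists>x'\<in>B. (x, c, x') \<in> Xs f a b" if xB: "x \<in> B" for x
          proof -
            have "x \<in> gen f d c" using xB True by simp
            then obtain x' where "(x, c, x') \<in> Xs f a b" "x' \<in> gen f v c"
              by (rule Xs_gen[OF ex1 idem[OF cA]])
            then show ?thesis using gen_least[OF clB vB cB] by blast
          qed
          obtain x where x: "x \<in> B" "(a, c, x) \<in> Xs f a b" using all[OF ab(2)] by blast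
          define q where "q = bev f k c x"
          obtain x' where "(x, c, x') \<in> Xs f a b" using all[OF x(1)] by blast
          then have qDl: "q \<in> Dl f a b" unfolding q_def using k(1) by (rule Xs_vote)
          have dq: "(d, q) \<in> Pi f a b" using Xs_Pi[OF Xs_row[OF x(2) k(1)]] by (simp add: k(2) q_def)
          have "a \<in> gen f d c" using True ab(2) by simp
          then obtain t where t: "a = bev f t d c" by (rule genE)
          have "(bev f t d c, bev f t q c) \<in> Pi f a b" using dq Dl_diag[OF cDl] by (rule Pi_bev)
          then have "(a, bev f t q c) \<in> Pi f a b" using t by simp
          moreover have "bev f t q c \<in> Dl f a b" using Dl_closed qDl cDl by (rule op_closed_bev)
          ultimately have False using \<open>\<not> (\<exists>p q. _ p q)\<close> ab(1) by blast
          then show ?thesis ..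
        next
          case neq: False
          have "gen f d c \<subseteq> B" using clB dB cB by (rule gen_least)
          then have K: "gen f d c \<subset> B" using neq by blast
          obtain u q where u: "u \<in> up f (gen f d c) d" and uq: "(u, q) \<in> Pi f a b" and q: "q \<in> Dl f a b"
            using exact_to_pattern[OF ab(4,5) ex1 hycK[OF K]] by blast
          have "up f (gen f d c) d \<subseteq> up f B d" using K by (intro up_mono) blast
          then have uB: "u \<in> up f B d" using u by blast
          have uqB: "u \<in> B" "q \<in> B" using PiB[OF uq Fab] by blast+
          show ?thesis
          proof (cases "gen f u q = B")
            case True
            then have "a \<in> gen f u q" using ab(2) by simp
            then obtain t where t: "a = bev f t u q" by (rule genE)
            have "(bev f t u q, bev f t q q) \<in> Pi f a b" using uq Dl_diag[OF q] by (rule Pi_bev)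
            moreover have "bev f t q q = q" using uqB BA idem by (intro bev_idem) blast
            ultimately have "(a, q) \<in> Pi f a b" using t by simp
            then have False using \<open>\<not> (\<exists>p q. _ p q)\<close> ab(1) q by blast
            then show ?thesis ..
          next
            case False
            have "gen f u q \<subseteq> B" using clB uqB by (rule gen_least)
            then have K': "gen f u q \<subset> B" using False by blast
            have "up f (gen f u q) u \<inter> Dl f a b \<noteq> {}"
              using ab(4,5) uq q hycK[OF K'] by (rule global_above)
            moreover have "up f (gen f u q) u \<subseteq> up f B u" using K' by (intro up_mono) blast
            ultimately show ?thesis using up_trans[OF uB] by blast
          qed
        qed
      qed
      have "Dl f a c \<inter> U = {}"
        using above up_least[OF U _ order_refl] ab(6) by blast
      then have Fac: "Fail (a, c)" using ab cB by (simp add: Fail_def)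
      have "D (a, c) \<subseteq> D (a, b)"
      proof
        fix w assume "w \<in> D (a, c)"
        then obtain d where w: "w \<in> B" "d \<in> up f B w" "d \<in> Dl f a c" by (auto simp: D_def)
        then obtain e where "e \<in> up f B d" "e \<in> Dl f a b" using above by blast
        then have "e \<in> up f B w \<inter> Dl f a b" using up_trans[OF w(2)] by blast
        then show "w \<in> D (a, b)" using w(1) by (auto simp: D_def)
      qed
      then have eq: "D (a, c) = D (a, b)" using D_eq Fac n by blast
      have "Good (a, c)" using Fac n eq cDl Dl_D[OF Fab] by (auto simp: Good_def)
      then show ?thesis by blast
    qed
  qed
  then obtain g0 where "Good g0" ..
  then obtain a b where G: "Good (a, b)"
    and Pmin: "\<And>p q. Good (p, q) \<Longrightarrow> card (Pi f a b) \<le> card (Pi f p q)"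
    using ex_has_least_nat[of Good g0 "\<lambda>(p, q). card (Pi f p q)"] by fastforce
  have Fab: "Fail (a, b)" and nab: "card (D (a, b)) = n" using G by (auto simp: Good_def)
  note ab = FU[OF Fab]
  have finPi: "finite (Pi f a b)"
    using finB PiB[OF _ Fab] by (intro finite_subset[of "Pi f a b" "B \<times> B"]) auto
  define P0 where "P0 = Pi f a b"
  have P0_eq: "Pi f p q = P0" if "(p, q) \<in> P0" "p \<in> U" "q \<in> D (a, b)" for p q
  proof -
    have pq: "(p, q) \<in> Pi f a b" using that by (simp add: P0_def)
    have "Good (p, q)" using good_trans[OF Fab nab pq that(2,3)] .
    then have "card (Pi f a b) \<le> card (Pi f p q)" by (rule Pmin)
    then show ?thesis unfolding P0_def using card_seteq[OF finPi Pi_trans[OF pq]] by simp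
  qed
  have P0_B: "p \<in> B \<and> q \<in> B" if "(p, q) \<in> P0" for p q using PiB[OF _ Fab] that by (simp add: P0_def)
  have P0_op: "(f p p', f q q') \<in> P0" if "(p, q) \<in> P0" "(p', q') \<in> P0" for p q p' q'
    using Pi_op that by (simp add: P0_def)
  have P0_bev: "(bev f t p p', bev f t q q') \<in> P0" if "(p, q) \<in> P0" "(p', q') \<in> P0" for p q p' q' t
    using Pi_bev that by (simp add: P0_def)
  define Dl0 where "Dl0 = Dl f a b"
  have Dl0_iff: "d \<in> Dl0 \<longleftrightarrow> (d, d) \<in> P0" for d
  proof
    show "d \<in> Dl0 \<Longrightarrow> (d, d) \<in> P0" using Dl_diag by (simp add: Dl0_def P0_def)
    assume "(d, d) \<in> P0"
    then show "d \<in> Dl0" using Dl_op[of d d f a b] P0_B[of d d] BA idem by (auto simp: Dl0_def P0_def)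
  qed
  have Dl0_U: "Dl0 \<inter> U = {}" using ab by (simp add: Dl0_def)
  have Dl0_sub: "Dl0 \<subseteq> D (a, b)" using Dl_D[OF Fab] by (simp add: Dl0_def)
  \<comment> \<open>These are the global values paired by a pattern with some element of
    \<open>U\<close>. Such a pair generates \<open>B\<close>, and \<open>d\<close> is idempotent, so
    \<open>d\<close> is in fact paired with every element of \<open>B\<close>; by minimality each
    pair from \<open>U \<times> T\<close> has the same patterns as \<open>(a, b)\<close>.\<close>
  define T where "T = {d \<in> Dl0. \<exists>u\<in>U. (u, d) \<in> P0}"
  have T_gen: "gen f u d = B" if "(u, d) \<in> P0" "u \<in> U" for u d
    using gen_all[OF fail_trans[OF Fab]] that by (simp add: P0_def)
  have T_B: "d \<in> B" "d \<in> A" if "d \<in> T" for d using that P0_B BA by (auto simp: T_def)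
  have T_all: "(x, d) \<in> P0" if dT: "d \<in> T" and xB: "x \<in> B" for x d
  proof -
    obtain u where u: "u \<in> U" "(u, d) \<in> P0" using dT by (auto simp: T_def)
    have "x \<in> gen f u d" using T_gen[OF u(2,1)] xB by simp
    then obtain t where t: "x = bev f t u d" by (rule genE)
    have "(d, d) \<in> P0" using dT Dl0_iff by (auto simp: T_def)
    with u(2) have "(bev f t u d, bev f t d d) \<in> P0" by (rule P0_bev)
    then show ?thesis using t bev_idem[of f d t] idem T_B[OF dT] by simp
  qed
  have T_Pi: "Pi f u d = P0" if "u \<in> U" "d \<in> T" for u d
  proof (rule P0_eq)
    show "(u, d) \<in> P0" using T_all that UB by blast
    show "u \<in> U" "d \<in> D (a, b)" using that Dl0_sub by (auto simp: T_def)
  qed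
  have T_k: "\<exists>k. (k, k) \<in> pat \<and> bev f k u d = d" if "u \<in> U" "d \<in> T" for u d
  proof -
    have "d \<in> Dl0" using that by (simp add: T_def)
    then have "(d, d) \<in> Pi f u d" using T_Pi[OF that] Dl0_iff by simp
    then have "d \<in> Dl f u d" using Dl_iff_diag[of f d u d] idem T_B that by blast
    then obtain k where "(k, k) \<in> pat" "d = bev f k u d" by (rule DlE)
    then show ?thesis by auto
  qed
  have T_up: "upwards_closed f B T"
    unfolding upwards_closed_def
  proof (intro conjI ballI impI)
    show "T \<subseteq> B" using T_B by blast
    fix d w assume d: "d \<in> T" and w: "w \<in> B" and a: "arrow f d w"
    have "(w, d) \<in> P0" using T_all d w by blast
    moreover have "(d, d) \<in> P0" using T_all d T_B by blast
    moreover have "f w d = w" "f d w = w" using a by (auto simp: arrow_def)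
    ultimately have "w \<in> Dl0" using Dl_op[of w d f a b] by (simp add: Dl0_def P0_def)
    then have ww: "(w, w) \<in> P0" using Dl0_iff by blast
    obtain u where u: "u \<in> U" "(u, d) \<in> P0" using d by (auto simp: T_def)
    have "(bev f sg u w, bev f sg d w) \<in> P0" using u(2) ww by (rule P0_bev)
    moreover have "bev f sg d w = w" using T_B d w BA a by (intro sg_eq) auto
    moreover have "bev f sg u w \<in> U" using U clB BA u(1) w by (rule sg_in_upwards_closed)
    ultimately show "w \<in> T" using \<open>w \<in> Dl0\<close> by (auto simp: T_def)
  qed
  have "T \<noteq> {}"
  proof -
    have "b \<in> D (a, b)" using G by (simp add: Good_def)
    then obtain d where d: "d \<in> up f B b" "d \<in> Dl f a b" by (auto simp: D_def)
    have "\<exists>u\<in>U. (u, d) \<in> P0" using d(1)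
    proof (induction rule: up_induct)
      case base show ?case using ab(1) Pi_base[of a b f] unfolding P0_def by blast
    next
      case (step x y)
      then obtain u where u: "u \<in> U" "(u, x) \<in> P0" by blast
      have "y \<in> gen f u x" using T_gen[OF u(2,1)] step by simp
      then obtain t where t: "y = bev f t u x" by (rule genE)
      \<comment> \<open>The choice gives \<open>s(x, u) = sg(x, t(u, x)) = sg(x, y) = y\<close> and
        \<open>s(u, x) = u'\<close>, which lies above \<open>u\<close>. Then \<open>pat_star\<close>
        with the basic term sends the pattern \<open>(u, x)\<close> to
        \<open>(u', y)\<close>.\<close>
      define s where "s = sub sg VX (sub t VY VX)"
      define u' where "u' = bev f sg u (bev f t x u)"
      have uxB: "u \<in> B" "x \<in> B" using u UB step by auto
      then have tB: "bev f t x u \<in> B" using clB by (intro op_closed_bev)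
      have "(f u (bev f s u x), f x (bev f s x u)) \<in> P0"
        using Pi_star[OF u(2)[unfolded P0_def] pat_basic, of s] by (simp add: P0_def)
      moreover have "f u (bev f s u x) = u'"
        using sg_arrow[of u "bev f t x u"] uxB tB BA by (auto simp: s_def u'_def arrow_def)
      moreover have "bev f s x u = y" using step BA by (auto simp: s_def t[symmetric] intro: sg_eq)
      moreover have "f x y = y" using step by (simp add: arrow_def)
      moreover have "u' \<in> U" unfolding u'_def using U clB BA u(1) tB by (rule sg_in_upwards_closed)
      ultimately have "(u', y) \<in> P0" "u' \<in> U" by simp_all
      then show ?case by blast
    qed
    then show ?thesis using d(2) unfolding T_def Dl0_def by blast
  qed
  define R where "R = (\<lambda>(u, d). gen (prod_op f) (u, d) (d, u))"
  obtain d0 where "d0 \<in> T" using \<open>T \<noteq> {}\<close> by blast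
  then have "\<exists>p. p \<in> U \<times> T" using ab by blast
  then obtain ud where "ud \<in> U \<times> T" and "\<forall>p. p \<in> U \<times> T \<longrightarrow> card (R ud) \<le> card (R p)"
    using ex_has_least_nat[of "\<lambda>p. p \<in> U \<times> T" _ "\<lambda>p. card (R p)"] by blast
  then obtain u d where u: "u \<in> U" and d: "d \<in> T"
    and Rmin: "\<And>u' d'. u' \<in> U \<Longrightarrow> d' \<in> T \<Longrightarrow> card (R (u, d)) \<le> card (R (u', d'))"
    by (cases ud) auto
  have uB: "u \<in> B" and uA: "u \<in> A" using u UB BA by auto
  have dB: "d \<in> B" and dA: "d \<in> A" using T_B d by auto
  have RB: "R (u, d) \<subseteq> B \<times> B" unfolding R_def prod.case using uB dB clB by (intro gen_least op_closed_Times) auto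
  have finR: "finite (R (u, d))" using RB finB finite_subset by blast
  obtain k where k: "(k, k) \<in> pat" "bev f k u d = d" using T_k u d by blast
  define e where "e = bev f k d u"
  have eB: "e \<in> B" unfolding e_def using clB dB uB by (rule op_closed_bev)
  have deP: "(d, e) \<in> P0"
    using Pi_star[OF T_all[OF d uB, unfolded P0_def] k(1), of VY] k by (simp add: e_def P0_def)
  have ddP: "(d, d) \<in> P0" using T_all d dB by blast
  \<comment> \<open>If \<open>u\<close> were a term in \<open>d\<close> and \<open>e\<close>, then
    \<open>(d, u)\<close> would be a pattern value and \<open>e = k(d, u)\<close> a global one. But
    then \<open>d\<close> and \<open>e\<close> generate global values only, and none of these lies
    in \<open>U\<close>.\<close>
  have F: "gen f d e \<noteq> B"
  proof
    assume "gen f d e = B"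
    then have "u \<in> gen f d e" using uB by simp
    then obtain t where t: "u = bev f t d e" by (rule genE)
    have "(bev f t d d, bev f t d e) \<in> P0" using ddP deP by (rule P0_bev)
    then have "(d, u) \<in> P0" using t bev_idem[of f d t] idem dA by simp
    then have "Dl f d u \<subseteq> Dl0" unfolding P0_def Dl0_def by (rule Dl_trans)
    then have "e \<in> Dl0" using DlI[OF k(1), of f d u] by (auto simp: e_def)
    moreover have "d \<in> Dl0" using d by (simp add: T_def)
    moreover have "op_closed f Dl0" unfolding Dl0_def by (rule Dl_closed)
    ultimately have "gen f d e \<subseteq> Dl0" by (intro gen_least)
    then show False using \<open>gen f d e = B\<close> uB u Dl0_U by blast
  qed
  have "gen f d e \<subseteq> B" using clB dB eB by (rule gen_least)
  then have "yellow_connected f (gen f d e)" using F op_closed_gen[of f d e] gen_left[of d f e] by (intro yc) auto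
  then obtain x1 w1 x2 w2 where x: "x1 \<in> U" "w1 \<in> T" "x2 \<in> T" and yw: "yellow f w1 w2"
    and N: "(x1, w1) \<in> gen (prod_op f) (u, d) (d, e)" "(x2, w2) \<in> gen (prod_op f) (u, d) (d, e)"
    and w2B: "w2 \<in> B"
    by (rule yellow_second_coordinate[OF BA clB u d d eB U T_up T_up])
  let ?N = "gen (prod_op f) (u, d) (d, e)"
  have w1: "w1 \<in> B" "w1 \<in> A" using x T_B by auto
  have N_R: "?N \<subseteq> R (u, d)"
  proof -
    have "(d, e) = bev (prod_op f) k (u, d) (d, u)" using k by (simp add: e_def)
    then have "(d, e) \<in> R (u, d)" unfolding R_def prod.case by (simp only: gen_bev)
    then show ?thesis unfolding R_def prod.case by (intro gen_subset gen_left)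
  qed
  \<comment> \<open>On the yellow pair \<open>k2\<close> is the first projection, so it moves
    \<open>x1\<close> to \<open>x2\<close> above a fixed \<open>w1\<close>. Since \<open>x1\<close>
    and \<open>x2\<close> generate \<open>B\<close>, a further term reaches \<open>(w1, w1)\<close>,
    and minimality of \<open>R\<close> expresses this point by \<open>(x1, w1)\<close> and
    \<open>(w1, x1)\<close>, as absorption requires.\<close>
  obtain k2 where k2: "(k2, k2) \<in> pat" "bev f k2 x1 x2 = x2" using T_k x by blast
  have "bev (prod_op f) k2 (x1, w1) (x2, w2) \<in> ?N" using N by (intro op_closed_bev op_closed_gen)
  moreover have "bev f k2 w1 w2 = w1"
    using bev_yellow[of f w1 w2 k2] pat_leftmost[OF k2(1)] yw idem w1 w2B BA by auto
  ultimately have x2N: "(x2, w1) \<in> ?N" using k2 by simp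
  have "gen f x1 x2 = B" using T_gen T_all x UB by blast
  then have "w1 \<in> gen f x1 x2" using w1 by simp
  then obtain t where t: "w1 = bev f t x1 x2" by (rule genE)
  have "bev (prod_op f) t (x1, w1) (x2, w1) \<in> ?N" using N x2N by (intro op_closed_bev op_closed_gen)
  then have ww: "(w1, w1) \<in> R (u, d)" using t bev_idem[of f w1 t] idem w1 N_R by auto
  have sub: "R (x1, w1) \<subseteq> R (u, d)"
  proof -
    have "(x1, w1) \<in> R (u, d)" using N N_R by blast
    then obtain s where s: "(x1, w1) = bev (prod_op f) s (u, d) (d, u)" unfolding R_def prod.case by (rule genE)
    then have "(w1, x1) = bev (prod_op f) (sub s VY VX) (u, d) (d, u)" by simp
    then show ?thesis unfolding R_def prod.case using s by (intro gen_subset) (simp_all only: gen_bev)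
  qed
  have "R (x1, w1) = R (u, d)" using card_seteq[OF finR sub] Rmin x by blast
  then have "(w1, w1) \<in> gen (prod_op f) (x1, w1) (w1, x1)" using ww by (simp add: R_def)
  then obtain s where "(w1, w1) = bev (prod_op f) s (x1, w1) (w1, x1)" by (rule genE)
  then have s: "bev f s x1 w1 = w1" "bev f s w1 x1 = w1" by auto
  have "x1 \<in> A" using x UB BA by blast
  moreover have "w1 \<notin> U" using x Dl0_U by (auto simp: T_def)
  ultimately have "arrow f x1 w1" using absorption w1 s x by metis
  then show False using U x w1 \<open>w1 \<notin> U\<close> by (auto simp: upwards_closed_def)
qed

end

section \<open>Yellow connectivity\<close>

text \<open>An irreflexive transitive relation on a finite nonempty set has a maximal element, which
  contradicts \<open>succ\<close>. This replaces an idempotent iterate where successive steps may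
  use different terms.\<close>

lemma transitive_has_fixpoint:
  assumes fin: "finite S" and ne: "S \<noteq> {}" and trans: "\<And>x y z. r x y \<Longrightarrow> r y z \<Longrightarrow> r x z"
    and succ: "\<And>x. x \<in> S \<Longrightarrow> \<exists>y\<in>S. r x y"
  obtains x where "x \<in> S" "r x x"
proof (rule ccontr)
  assume "\<not> thesis"
  then have irr: "\<not> r x x" if "x \<in> S" for x using that \<open>\<And>x. x \<in> S \<Longrightarrow> r x x \<Longrightarrow> thesis\<close> by blast
  have "transp_on S r" using trans by (intro transp_onI) blast
  moreover have "asymp_on S r" using trans irr by (intro asymp_onI) blast
  ultimately obtain m where m: "m \<in> S" "\<forall>x\<in>S. x \<noteq> m \<longrightarrow> \<not> r m x" using Finite_Set.bex_max_element[OF fin _ _ ne] by blast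
  obtain y where "y \<in> S" "r m y" using succ[OF m(1)] by blast
  then show False using m irr[of m] by (cases "y = m") auto
qed

section \<open>Subalgebras all of whose proper subalgebras are yellow connected\<close>

locale bw_minimal = bw_algebra pat ex A f sg
  for pat ex and A :: "'a set" and f sg +
  fixes B :: "'a set"
  assumes BA: "B \<subseteq> A" and clB: "op_closed f B"
    and yc: "\<And>K. K \<subset> B \<Longrightarrow> op_closed f K \<Longrightarrow> K \<noteq> {} \<Longrightarrow> yellow_connected f K"
    and hits: "hits B"
begin

definition separated :: "'a set \<Rightarrow> 'a set \<Rightarrow> bool" where
  "separated U V \<longleftrightarrow> upwards_closed f B U \<and> upwards_closed f B V \<and> U \<noteq> {} \<and> V \<noteq> {} \<and>
     (\<forall>u\<in>U. \<forall>v\<in>V. \<not> yellow f u v)"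

definition right_ideal :: "'a set \<Rightarrow> bool" where
  "right_ideal S \<longleftrightarrow> S \<subseteq> B \<and> (\<forall>x\<in>S. \<forall>y\<in>B. f x y \<in> S)"

lemma hyc_proper: "K \<subset> B \<Longrightarrow> hyc f K"
  unfolding hyc_def using yc by blast

lemma separated_sym: "separated U V \<Longrightarrow> separated V U"
  by (auto simp: separated_def yellow_def)

lemma separated_in:
  assumes "separated U V"
  shows "u \<in> U \<Longrightarrow> u \<in> B \<and> u \<in> A" and "v \<in> V \<Longrightarrow> v \<in> B \<and> v \<in> A" and "u \<in> U \<Longrightarrow> v \<in> V \<Longrightarrow> u \<noteq> v"
proof -
  have UV: "U \<subseteq> B" "V \<subseteq> B" "\<forall>u\<in>U. \<forall>v\<in>V. \<not> yellow f u v"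
    using assms by (auto simp: separated_def upwards_closed_def)
  show "u \<in> U \<Longrightarrow> u \<in> B \<and> u \<in> A" "v \<in> V \<Longrightarrow> v \<in> B \<and> v \<in> A" using UV BA by blast+
  have "yellow f u u" if "u \<in> U" using idem that UV BA by (auto simp: yellow_def)
  then show "u \<in> U \<Longrightarrow> v \<in> V \<Longrightarrow> u \<noteq> v" using UV by blast
qed

lemma separated_gen:
  assumes sep: "separated U V" and u: "u \<in> U" and v: "v \<in> V"
  shows "gen f u v = B"
proof (rule ccontr)
  let ?K = "gen f u v"
  have "?K \<subseteq> B" using separated_in[OF sep] u v clB by (intro gen_least) auto
  moreover assume "?K \<noteq> B"
  ultimately have K: "?K \<subset> B" by blast
  have uv: "u \<in> ?K" "v \<in> ?K" by (rule gen_left, rule gen_right)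
  have "yellow_connected f ?K" using uv by (intro yc K op_closed_gen) blast
  moreover have "upwards_closed f ?K (U \<inter> ?K)" "upwards_closed f ?K (V \<inter> ?K)"
    using sep K by (auto simp: separated_def intro!: upwards_closed_Int)
  ultimately obtain x y where "x \<in> U \<inter> ?K" "y \<in> V \<inter> ?K" "yellow f x y"
    using u v uv by (elim yellow_connectedD[of f ?K "U \<inter> ?K" u "V \<inter> ?K" v]) auto
  then show False using sep by (auto simp: separated_def)
qed

text \<open>Patterns consist of terms, so \<open>pat\<close> and \<open>ex\<close> serve the square
  unchanged. A global value at \<open>(a, b)\<close>, \<open>(b, a)\<close> has the coordinates
  \<open>k(a, b)\<close> and \<open>k(b, a)\<close>, the form in which \<open>yellow_of_pat\<close>
  asks for them.\<close>

lemma square: "voting_psemilattice pat ex (A \<times> A) (prod_op f) sg"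
  using voting_axioms psemilattice_prod by (rule voting_psemilattice.intro)

lemma leftmost_right_ideal:
  "right_ideal S \<Longrightarrow> x \<in> S \<Longrightarrow> y \<in> B \<Longrightarrow> leftmost t \<Longrightarrow> bev f t x y \<in> S"
proof (induction t)
  case (App s t)
  have "bev f t x y \<in> B" using App.prems clB by (intro op_closed_bev) (auto simp: right_ideal_def)
  then show ?case using App by (auto simp: right_ideal_def)
qed auto

text \<open>Take a pair from \<open>U \<times> V\<close> with the fewest patterns in the square.\<close>

lemma separated_normal:
  assumes sep: "separated U V"
  obtains a b k where "a \<in> U" "b \<in> V" "(k, k) \<in> pat"
    "\<forall>x\<in>A. \<forall>y\<in>A. yellow f (bev f k x y) (bev f k y x)"
    "bev f k a b = a" "Dl (prod_op f) (a, b) (b, a) \<inter> U \<times> V = {}"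
proof -
  have upU: "upwards_closed f B U" and upV: "upwards_closed f B V" using sep by (auto simp: separated_def)
  note inB = separated_in[OF sep]
  define P where "P = (\<lambda>(a, b). Pi (prod_op f) (a, b) (b, a))"
  obtain ab0 where "ab0 \<in> U \<times> V" using sep by (auto simp: separated_def)
  then obtain ab where "ab \<in> U \<times> V" and "\<And>p. p \<in> U \<times> V \<Longrightarrow> card (P ab) \<le> card (P p)"
    using ex_has_least_nat[of "\<lambda>p. p \<in> U \<times> V" ab0 "\<lambda>p. card (P p)"] by blast
  then obtain a b where a: "a \<in> U" and b: "b \<in> V"
    and Pmin: "\<And>u v. u \<in> U \<Longrightarrow> v \<in> V \<Longrightarrow> card (P (a, b)) \<le> card (P (u, v))"
    by (cases ab) auto
  interpret sq: voting_psemilattice pat ex "A \<times> A" "prod_op f" sg by (rule square)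
  have "P (a, b) \<subseteq> (A \<times> A) \<times> (A \<times> A)"
  proof -
    have "(a, b) \<in> A \<times> A" "(b, a) \<in> A \<times> A" using inB a b by blast+
    then have "p \<in> A \<times> A \<and> q \<in> A \<times> A" if "(p, q) \<in> P (a, b)" for p q
      using sq.in_X(1,2)[of "(a, b)" "(b, a)" p q] that by (simp add: P_def)
    then show ?thesis by (intro subrelI) blast
  qed
  then have finP: "finite (P (a, b))" using finX finite_subset by blast
  have P_eq: "P (u, v) = P (a, b)" if "u \<in> U" "v \<in> V" "((u, v), (v, u)) \<in> P (a, b)" for u v
    using card_seteq[OF finP _ Pmin[OF that(1,2)]] Pi_trans[of "(u, v)" "(v, u)" "prod_op f" "(a, b)" "(b, a)"]
      that(3) by (auto simp: P_def)
  have Dl_iff: "(x, y) \<in> Dl (prod_op f) (u, v) (v, u) \<longleftrightarrow> ((x, y), (x, y)) \<in> P (u, v)" if "x \<in> A" "y \<in> A" for x y u v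
    using Dl_iff_diag[of "prod_op f" "(x, y)" "(u, v)" "(v, u)"] idem that by (simp add: P_def)
  \<comment> \<open>A global value \<open>(u, v)\<close> in \<open>U \<times> V\<close> gives the
    pattern \<open>((u, v), (v, u))\<close> by \<open>pat_star\<close>. By minimality
    \<open>(u, v)\<close> is then a global value of its own pair, and \<open>yellow_of_pat\<close>
    yields a forbidden edge.\<close>
  have no_Dl: "Dl (prod_op f) (a, b) (b, a) \<inter> U \<times> V = {}"
  proof (rule ccontr)
    assume "\<not> ?thesis"
    then obtain u v where u: "u \<in> U" and v: "v \<in> V" and uv: "(u, v) \<in> Dl (prod_op f) (a, b) (b, a)" by blast
    obtain k where k: "(k, k) \<in> pat" "(u, v) = bev (prod_op f) k (a, b) (b, a)" using uv by (rule DlE)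
    have uvA: "u \<in> A" "v \<in> A" using inB u v by blast+
    have "((u, v), (v, u)) \<in> P (a, b)"
      using Pi_star[OF Pi_base k(1), where M = "prod_op f" and t = VY and a = "(a, b)" and b = "(b, a)"] k(2)
      by (simp add: P_def)
    then have "P (u, v) = P (a, b)" by (rule P_eq[OF u v])
    then have "(u, v) \<in> Dl (prod_op f) (u, v) (v, u)" using uv Dl_iff[OF uvA] by simp
    then obtain j where "(j, j) \<in> pat" "(u, v) = bev (prod_op f) j (u, v) (v, u)" by (rule DlE)
    then have "yellow f u v" using yellow_of_pat uvA by simp
    then show False using sep u v by (auto simp: separated_def)
  qed
  \<comment> \<open>Composing two steps gives a step, again by \<open>pat_star\<close>. A reflexive
    point is a pair fixed by a global term, hence yellow, and it is reached from
    \<open>(a, b)\<close> by a single global term.\<close>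
  define step where "step = (\<lambda>(x, y) q. \<exists>k. (k, k) \<in> pat \<and> q = (bev f k x y, bev f k y x))"
  have step_trans: "step p r" if pq: "step p q" and qr: "step q r" for p q r
  proof -
    obtain x y where p: "p = (x, y)" by (cases p)
    obtain k where k: "(k, k) \<in> pat" "q = (bev f k x y, bev f k y x)" using pq p by (auto simp: step_def)
    obtain j where j: "(j, j) \<in> pat" "r = bev (prod_op f) j q (prod.swap q)" using qr by (cases q) (auto simp: step_def)
    have "(sub k VX VY, sub k VY (sub VY VY VX)) \<in> pat" using k(1) by (rule pat_star)
    from pat_sub[OF j(1) this] have "(sub j (sub k VX VY) (sub k VY VX), sub j (sub k VX VY) (sub k VY VX)) \<in> pat" by simp
    then show ?thesis using j(2) k(2) p unfolding step_def by (auto intro!: exI)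
  qed
  let ?Up = "up f B a"
  have aB: "a \<in> B" "b \<in> B" using inB a b by blast+
  have UpB: "?Up \<subseteq> B" using aB(1) by (rule up_subset)
  have succ: "\<exists>q\<in>?Up \<times> B. step p q" if p0: "p \<in> ?Up \<times> B" for p
  proof -
    obtain x y where p: "p = (x, y)" "x \<in> ?Up" "y \<in> B" using p0 by blast
    obtain k where k: "(k, k) \<in> pat" "bev f k x y \<in> ?Up"
      using hits upwards_closed_up[OF aB(1)] p(2,3) by (rule hitsD)
    have "bev f k y x \<in> B" using p UpB clB by (intro op_closed_bev) auto
    then show ?thesis using k p by (auto simp: step_def)
  qed
  let ?S = "{q \<in> ?Up \<times> B. step (a, b) q}"
  have "finite B" using BA finX finite_subset by blast
  then have finS: "finite ?S" using UpB finite_subset[of ?Up B] by (intro finite_subset[of ?S "?Up \<times> B"]) auto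
  have neS: "?S \<noteq> {}" using succ[of "(a, b)"] up_refl[of a f B] aB by blast
  have succS: "\<exists>q\<in>?S. step p q" if "p \<in> ?S" for p
  proof -
    have "p \<in> ?Up \<times> B" and ap: "step (a, b) p" using that by blast+
    then obtain q where "q \<in> ?Up \<times> B" "step p q" using succ by blast
    then show ?thesis using step_trans[OF ap] by blast
  qed
  obtain xy where "xy \<in> ?S" "step xy xy" using finS neS step_trans succS by (rule transitive_has_fixpoint)
  then obtain x y where x: "x \<in> ?Up" and y: "y \<in> B" and sa: "step (a, b) (x, y)" and sx: "step (x, y) (x, y)" by blast
  have xU: "x \<in> U" using up_least[OF upU a order_refl] x by blast
  have xyA: "x \<in> A" "y \<in> A" using xU y inB BA by blast+
  obtain j where "(j, j) \<in> pat" "bev f j x y = x" "bev f j y x = y" using sx by (auto simp: step_def)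
  then have yxy: "yellow f x y" using yellow_of_pat xyA by blast
  obtain d where "(d, d) \<in> pat" "(x, y) = bev (prod_op f) d (a, b) (b, a)" using sa by (auto simp: step_def)
  then have "(x, y) \<in> Dl (prod_op f) (a, b) (b, a)" using DlI[of d "prod_op f" "(a, b)" "(b, a)"] by simp
  then have xyP: "((x, y), (x, y)) \<in> P (a, b)" using Dl_iff xyA by simp
  \<comment> \<open>The partner \<open>y\<close> of \<open>x\<close> need not lie in
    \<open>V\<close>. A partner in \<open>V\<close> is carried along the arrows from
    \<open>a\<close> to \<open>x\<close>, in such a way that the swapped pair stays in
    \<open>P (a, b)\<close>.\<close>
  have "\<exists>v\<in>V. ((x, v), (v, x)) \<in> P (a, b)" using x
  proof (induction rule: up_induct)
    case base show ?case using b Pi_base[of "(a, b)" "(b, a)" "prod_op f"] unfolding P_def by blast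
  next
    case (step x x')
    then obtain v where v: "v \<in> V" "((x, v), (v, x)) \<in> P (a, b)" by blast
    have xU: "x \<in> U" using up_least[OF upU a order_refl] step by blast
    have "x' \<in> gen f x v" using separated_gen[OF sep xU v(1)] step by simp
    then obtain t where t: "x' = bev f t x v" by (rule genE)
    define s where "s = sub sg VX t"
    define v' where "v' = bev f sg v (bev f t v x)"
    have xv: "x \<in> B" "v \<in> B" using inB xU v by blast+
    then have tB: "bev f t v x \<in> B" using clB by (intro op_closed_bev)
    have "bev f s x v = x'" using step BA by (auto simp: s_def t[symmetric] intro: sg_eq)
    moreover have "bev f s v x = v'" by (simp add: s_def v'_def)
    moreover have "f x x' = x'" using step by (simp add: arrow_def)
    moreover have "f v v' = v'" using sg_arrow[of v "bev f t v x"] xv tB BA by (auto simp: v'_def arrow_def)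
    moreover have "(bev (prod_op f) (App VX VY) (x, v) (bev (prod_op f) s (x, v) (v, x)),
        bev (prod_op f) (App VX VY) (v, x) (bev (prod_op f) s (v, x) (x, v))) \<in> P (a, b)"
      using v(2) unfolding P_def prod.case by (rule Pi_star[OF _ pat_basic])
    ultimately have "((x', v'), (v', x')) \<in> P (a, b)" by simp
    moreover have "v' \<in> V" unfolding v'_def using upV clB BA v(1) tB by (rule sg_in_upwards_closed)
    ultimately show ?case by blast
  qed
  then obtain v where v: "v \<in> V" "((x, v), (v, x)) \<in> P (a, b)" by blast
  have "P (x, v) = P (a, b)" using xU v by (rule P_eq)
  then have "(x, y) \<in> Dl (prod_op f) (x, v) (v, x)" using xyP Dl_iff xyA by simp
  then obtain c where c: "(c, c) \<in> pat" "(x, y) = bev (prod_op f) c (x, v) (v, x)" by (rule DlE)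
  \<comment> \<open>Applying \<open>f\<close> to \<open>c(x, y)\<close> and \<open>c(y, x)\<close>
    makes the pair of values of \<open>k\<close> yellow everywhere by \<open>basic_yellow\<close>.
    At \<open>(x, v)\<close> it gives \<open>f x y\<close>, which is still \<open>x\<close> because
    \<open>x\<close> and \<open>y\<close> are yellow.\<close>
  define k where "k = App c (sub c VY VX)"
  have "(sub c VX VY, sub c VY (sub VY VY VX)) \<in> pat" using c(1) by (rule pat_star)
  from pat_sub[OF pat_basic this] have "(App (sub c VX VY) (sub c VY VX), App (sub c VX VY) (sub c VY VX)) \<in> pat" by simp
  moreover have "sub t VX VY = t" for t by (induction t) auto
  ultimately have 1: "(k, k) \<in> pat" by (simp add: k_def)
  have 2: "\<forall>p\<in>A. \<forall>q\<in>A. yellow f (bev f k p q) (bev f k q p)"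
    using basic_yellow op_closed_bev[OF clX] by (simp add: k_def)
  have 3: "bev f k x v = x" using c(2) yxy by (auto simp: k_def yellow_def)
  have "Dl (prod_op f) (x, v) (v, x) \<subseteq> Dl (prod_op f) (a, b) (b, a)"
    using v(2) unfolding P_def prod.case by (rule Dl_trans)
  then have "Dl (prod_op f) (x, v) (v, x) \<inter> U \<times> V = {}" using no_Dl by blast
  then show thesis using that[OF xU v(1) 1 2 3] by blast
qed

text \<open>If \<open>a = t(b, k(b, a))\<close>, then the term \<open>t(x, k(x, y))\<close> has the
  value \<open>a\<close> at \<open>(b, a)\<close> and, because \<open>k(a, b) = a\<close>, also at
  \<open>(a, b)\<close>. Absorption would then give an arrow from \<open>b\<close> to
  \<open>a\<close> and put \<open>a\<close> into \<open>V\<close>.\<close>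

lemma normal_gen:
  assumes sep: "separated U V" and ab: "a \<in> U" "b \<in> V" and k: "bev f k a b = a"
  shows "gen f b (bev f k b a) \<subset> B"
proof -
  let ?e = "bev f k b a"
  note inB = separated_in[OF sep]
  have "?e \<in> B" using inB ab clB by (intro op_closed_bev) auto
  then have "gen f b ?e \<subseteq> B" using inB ab clB by (intro gen_least) auto
  moreover have "gen f b ?e \<noteq> B"
  proof
    assume "gen f b ?e = B"
    then have "a \<in> gen f b ?e" using inB ab by blast
    then obtain t where t: "a = bev f t b ?e" by (rule genE)
    have aA: "a \<in> A" and bA: "b \<in> A" and ne: "b \<noteq> a" using inB(1)[OF ab(1)] inB(2)[OF ab(2)] inB(3)[OF ab] by blast+
    have "bev f (sub t VX k) b a = a" using t by simp
    moreover have "bev f (sub t VX k) a b = a" using k bev_idem[of f a t] idem aA by simp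
    ultimately have "arrow f b a" using absorption[OF bA aA ne] by blast
    moreover have "upwards_closed f B V" "a \<in> B" using sep inB(1)[OF ab(1)] by (simp_all add: separated_def)
    ultimately have "a \<in> V" using ab(2) unfolding upwards_closed_def by blast
    then show False using inB(3)[OF ab(1)] by blast
  qed
  ultimately show ?thesis by blast
qed

lemma not_all_thick:
  assumes sep: "separated U V"
  shows "\<exists>v\<in>V. \<exists>S. right_ideal S \<and> v \<in> S \<and> S \<noteq> B"
proof (rule ccontr)
  assume "\<not> ?thesis"
  then have thick: "S = B" if "right_ideal S" "v \<in> S" "v \<in> V" for S v using that by blast
  have upU: "upwards_closed f B U" and upV: "upwards_closed f B V" using sep by (auto simp: separated_def)
  note inB = separated_in[OF sep]
  obtain a b k where a: "a \<in> U" and b: "b \<in> V" and k: "(k, k) \<in> pat"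
    and ka: "bev f k a b = a" and no_Dl: "Dl (prod_op f) (a, b) (b, a) \<inter> U \<times> V = {}"
    using sep by (rule separated_normal) blast
  have aB: "a \<in> B" "a \<in> A" and bB: "b \<in> B" "b \<in> A" using inB a b by blast+
  define e where "e = bev f k b a"
  have eB: "e \<in> B" unfolding e_def using clB bB(1) aB(1) by (rule op_closed_bev)
  have "yellow_connected f (gen f b e)"
    unfolding e_def using gen_left[of b f] by (intro yc normal_gen[OF sep a b ka] op_closed_gen) blast
  then obtain x1 w1 x2 w2 where x: "x1 \<in> V" "w1 \<in> V" "x2 \<in> U" and yw: "yellow f w1 w2" and w2: "w2 \<in> B"
    and N: "(x1, w1) \<in> gen (prod_op f) (b, b) (a, e)" "(x2, w2) \<in> gen (prod_op f) (b, b) (a, e)"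
    by (rule yellow_second_coordinate[OF BA clB b b a eB upV upU upV])
  \<comment> \<open>This is the right ideal generated by \<open>x1\<close>, all of \<open>B\<close>
    by assumption. Hence \<open>a\<close> is the value of a leftmost term, and such a term keeps
    \<open>w1\<close> on the yellow pair: the first coordinate moves to \<open>a\<close> while the
    second stays in \<open>V\<close>.\<close>
  define S where "S = (\<lambda>t. bev f t x1 x2) ` {t. leftmost t}"
  have gB: "gen f x1 x2 = B" using separated_gen[OF separated_sym[OF sep] x(1,3)] .
  have "right_ideal S"
    unfolding right_ideal_def
  proof (intro conjI ballI)
    show "S \<subseteq> B" unfolding gB[symmetric] S_def gen_def by blast
    fix s y assume "s \<in> S" "y \<in> B"
    then obtain t t' where "leftmost t" "s = bev f t x1 x2" "y = bev f t' x1 x2"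
      unfolding gB[symmetric] S_def gen_def by blast
    then show "f s y \<in> S" unfolding S_def by (intro image_eqI[of _ _ "App t t'"]) auto
  qed
  moreover have "x1 \<in> S" unfolding S_def by (intro image_eqI[of _ _ VX]) auto
  ultimately have "S = B" using x(1) by (rule thick)
  then obtain t where t: "leftmost t" "a = bev f t x1 x2" using aB(1) unfolding S_def by blast
  have wA: "w1 \<in> A" "w2 \<in> A" using inB x w2 BA by blast+
  have "bev f t w1 w2 = w1" using bev_yellow[of f w1 w2 t] idem wA yw t(1) by simp
  moreover have "bev (prod_op f) t (x1, w1) (x2, w2) \<in> gen (prod_op f) (b, b) (a, e)"
    using N by (intro op_closed_bev op_closed_gen)
  ultimately have "(a, w1) \<in> gen (prod_op f) (b, b) (a, e)" using t(2) by simp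
  then obtain s where "(a, w1) = bev (prod_op f) s (b, b) (a, e)" by (rule genE)
  then have s: "bev f s b a = a" "bev f s b e = w1" by simp_all
  define y where "y = bev f s a e"
  have yB: "y \<in> B" unfolding y_def using clB aB(1) eB by (rule op_closed_bev)
  let ?Pi = "Pi (prod_op f) (a, b) (b, a)"
  have "(a, e) \<in> Dl (prod_op f) (a, b) (b, a)" using DlI[OF k, of "prod_op f" "(a, b)" "(b, a)"] ka by (simp add: e_def)
  then have "((a, e), (a, e)) \<in> ?Pi" by (rule Dl_diag)
  \<comment> \<open>Because \<open>s(a, a) = s(b, a) = a\<close>, both parts of the new pattern have
    first coordinate \<open>a\<close>. A global term therefore changes second coordinates only,
    where \<open>hits\<close> leads into \<open>V\<close>.\<close>
  with Pi_base have "(bev (prod_op f) s (a, b) (a, e), bev (prod_op f) s (b, a) (a, e)) \<in> ?Pi" by (rule Pi_bev)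
  then have Pi1: "((a, w1), (a, y)) \<in> ?Pi" using s bev_idem[of f a s] idem aB by (simp add: y_def)
  obtain j where j: "(j, j) \<in> pat" "bev f j w1 y \<in> V" using hits upV x(2) yB by (rule hitsD)
  have "bev (prod_op f) j (a, w1) (a, y) \<in> Dl (prod_op f) (a, b) (b, a)" using Pi1 j(1) by (rule Dl_bev)
  then have "(a, bev f j w1 y) \<in> Dl (prod_op f) (a, b) (b, a)" using bev_idem[of f a j] idem aB by simp
  then show False using no_Dl a j(2) by blast
qed

lemma not_separated: "\<not> separated U V"
proof
  assume sep0: "separated U V"
  obtain v0 SV where v0: "v0 \<in> V" "v0 \<in> SV" and SV: "right_ideal SV" "SV \<noteq> B" using not_all_thick[OF sep0] by blast
  obtain u0 SU where u0: "u0 \<in> U" "u0 \<in> SU" and SU: "right_ideal SU" "SU \<noteq> B"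
    using not_all_thick[OF separated_sym[OF sep0]] by blast
  \<comment> \<open>Right ideals are respected by arrows, since \<open>y = f x y\<close> at an arrow
    from \<open>x\<close> to \<open>y\<close>. They also contain all values of leftmost terms, so
    global values of the pair chosen below lie in \<open>SU \<times> SV\<close>.\<close>
  define U' where "U' = U \<inter> SU"
  define V' where "V' = V \<inter> SV"
  have up_ideal: "upwards_closed f B (W \<inter> S)" if "upwards_closed f B W" "right_ideal S" for W S
    unfolding upwards_closed_def
  proof (intro conjI ballI impI)
    show "W \<inter> S \<subseteq> B" using that by (auto simp: right_ideal_def)
    fix x y assume x: "x \<in> W \<inter> S" and y: "y \<in> B" and a: "arrow f x y"
    have "y \<in> W" using that(1) x y a by (auto simp: upwards_closed_def)
    moreover have "f x y \<in> S" using that(2) x y by (auto simp: right_ideal_def)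
    ultimately show "y \<in> W \<inter> S" using a by (simp add: arrow_def)
  qed
  have upU: "upwards_closed f B U'" and upV: "upwards_closed f B V'"
    unfolding U'_def V'_def using sep0 SU SV by (auto simp: separated_def intro!: up_ideal)
  have sep: "separated U' V'"
    using upU upV sep0 u0 v0 unfolding separated_def U'_def V'_def by blast
  note inB = separated_in[OF sep]
  obtain a b k where a: "a \<in> U'" and b: "b \<in> V'" and k: "(k, k) \<in> pat"
    and ky: "\<forall>x\<in>A. \<forall>y\<in>A. yellow f (bev f k x y) (bev f k y x)"
    and ka: "bev f k a b = a" and no_Dl: "Dl (prod_op f) (a, b) (b, a) \<inter> U' \<times> V' = {}"
    using sep by (rule separated_normal)
  have aB: "a \<in> B" "a \<in> A" and bB: "b \<in> B" "b \<in> A" using inB a b by blast+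
  define e where "e = bev f k b a"
  have eB: "e \<in> B" unfolding e_def using clB bB(1) aB(1) by (rule op_closed_bev)
  obtain j where j: "(j, j) \<in> pat" "bev f j b e \<in> V'" using hits upV b eB by (rule hitsD)
  define b' where "b' = bev f j b e"
  have b'B: "b' \<in> B" using inB j by (simp add: b'_def)
  have J: "gen f b e \<subset> B" unfolding e_def using sep a b ka by (rule normal_gen)
  have aJ: "{a} \<subset> B" using aB bB inB(3)[OF a b] by blast
  let ?M = "prod_op f"
  interpret sq: voting_psemilattice pat ex "A \<times> A" ?M sg by (rule square)
  have abA: "(a, b) \<in> A \<times> A" "(b, a) \<in> A \<times> A" using aB bB by blast+
  let ?c = "(a, e)" and ?w = "(a, b')"
  \<comment> \<open>In the square this triple has pure part \<open>(a, b')\<close> in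
    \<open>U' \<times> V'\<close> and mixed part \<open>(a, e)\<close>. Both lie in
    \<open>{a} \<times> gen f b e\<close>, a product of proper subalgebras, so the climb to a
    pattern is possible there.\<close>
  have "(sub j VX k, k, sub j VY k) \<in> ex" using j(1) k by (rule ex_yellow) (use ky in blast)
  from XsI[OF this, of ?M "(a, b)" "(b, a)"]
  have ex0: "(?w, ?c, (bev f j b a, bev f j a e)) \<in> Xs ?M (a, b) (b, a)"
    using ka bev_idem[of f a j] idem aB by (simp add: e_def b'_def)
  have cla: "op_closed f {a}" using idem aB by (simp add: op_closed_def)
  have gw: "gen ?M ?w ?c \<subseteq> {a} \<times> gen f b e"
  proof (rule gen_least)
    show "op_closed ?M ({a} \<times> gen f b e)" by (intro op_closed_Times cla op_closed_gen)
    show "?c \<in> {a} \<times> gen f b e" using gen_right[of e f b] by blast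
    show "?w \<in> {a} \<times> gen f b e" by (simp add: b'_def gen_bev)
  qed
  have "hyc ?M ({a} \<times> gen f b e)"
    using aB J BA by (intro hyc_Times cla op_closed_gen hyc_proper aJ J) auto
  then have hw: "hyc ?M (gen ?M ?w ?c)" using gw by (rule hyc_mono)
  obtain u q where u: "u \<in> up ?M (gen ?M ?w ?c) ?w" and uq: "(u, q) \<in> Pi ?M (a, b) (b, a)"
    and q: "q \<in> Dl ?M (a, b) (b, a)"
    using abA ex0 hw by (rule sq.exact_to_pattern)
  have upUV: "upwards_closed ?M (B \<times> B) (U' \<times> V')" using upU upV by (rule upwards_closed_Times)
  have "?w \<in> U' \<times> V'" using a j by (simp add: b'_def)
  moreover have "gen ?M ?w ?c \<subseteq> B \<times> B" using gw aB J by blast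
  ultimately have "up ?M (gen ?M ?w ?c) ?w \<subseteq> U' \<times> V'" by (rule up_least[OF upUV])
  then have uUV: "u \<in> U' \<times> V'" using u by blast
  obtain p where p: "(p, p) \<in> pat" "q = bev ?M p (a, b) (b, a)" using q by (rule DlE)
  have aSU: "a \<in> SU" and bSV: "b \<in> SV" using a b by (auto simp: U'_def V'_def)
  have "bev f p a b \<in> SU" using SU(1) aSU bB(1) pat_leftmost[OF p(1)] by (rule leftmost_right_ideal)
  moreover have "bev f p b a \<in> SV" using SV(1) bSV aB(1) pat_leftmost[OF p(1)] by (rule leftmost_right_ideal)
  ultimately have qS: "q \<in> SU \<times> SV" using p(2) by simp
  have uS: "u \<in> SU \<times> SV" using uUV by (auto simp: U'_def V'_def)
  have S: "SU \<subset> B" "SV \<subset> B" "op_closed f SU" "op_closed f SV"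
    using SU SV by (auto simp: right_ideal_def op_closed_def)
  have gS: "gen ?M u q \<subseteq> SU \<times> SV" using S uS qS by (intro gen_least op_closed_Times)
  have "hyc ?M (SU \<times> SV)" using S BA by (intro hyc_Times hyc_proper) auto
  then have "hyc ?M (gen ?M u q)" using gS by (rule hyc_mono)
  with abA uq q have "up ?M (gen ?M u q) u \<inter> Dl ?M (a, b) (b, a) \<noteq> {}" by (rule sq.global_above)
  moreover have "gen ?M u q \<subseteq> B \<times> B" using gS S by blast
  with uUV have "up ?M (gen ?M u q) u \<subseteq> U' \<times> V'" by (rule up_least[OF upUV])
  ultimately show False using no_Dl by blast
qed

end

section \<open>Simultaneous induction on subalgebras\<close>

context bw_algebra
begin

theorem all_yellow_connected:
  assumes "B \<subseteq> A" "op_closed f B"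
  shows "(B \<noteq> {} \<longrightarrow> yellow_connected f B) \<and> hits B"
  using assms
proof (induction "card B" arbitrary: B rule: less_induct)
  case less
  have IH: "(K \<noteq> {} \<longrightarrow> yellow_connected f K) \<and> hits K" if K: "K \<subset> B" "op_closed f K" for K
  proof (rule less.hyps)
    show "card K < card B" using K less.prems finX finite_subset by (intro psubset_card_mono) auto
  qed (use K less.prems in auto)
  have ycK: "yellow_connected f K" if "K \<subset> B" "op_closed f K" "K \<noteq> {}" for K using IH that by blast
  have hK: "hits K" if "K \<subset> B" "op_closed f K" for K using IH[OF that] ..
  \<comment> \<open>The order matters: \<open>hits B\<close> follows from both properties of the
    proper subalgebras, and yellow connectivity of \<open>B\<close> then uses \<open>hits B\<close>
    itself.\<close>
  have hB: "hits B" using less.prems ycK hK by (rule hits_step)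
  interpret bw_minimal pat ex A f sg B
    using bw_algebra_axioms less.prems ycK hB by (intro bw_minimal.intro bw_minimal_axioms.intro)
  have "yellow_connected f B"
    unfolding yellow_connected_def
  proof (intro allI impI)
    fix U V assume "upwards_closed f B U" "U \<noteq> {}" "upwards_closed f B V" "V \<noteq> {}"
    then have "\<exists>u\<in>U. \<exists>v\<in>V. yellow f u v" using not_separated[of U V] unfolding separated_def by blast
    then show "\<exists>u\<in>U. \<exists>v\<in>V. f u v = u \<and> f v u = v" by (simp add: yellow_def)
  qed
  then show ?case using hB by blast
qed

end

section \<open>A partial semilattice term\<close>

lemma bev_funpow:
  "bev M ((App VX ^^ i) VY) x y = (M x ^^ i) y" "bev M ((App VY ^^ i) VX) x y = (M y ^^ i) x"
  by (induction i) auto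

text \<open>Terms in \<open>Q\<close> already fix the targets of arrows, and \<open>Q\<close> is
  closed under substitution in the second variable. It remains to create arrows, one pair
  \<open>(x, z)\<close> at a time, without destroying earlier ones.\<close>

lemma ex_psemilattice:
  fixes M :: "'x \<Rightarrow> 'x \<Rightarrow> 'x"
  assumes fin: "finite X" and cl: "op_closed M X" and idem: "\<And>x. x \<in> X \<Longrightarrow> M x x = x"
    and absorption: "\<And>t x y. x \<in> X \<Longrightarrow> y \<in> X \<Longrightarrow> x \<noteq> y \<Longrightarrow> bev M t x y = y \<Longrightarrow> bev M t y x = y \<Longrightarrow> arrow M x y"
  shows "\<exists>sg. psemilattice X M sg"
proof -
  define Q where "Q = {t. \<forall>x\<in>X. \<forall>y\<in>X. arrow M x y \<longrightarrow> bev M t x y = y}"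
  have Q_sub: "sub q VX p \<in> Q" if "p \<in> Q" "q \<in> Q" for p q using that by (auto simp: Q_def)
  have Q_VY: "VY \<in> Q" by (simp add: Q_def)
  have Q_pow: "(App VX ^^ i) VY \<in> Q" for i
  proof (induction i)
    case (Suc i) then show ?case by (auto simp: Q_def arrow_def)
  qed (simp add: Q_VY)
  have Q_pow': "(App VY ^^ Suc i) VX \<in> Q" for i
  proof (induction i)
    case (Suc i) then show ?case using idem by (auto simp: Q_def)
  qed (auto simp: Q_def arrow_def)
  have good: "\<exists>q\<in>Q. arrow M x (bev M q x z)" if x: "x \<in> X" and z: "z \<in> X" for x z
  proof -
    \<comment> \<open>After this choice every element of \<open>T\<close> generates the same
      subalgebra together with \<open>x\<close>, as no term of \<open>Q\<close> can make it
      smaller.\<close>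
    obtain q0 where q0: "q0 \<in> Q" and qmin: "\<And>q. q \<in> Q \<Longrightarrow> card (gen M x (bev M q0 x z)) \<le> card (gen M x (bev M q x z))"
      using ex_has_least_nat[of "\<lambda>q. q \<in> Q" VY "\<lambda>q. card (gen M x (bev M q x z))"] Q_VY by blast
    define z' where "z' = bev M q0 x z"
    have z'X: "z' \<in> X" unfolding z'_def using cl x z by (rule op_closed_bev)
    define T where "T = (\<lambda>q. bev M q x z') ` Q"
    have TX: "T \<subseteq> X" unfolding T_def using op_closed_bev[OF cl x z'X] by blast
    have T_Q: "bev M q x y \<in> T" if "y \<in> T" "q \<in> Q" for q y
    proof -
      obtain p where p: "p \<in> Q" "y = bev M p x z'" using \<open>y \<in> T\<close> by (auto simp: T_def)
      show ?thesis unfolding T_def using Q_sub[OF p(1) \<open>q \<in> Q\<close>] p(2) by (intro image_eqI[of _ _ "sub q VX p"]) simp_all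
    qed
    have T_good: ?thesis if "y \<in> T" "arrow M x y" for y
    proof -
      obtain p where p: "p \<in> Q" "y = bev M p x z'" using \<open>y \<in> T\<close> by (auto simp: T_def)
      have "arrow M x (bev M (sub p VX q0) x z)" using p(2) \<open>arrow M x y\<close> by (simp add: z'_def)
      then show ?thesis using Q_sub[OF q0 p(1)] by blast
    qed
    have T_gen: "gen M x y = gen M x z'" if "y \<in> T" for y
    proof -
      obtain p where p: "p \<in> Q" "y = bev M p x z'" using \<open>y \<in> T\<close> by (auto simp: T_def)
      have "gen M x z' \<subseteq> X" using cl x z'X by (rule gen_least)
      then have "finite (gen M x z')" using fin finite_subset by blast
      moreover have "gen M x y \<subseteq> gen M x z'" using p(2) by (intro gen_subset gen_left) (simp add: gen_bev)
      moreover have "card (gen M x z') \<le> card (gen M x y)"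
        using qmin[OF Q_sub[OF q0 p(1)]] p(2) by (simp add: z'_def)
      ultimately show ?thesis by (rule card_seteq)
    qed
    show ?thesis
    proof (cases "x \<in> T")
      case True
      then show ?thesis using T_good[of x] idem x by (simp add: arrow_def)
    next
      case False
      \<comment> \<open>Multiplication by \<open>x\<close> from the left maps the finite set
        \<open>T\<close> into itself, so some \<open>y\<close> is periodic; a positive number of
        steps is built into the relation.\<close>
      define r where "r = (\<lambda>y y'. \<exists>i. y' = (M x ^^ Suc i) y)"
      have "r y y''" if ry: "r y y'" "r y' y''" for y y' y''
      proof -
        obtain i j where "y' = (M x ^^ Suc i) y" "y'' = (M x ^^ Suc j) y'" using ry unfolding r_def by blast
        then have "y'' = (M x ^^ (Suc j + Suc i)) y" by (simp only: funpow_add o_apply)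
        then show ?thesis unfolding r_def by (intro exI[of _ "j + Suc i"]) simp
      qed
      moreover have "\<exists>y'\<in>T. r y y'" if "y \<in> T" for y
      proof
        show "r y (M x y)" unfolding r_def by (intro exI[of _ 0]) simp
        show "M x y \<in> T" using T_Q[OF that Q_pow[of 1]] by simp
      qed
      moreover have "finite T" using TX fin finite_subset by blast
      moreover have "T \<noteq> {}" using Q_VY by (auto simp: T_def)
      ultimately obtain y where y: "y \<in> T" and "r y y"
        using transitive_has_fixpoint[of T r] by blast
      then obtain i where "y = (M x ^^ Suc i) y" unfolding r_def by blast
      then have i: "(M x ^^ Suc i) y = y" by simp
      let ?R = "gen (prod_op M) (x, y) (y, x)"
      \<comment> \<open>The same iteration with \<open>x\<close> and \<open>y\<close> exchanged puts
        \<open>(y, t)\<close> into \<open>?R\<close>. At least one factor is required for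
        \<open>t \<in> T\<close>, because the plain variable \<open>VX\<close> need not fix targets
        of arrows. Writing \<open>y\<close> as a term in \<open>x\<close> and \<open>t\<close> then
        gives \<open>(y, y)\<close>.\<close>
      define t where "t = (M y ^^ Suc i) x"
      have "bev (prod_op M) ((App VX ^^ Suc i) VY) (x, y) (y, x) = (y, t)"
        by (subst bev_prod_op) (simp only: bev_funpow fst_conv snd_conv t_def i)
      then have yt: "(y, t) \<in> ?R" by (metis gen_bev)
      have "t \<in> T" using T_Q[OF y Q_pow'[of i]] unfolding bev_funpow t_def .
      then have "gen M x t = gen M x y" using T_gen y by simp
      then have "y \<in> gen M x t" using gen_right[of y M x] by simp
      then obtain s where s: "y = bev M s x t" by (rule genE)
      have yX: "y \<in> X" using y TX by blast
      have "bev (prod_op M) s (y, x) (y, t) \<in> ?R" using yt by (intro op_closed_bev op_closed_gen gen_right)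
      then have "(y, y) \<in> ?R" using s bev_idem[of M y s] idem yX by simp
      then obtain p where "(y, y) = bev (prod_op M) p (x, y) (y, x)" by (rule genE)
      then have "bev M p x y = y" "bev M p y x = y" by auto
      moreover have "x \<noteq> y" using y False by blast
      ultimately have "arrow M x y" using absorption[OF x yX] by blast
      then show ?thesis using T_good y by blast
    qed
  qed
  \<comment> \<open>A term of \<open>Q\<close> with the most good pairs is good everywhere:
    composing it with a term that repairs a bad pair keeps the good ones, since terms of
    \<open>Q\<close> fix targets of arrows.\<close>
  define G where "G = (\<lambda>p. {(x, z) \<in> X \<times> X. arrow M x (bev M p x z)})"
  have G_sub: "G p \<subseteq> X \<times> X" for p by (auto simp: G_def)
  have finG: "finite (G p)" for p using G_sub[of p] fin by (meson finite_SigmaI finite_subset)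
  have bound: "card (G p) < card (X \<times> X) + 1" for p
    using card_mono[OF _ G_sub[of p]] fin by (simp add: less_Suc_eq_le)
  obtain p where p: "p \<in> Q" and pmax: "\<And>q. q \<in> Q \<Longrightarrow> card (G q) \<le> card (G p)"
    using ex_has_greatest_nat[of "\<lambda>q. q \<in> Q" VY "\<lambda>q. card (G q)" "card (X \<times> X) + 1"] Q_VY bound by blast
  have "arrow M x (bev M p x z)" if x: "x \<in> X" and z: "z \<in> X" for x z
  proof (rule ccontr)
    assume no: "\<not> arrow M x (bev M p x z)"
    have "bev M p x z \<in> X" using cl x z by (rule op_closed_bev)
    then obtain q where q: "q \<in> Q" "arrow M x (bev M q x (bev M p x z))" using good x by blast
    have "G p \<subset> G (sub q VX p)"
    proof
      show "G p \<subseteq> G (sub q VX p)"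
        using q(1) op_closed_bev[OF cl] by (auto simp: G_def Q_def)
      have "(x, z) \<in> G (sub q VX p)" "(x, z) \<notin> G p" using x z no q(2) by (auto simp: G_def)
      then show "G p \<noteq> G (sub q VX p)" by blast
    qed
    then have "card (G p) < card (G (sub q VX p))" by (rule psubset_card_mono[OF finG])
    then show False using pmax[OF Q_sub[OF p q(1)]] by simp
  qed
  then have "psemilattice X M p" using fin cl idem p by unfold_locales (auto simp: Q_def)
  then show ?thesis ..
qed

section \<open>Voting with the terms of the algebra\<close>

primrec tsub :: "(nat \<Rightarrow> trm) \<Rightarrow> trm \<Rightarrow> trm" where
  "tsub \<sigma> (Var i) = \<sigma> i"
| "tsub \<sigma> (F s t) = F (tsub \<sigma> s) (tsub \<sigma> t)"
| "tsub \<sigma> (G s t u) = G (tsub \<sigma> s) (tsub \<sigma> t) (tsub \<sigma> u)"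

lemma eval_tsub [simp]: "eval f g \<rho> (tsub \<sigma> t) = eval f g (\<lambda>i. eval f g \<rho> (\<sigma> i)) t"
  by (induction t) auto

primrec trm_of :: "bt \<Rightarrow> trm \<Rightarrow> trm \<Rightarrow> trm" where
  "trm_of VX p q = p"
| "trm_of VY p q = q"
| "trm_of (App s t) p q = F (trm_of s p q) (trm_of t p q)"

lemma eval_trm_of [simp]: "eval f g \<rho> (trm_of t p q) = bev f t (eval f g \<rho> p) (eval f g \<rho> q)"
  by (induction t) auto

text \<open>\<open>S\<close> is proper, so the minority value occurs. Variables from
  \<open>n\<close> on may take any values in \<open>A\<close>; a witnessing term may mention them,
  provided its value does not depend on them.\<close>

definition majority_env :: "'a set \<Rightarrow> nat \<Rightarrow> nat set \<Rightarrow> 'a \<Rightarrow> 'a \<Rightarrow> (nat \<Rightarrow> 'a) \<Rightarrow> bool" where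
  "majority_env A n S x y \<rho> \<longleftrightarrow> S \<subset> {..<n} \<and> n < 2 * card S \<and> x \<in> A \<and> y \<in> A \<and> range \<rho> \<subseteq> A \<and>
     (\<forall>i<n. \<rho> i = (if i \<in> S then x else y))"

locale majority_algebra =
  fixes A :: "'a set" and f :: "'a \<Rightarrow> 'a \<Rightarrow> 'a" and g :: "'a \<Rightarrow> 'a \<Rightarrow> 'a \<Rightarrow> 'a"
  assumes f_closed: "x \<in> A \<Longrightarrow> y \<in> A \<Longrightarrow> f x y \<in> A"
    and g_closed: "x \<in> A \<Longrightarrow> y \<in> A \<Longrightarrow> z \<in> A \<Longrightarrow> g x y z \<in> A"
    and f_idem: "x \<in> A \<Longrightarrow> f x x = x" and g_idem: "x \<in> A \<Longrightarrow> g x x x = x"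
    and f_yellow: "x \<in> A \<Longrightarrow> y \<in> A \<Longrightarrow> f (f x y) (f y x) = f x y"
    and majority: "odd n \<Longrightarrow> 3 \<le> n \<Longrightarrow> \<exists>t. \<forall>S x y \<rho>. majority_env A n S x y \<rho> \<longrightarrow> eval f g \<rho> t = f x y"
begin

section \<open>Patterns and exact triples as families of terms\<close>

definition represents :: "nat \<Rightarrow> trm \<Rightarrow> (nat set \<Rightarrow> bt) \<Rightarrow> bool" where
  "represents n t \<phi> \<longleftrightarrow> (\<forall>S x y \<rho>. majority_env A n S x y \<rho> \<longrightarrow> eval f g \<rho> t = bev f (\<phi> S) x y)"

text \<open>All odd lengths are carried together because the closure rules obtain one length from a
  longer one, for instance \<open>n\<close> from \<open>2 * n + 1\<close> in
  \<open>pat_star\<close>.\<close>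

definition pat :: "(bt \<times> bt) set" where
  "pat = {(p, q). leftmost p \<and> (\<forall>n i. odd n \<longrightarrow> 3 \<le> n \<longrightarrow> i < n \<longrightarrow> (\<exists>t. represents n t (\<lambda>S. if i \<in> S then p else q)))}"

definition ex :: "(bt \<times> bt \<times> bt) set" where
  "ex = {(w, z, v). leftmost w \<and> (z, z) \<in> pat \<and> (\<forall>n e. odd n \<longrightarrow> 3 \<le> n \<longrightarrow> e \<noteq> [] \<longrightarrow> set e \<subseteq> {..<n} \<longrightarrow>
     (\<exists>t. represents n t (\<lambda>S. if set e \<subseteq> S then w else if set e \<inter> S = {} then v else z)))}"

lemma op_closed_A: "op_closed f A"
  by (simp add: op_closed_def f_closed)

lemma bev_A: "x \<in> A \<Longrightarrow> y \<in> A \<Longrightarrow> bev f t x y \<in> A"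
  by (rule op_closed_bev[OF op_closed_A])

lemma bev_const: "x \<in> A \<Longrightarrow> bev f t x x = x"
  by (rule bev_idem) (rule f_idem)

lemma eval_A: "range \<rho> \<subseteq> A \<Longrightarrow> eval f g \<rho> t \<in> A"
  by (induction t) (auto intro: f_closed g_closed)

lemma eval_const: "x \<in> A \<Longrightarrow> eval f g (\<lambda>_. x) t = x"
  by (induction t) (auto simp: f_idem g_idem)

lemma majority_envD:
  assumes "majority_env A n S x y \<rho>"
  shows "x \<in> A" "y \<in> A" "range \<rho> \<subseteq> A" "S \<subset> {..<n}" "n < 2 * card S" "i < n \<Longrightarrow> \<rho> i = (if i \<in> S then x else y)"
    "S \<noteq> {}" "finite S" "\<exists>i<n. i \<notin> S"
  using assms by (auto simp: majority_env_def intro: finite_subset)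

lemma representsD: "represents n t \<phi> \<Longrightarrow> majority_env A n S x y \<rho> \<Longrightarrow> eval f g \<rho> t = bev f (\<phi> S) x y"
  unfolding represents_def by blast

lemma patD:
  assumes "(p, q) \<in> pat" "odd n" "3 \<le> n" "i < n"
  obtains t where "represents n t (\<lambda>S. if i \<in> S then p else q)"
  using assms unfolding pat_def by blast

lemma patI:
  assumes "leftmost p"
    "\<And>n i. odd n \<Longrightarrow> 3 \<le> n \<Longrightarrow> i < n \<Longrightarrow> \<exists>t. represents n t (\<lambda>S. if i \<in> S then p else q)"
  shows "(p, q) \<in> pat"
  using assms unfolding pat_def by blast

lemma ex_tripleD:
  assumes "(w, z, v) \<in> ex" "odd n" "3 \<le> n" "e \<noteq> []" "set e \<subseteq> {..<n}"
  obtains t where "represents n t (\<lambda>S. if set e \<subseteq> S then w else if set e \<inter> S = {} then v else z)"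
  using assms unfolding ex_def by blast

lemma ex_tripleI:
  assumes "leftmost w" "(z, z) \<in> pat"
    "\<And>n e. odd n \<Longrightarrow> 3 \<le> n \<Longrightarrow> e \<noteq> [] \<Longrightarrow> set e \<subseteq> {..<n} \<Longrightarrow>
      \<exists>t. represents n t (\<lambda>S. if set e \<subseteq> S then w else if set e \<inter> S = {} then v else z)"
  shows "(w, z, v) \<in> ex"
  using assms unfolding ex_def by blast

lemma represents_F:
  assumes "represents n s (\<lambda>S. p S)" "represents n t (\<lambda>S. q S)"
  shows "represents n (F s t) (\<lambda>S. App (p S) (q S))"
  using assms by (simp add: represents_def)

lemma represents_cong:
  assumes "represents n t \<phi>" and "\<And>S. \<phi> S = \<psi> S" shows "represents n t \<psi>"
  using assms by (simp add: represents_def)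

lemma leftmost_pat: "(p, q) \<in> pat \<Longrightarrow> leftmost p"
  by (simp add: pat_def)

text \<open>A list of terms with values in \<open>{X, Y}\<close> and majority value \<open>X\<close> is a majority environment, in which
  the terms that witness \<open>(k, k) \<in> pat\<close> can be evaluated.\<close>

definition votes :: "bt \<Rightarrow> trm list \<Rightarrow> trm \<Rightarrow> bool" where
  "votes k ts t \<longleftrightarrow> (\<forall>\<rho> X Y. range \<rho> \<subseteq> A \<longrightarrow> (\<forall>s\<in>set ts. eval f g \<rho> s \<in> {X, Y}) \<longrightarrow>
     length ts < 2 * length (filter (\<lambda>s. eval f g \<rho> s = X) ts) \<longrightarrow> (\<exists>s\<in>set ts. eval f g \<rho> s = Y) \<longrightarrow>
     eval f g \<rho> t = bev f k X Y)"

lemma votesD: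
  assumes "votes k ts t" "range \<rho> \<subseteq> A" "\<forall>s\<in>set ts. eval f g \<rho> s \<in> {X, Y}"
    "length ts < 2 * length (filter (\<lambda>s. eval f g \<rho> s = X) ts)" "\<exists>s\<in>set ts. eval f g \<rho> s = Y"
  shows "eval f g \<rho> t = bev f k X Y"
  using assms unfolding votes_def by blast

lemma ex_votes:
  assumes k: "(k, k) \<in> pat" and n: "odd (length ts)" "3 \<le> length ts"
  shows "\<exists>t. votes k ts t"
proof -
  obtain t where t: "represents (length ts) t (\<lambda>S. if 0 \<in> S then k else k)"
    using k n by (rule patD[of k k "length ts" 0]) (use n in linarith)
  define \<sigma> where "\<sigma> = (\<lambda>i. if i < length ts then ts ! i else ts ! 0)"
  have "0 < length ts" using n by linarith
  then have \<sigma>: "\<sigma> i \<in> set ts" for i by (simp add: \<sigma>_def)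
  have "votes k ts (tsub \<sigma> t)"
    unfolding votes_def
  proof (intro allI impI)
    fix \<rho> X Y
    assume \<rho>: "range \<rho> \<subseteq> A" and XY: "\<forall>s\<in>set ts. eval f g \<rho> s \<in> {X, Y}"
      and maj: "length ts < 2 * length (filter (\<lambda>s. eval f g \<rho> s = X) ts)" and Y: "\<exists>s\<in>set ts. eval f g \<rho> s = Y"
    define \<tau> where "\<tau> = (\<lambda>i. eval f g \<rho> (\<sigma> i))"
    define S where "S = {i. i < length ts \<and> eval f g \<rho> (ts ! i) = X}"
    have card: "length ts < 2 * card S" using maj by (simp add: S_def length_filter_conv_card)
    then have "S \<noteq> {}" by auto
    then have XA: "X \<in> A" using eval_A[OF \<rho>] by (auto simp: S_def)
    have YA: "Y \<in> A" using Y eval_A[OF \<rho>] by blast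
    show "eval f g \<rho> (tsub \<sigma> t) = bev f k X Y"
    proof (cases "X = Y")
      case True
      then have "\<tau> = (\<lambda>_. X)" using XY \<sigma> unfolding \<tau>_def by blast
      then have "eval f g \<tau> t = X" using eval_const[OF XA] by simp
      then show ?thesis using True bev_const[OF XA] by (simp add: \<tau>_def)
    next
      case False
      obtain i where i: "i < length ts" "eval f g \<rho> (ts ! i) = Y" using Y by (auto simp: in_set_conv_nth)
      have "i \<notin> S" using i False by (simp add: S_def)
      then have "S \<subset> {..<length ts}" using i by (auto simp: S_def)
      moreover have "\<tau> i = (if i \<in> S then X else Y)" if "i < length ts" for i
        using XY that by (auto simp: \<tau>_def \<sigma>_def S_def)
      moreover have "range \<tau> \<subseteq> A" using eval_A[OF \<rho>] by (auto simp: \<tau>_def)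
      ultimately have "majority_env A (length ts) S X Y \<tau>" using card XA YA by (simp add: majority_env_def)
      from representsD[OF t this] show ?thesis by (simp add: \<tau>_def)
    qed
  qed
  then show ?thesis ..
qed

lemma pat_basic: "(App VX VY, App VX VY) \<in> pat"
proof (rule patI)
  fix n i :: nat assume "odd n" "3 \<le> n"
  from majority[OF this] obtain t where "\<forall>S x y \<rho>. majority_env A n S x y \<rho> \<longrightarrow> eval f g \<rho> t = f x y" ..
  then have "represents n t (\<lambda>S. if i \<in> S then App VX VY else App VX VY)"
    by (simp add: represents_def)
  then show "\<exists>t. represents n t (\<lambda>S. if i \<in> S then App VX VY else App VX VY)" ..
qed simp

lemma pat_sub:
  assumes p': "(p', q') \<in> pat" and p: "(p, q) \<in> pat"
  shows "(sub p' p q, sub q' p q) \<in> pat"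
proof (rule patI)
  show "leftmost (sub p' p q)" using p p' by (intro leftmost_sub leftmost_pat)
  fix n i :: nat assume n: "odd n" "3 \<le> n" and i: "i < n"
  obtain t where t: "represents n t (\<lambda>S. if i \<in> S then p' else q')" using p' n i by (rule patD)
  have "\<forall>j. \<exists>s. j < n \<longrightarrow> represents n s (\<lambda>S. if j \<in> S then p else q)" using patD[OF p n] by metis
  then obtain \<sigma> where \<sigma>: "\<And>j. j < n \<Longrightarrow> represents n (\<sigma> j) (\<lambda>S. if j \<in> S then p else q)" by metis
  have "represents n (tsub \<sigma> t) (\<lambda>S. if i \<in> S then sub p' p q else sub q' p q)"
    unfolding represents_def
  proof (intro allI impI)
    fix S x y \<rho> assume E: "majority_env A n S x y \<rho>"
    note D = majority_envD[OF E]
    have "eval f g \<rho> (\<sigma> j) = (if j \<in> S then bev f p x y else bev f q x y)" if "j < n" for j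
      using representsD[OF \<sigma>[OF that] E] by simp
    then have "majority_env A n S (bev f p x y) (bev f q x y) (\<lambda>j. eval f g \<rho> (\<sigma> j))"
      using D bev_A eval_A[OF D(3)] unfolding majority_env_def by blast
    from representsD[OF t this]
    show "eval f g \<rho> (tsub \<sigma> t) = bev f (if i \<in> S then sub p' p q else sub q' p q) x y" by simp
  qed
  then show "\<exists>t. represents n t (\<lambda>S. if i \<in> S then sub p' p q else sub q' p q)" ..
qed

text \<open>Place \<open>i\<close> casts \<open>n + 1\<close> votes for its own value against the
  \<open>n\<close> values \<open>t(x_i, x_j)\<close>. Such a value equals \<open>x_i\<close> when
  \<open>i\<close> and \<open>j\<close> are on the same side, so exactly one other value competes,
  and it occurs because both sides are nonempty.\<close>

lemma pat_star:
  assumes k: "(k, k) \<in> pat"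
  shows "(sub k VX t, sub k VY (sub t VY VX)) \<in> pat"
proof (rule patI)
  show "leftmost (sub k VX t)" using leftmost_pat[OF k] by (intro leftmost_sub) auto
  fix n i :: nat assume n: "odd n" "3 \<le> n" and i: "i < n"
  define ts where "ts = replicate (n + 1) (Var i) @ map (\<lambda>j. trm_of t (Var i) (Var j)) [0..<n]"
  have len: "length ts = 2 * n + 1" by (simp add: ts_def)
  have "odd (length ts)" "3 \<le> length ts" using len n by auto
  then obtain s where s: "votes k ts s" using ex_votes[OF k] by blast
  have "represents n s (\<lambda>S. if i \<in> S then sub k VX t else sub k VY (sub t VY VX))"
    unfolding represents_def
  proof (intro allI impI)
    fix S x y \<rho> assume E: "majority_env A n S x y \<rho>"
    note D = majority_envD[OF E]
    define X where "X = \<rho> i"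
    define Y where "Y = bev f t X (if i \<in> S then y else x)"
    have X: "X = (if i \<in> S then x else y)" using D(6) i by (simp add: X_def)
    have j: "bev f t X (\<rho> j) = (if j \<in> S \<longleftrightarrow> i \<in> S then X else Y)" if "j < n" for j
      using D(6)[OF that] D(1,2) by (auto simp: X Y_def bev_const)
    have "\<exists>j<n. \<not> (j \<in> S \<longleftrightarrow> i \<in> S)" using D(4,7,9) by auto
    then obtain l where l: "l < n" "\<not> (l \<in> S \<longleftrightarrow> i \<in> S)" by blast
    have "eval f g \<rho> s = bev f k X Y"
    proof (rule votesD[OF s D(3)])
      show "\<forall>s\<in>set ts. eval f g \<rho> s \<in> {X, Y}" using j by (auto simp: ts_def X_def[symmetric])
      show "length ts < 2 * length (filter (\<lambda>s. eval f g \<rho> s = X) ts)"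
        unfolding len by (simp add: ts_def X_def)
      show "\<exists>s\<in>set ts. eval f g \<rho> s = Y" using j[OF l(1)] l by (auto simp: ts_def X_def[symmetric])
    qed
    then show "eval f g \<rho> s = bev f (if i \<in> S then sub k VX t else sub k VY (sub t VY VX)) x y"
      by (simp add: X Y_def)
  qed
  then show "\<exists>s. represents n s (\<lambda>S. if i \<in> S then sub k VX t else sub k VY (sub t VY VX))" ..
qed

text \<open>The vote runs over all places \<open>j\<close>, each added to the list \<open>e\<close>.
  A list inside the majority stays pure exactly for \<open>j\<close> in the majority, so
  \<open>w\<close> wins over \<open>z\<close>; a list avoiding it turns mixed for these
  \<open>j\<close>, so \<open>z\<close> wins over \<open>v\<close>; a mixed list stays
  mixed.\<close>

lemma ex_row:
  assumes w: "(w, z, v) \<in> ex" and k: "(k, k) \<in> pat"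
  shows "(sub k w z, z, sub k z v) \<in> ex"
proof (rule ex_tripleI)
  have z: "(z, z) \<in> pat" and lw: "leftmost w" using w by (auto simp: ex_def)
  show "(z, z) \<in> pat" by (rule z)
  show "leftmost (sub k w z)" using leftmost_pat[OF k] lw by (rule leftmost_sub)
  fix n :: nat and e :: "nat list" assume n: "odd n" "3 \<le> n" and e: "e \<noteq> []" "set e \<subseteq> {..<n}"
  let ?val = "\<lambda>e S. if set e \<subseteq> S then w else if set e \<inter> S = {} then v else z"
  have "\<forall>j. \<exists>s. j < n \<longrightarrow> represents n s (?val (j # e))"
  proof
    fix j show "\<exists>s. j < n \<longrightarrow> represents n s (?val (j # e))"
    proof (cases "j < n")
      case True
      then have "set (j # e) \<subseteq> {..<n}" using e by simp
      then show ?thesis using ex_tripleD[OF w n, of "j # e"] by blast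
    qed simp
  qed
  then obtain \<sigma> where \<sigma>: "\<And>j. j < n \<Longrightarrow> represents n (\<sigma> j) (?val (j # e))" by metis
  define ts where "ts = map \<sigma> [0..<n]"
  have "odd (length ts)" "3 \<le> length ts" using n by (simp_all add: ts_def)
  then obtain s where s: "votes k ts s" using ex_votes[OF k] by blast
  let ?goal = "\<lambda>S. if set e \<subseteq> S then sub k w z else if set e \<inter> S = {} then sub k z v else z"
  have "represents n s ?goal"
    unfolding represents_def
  proof (intro allI impI)
    fix S x y \<rho> assume E: "majority_env A n S x y \<rho>"
    note D = majority_envD[OF E]
    have val: "eval f g \<rho> (\<sigma> j) = bev f (?val (j # e) S) x y" if "j < n" for j
      using representsD[OF \<sigma>[OF that] E] .
    have tally: "eval f g \<rho> s = bev f k X Y"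
      if v: "\<And>j. j < n \<Longrightarrow> eval f g \<rho> (\<sigma> j) = (if j \<in> S then X else Y)" for X Y
    proof (rule votesD[OF s D(3)])
      show "\<forall>s\<in>set ts. eval f g \<rho> s \<in> {X, Y}" using v by (auto simp: ts_def)
      have "card S \<le> card {i. i < length ts \<and> eval f g \<rho> (ts ! i) = X}"
        using D(4) v by (intro card_mono) (auto simp: ts_def)
      then show "length ts < 2 * length (filter (\<lambda>s. eval f g \<rho> s = X) ts)"
        using D(5) by (simp add: length_filter_conv_card ts_def)
      show "\<exists>s\<in>set ts. eval f g \<rho> s = Y" using D(9) v by (auto simp: ts_def)
    qed
    consider "set e \<subseteq> S" | "set e \<inter> S = {}" "\<not> set e \<subseteq> S" | "\<not> set e \<subseteq> S" "set e \<inter> S \<noteq> {}" by blast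
    then show "eval f g \<rho> s = bev f (?goal S) x y"
    proof cases
      case 1
      then have ne: "set e \<inter> S \<noteq> {}" using e(1) by (cases e) auto
      have "eval f g \<rho> s = bev f k (bev f w x y) (bev f z x y)" using 1 ne by (intro tally) (auto simp: val)
      then show ?thesis using 1 by simp
    next
      case 2
      then have "eval f g \<rho> s = bev f k (bev f z x y) (bev f v x y)" using e(1) by (intro tally) (auto simp: val)
      then show ?thesis using 2 by simp
    next
      case 3
      then have "eval f g \<rho> s = bev f k (bev f z x y) (bev f z x y)" by (intro tally) (auto simp: val)
      then show ?thesis using 3 bev_const bev_A D(1,2) by simp
    qed
  qed
  then show "\<exists>t. represents n t ?goal" by blast
qed

text \<open>Lists covering more than half of the places always meet the majority, so they never show
  \<open>v\<close>; the list of the majority itself shows \<open>w\<close>. One more copy of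
  \<open>z\<close> than there are lists makes \<open>z\<close> the winner and \<open>w\<close> the
  minority value in every environment.\<close>

lemma ex_vote:
  assumes w: "(w, z, v) \<in> ex" and k: "(k, k) \<in> pat"
  shows "(sub k z w, sub k z w) \<in> pat"
proof (rule patI)
  have z: "(z, z) \<in> pat" using w by (auto simp: ex_def)
  show "leftmost (sub k z w)" using leftmost_pat[OF k] leftmost_pat[OF z] by (rule leftmost_sub)
  fix n i :: nat assume n: "odd n" "3 \<le> n" and i: "i < n"
  let ?val = "\<lambda>e S. if set e \<subseteq> S then w else if set e \<inter> S = {} then v else z"
  define E where "E = {e. set e \<subseteq> {..<n} \<and> length e \<le> n \<and> n < 2 * card (set e)}"
  have "finite E" by (rule finite_subset[OF _ finite_lists_length_le[of "{..<n}" n]]) (auto simp: E_def)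
  then obtain es where es: "set es = E" using finite_list by blast
  have "\<forall>e. \<exists>s. e \<in> E \<longrightarrow> represents n s (?val e)"
  proof
    fix e show "\<exists>s. e \<in> E \<longrightarrow> represents n s (?val e)"
    proof (cases "e \<in> E")
      case True
      then have "e \<noteq> []" "set e \<subseteq> {..<n}" by (auto simp: E_def)
      then show ?thesis using ex_tripleD[OF w n, of e] by blast
    qed simp
  qed
  then obtain \<sigma> where \<sigma>: "\<And>e. e \<in> E \<Longrightarrow> represents n (\<sigma> e) (?val e)" by metis
  obtain zt where zt: "represents n zt (\<lambda>S. if i \<in> S then z else z)" using z n i by (rule patD)
  define ts where "ts = map \<sigma> es @ replicate (length es + 1) zt"
  have len: "length ts = 2 * length es + 1" by (simp add: ts_def)
  have "[0..<n] \<in> E" using n by (auto simp: E_def atLeast0LessThan)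
  then have "es \<noteq> []" using es by auto
  then have "0 < length es" by simp
  then have "3 \<le> length ts" using len by linarith
  moreover have "odd (length ts)" using len by simp
  ultimately obtain s where s: "votes k ts s" using ex_votes[OF k] by blast
  have "represents n s (\<lambda>S. if i \<in> S then sub k z w else sub k z w)"
    unfolding represents_def
  proof (intro allI impI)
    fix S x y \<rho> assume En: "majority_env A n S x y \<rho>"
    note D = majority_envD[OF En]
    have vz: "eval f g \<rho> zt = bev f z x y" using representsD[OF zt En] by simp
    have val: "eval f g \<rho> (\<sigma> e) = (if set e \<subseteq> S then bev f w x y else bev f z x y)" if e: "e \<in> E" for e
    proof -
      have "set e \<inter> S \<noteq> {}"
      proof
        assume "set e \<inter> S = {}"
        then have "card (set e) + card S = card (set e \<union> S)" using D(8) by (simp add: card_Un_disjoint)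
        also have "\<dots> \<le> card {..<n}" using e D(4) by (intro card_mono) (auto simp: E_def)
        finally show False using e D(5) by (simp add: E_def)
      qed
      then show ?thesis using representsD[OF \<sigma>[OF e] En] by simp
    qed
    have "card S \<le> n" using D(4) card_mono[of "{..<n}" S] by auto
    then have S: "sorted_list_of_set S \<in> E" using D(4,5,8) by (auto simp: E_def)
    have "eval f g \<rho> s = bev f k (bev f z x y) (bev f w x y)"
    proof (rule votesD[OF s D(3)])
      show "\<forall>s\<in>set ts. eval f g \<rho> s \<in> {bev f z x y, bev f w x y}" using val vz es by (auto simp: ts_def)
      show "length ts < 2 * length (filter (\<lambda>s. eval f g \<rho> s = bev f z x y) ts)"
        unfolding len by (simp add: ts_def vz)
      show "\<exists>s\<in>set ts. eval f g \<rho> s = bev f w x y"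
        using val[OF S] S D(8) es by (intro bexI[of _ "\<sigma> (sorted_list_of_set S)"]) (auto simp: ts_def)
    qed
    then show "eval f g \<rho> s = bev f (if i \<in> S then sub k z w else sub k z w) x y" by simp
  qed
  then show "\<exists>t. represents n t (\<lambda>S. if i \<in> S then sub k z w else sub k z w)" ..
qed

text \<open>Every place of the list votes by \<open>k\<close> against the whole list. On a constant
  list this returns the common value; on a mixed one it returns \<open>c = k(x, y)\<close> or
  \<open>d = k(y, x)\<close>, and a second vote by \<open>j\<close> settles on \<open>c\<close>
  because \<open>c\<close> and \<open>d\<close> are yellow.\<close>

lemma ex_yellow:
  assumes j: "(j, j) \<in> pat" and k: "(k, k) \<in> pat"
    and ky: "\<And>x y. x \<in> A \<Longrightarrow> y \<in> A \<Longrightarrow> yellow f (bev f k x y) (bev f k y x)"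
  shows "(sub j VX k, k, sub j VY k) \<in> ex"
proof (rule ex_tripleI)
  show "(k, k) \<in> pat" by (rule k)
  show "leftmost (sub j VX k)" using leftmost_pat[OF j] by (intro leftmost_sub) auto
  fix n :: nat and e0 :: "nat list" assume n: "odd n" "3 \<le> n" and e0: "e0 \<noteq> []" "set e0 \<subseteq> {..<n}"
  \<comment> \<open>Doubling changes no side of the list and guarantees at least two entries, so
    that the second vote has length at least three.\<close>
  define e where "e = e0 @ e0"
  have e: "set e = set e0" "2 \<le> length e" using e0 by (cases e0; simp add: e_def)+
  define star where "star = (\<lambda>i. replicate (length e + 1) (Var i) @ map Var e)"
  have len: "length (star i) = 2 * length e + 1" for i by (simp add: star_def)
  have "\<forall>i. \<exists>t. votes k (star i) t"
  proof
    fix i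
    have "odd (length (star i))" "3 \<le> length (star i)" using len[of i] e by auto
    then show "\<exists>t. votes k (star i) t" by (rule ex_votes[OF k])
  qed
  then obtain \<sigma> where \<sigma>: "\<And>i. votes k (star i) (\<sigma> i)" by metis
  have star_val: "eval f g \<rho> (\<sigma> i) = bev f k (\<rho> i) Y"
    if \<rho>: "range \<rho> \<subseteq> A" and v: "\<forall>l\<in>set e. \<rho> l \<in> {\<rho> i, Y}" "l \<in> insert i (set e)" "\<rho> l = Y" for \<rho> i l Y
  proof (rule votesD[OF \<sigma> \<rho>])
    show "\<forall>s\<in>set (star i). eval f g \<rho> s \<in> {\<rho> i, Y}" using v(1) by (auto simp: star_def)
    show "length (star i) < 2 * length (filter (\<lambda>s. eval f g \<rho> s = \<rho> i) (star i))" unfolding len by (simp add: star_def)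
    have "Var l \<in> set (star i)" using v(2) by (auto simp: star_def)
    then show "\<exists>s\<in>set (star i). eval f g \<rho> s = Y" using v(3) by (intro bexI[of _ "Var l"]) simp_all
  qed
  obtain kt where kt: "represents n kt (\<lambda>S. if 0 \<in> S then k else k)" using k n by (rule patD[of k k n 0]) (use n in linarith)
  \<comment> \<open>With one copy fewer than entries, a constant list outvotes the value
    \<open>c\<close>, while on a mixed list a single entry with value \<open>c\<close> already gives
    \<open>c\<close> the majority.\<close>
  define ts where "ts = map \<sigma> e @ replicate (length e - 1) kt"
  have tlen: "length ts = 2 * length e - 1" by (simp add: ts_def)
  have "odd (length ts)" "3 \<le> length ts" using tlen e by auto
  then obtain s where s: "votes j ts s" using ex_votes[OF j] by blast
  let ?goal = "\<lambda>S. if set e0 \<subseteq> S then sub j VX k else if set e0 \<inter> S = {} then sub j VY k else k"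
  have "represents n s ?goal"
    unfolding represents_def
  proof (intro allI impI)
    fix S x y \<rho> assume E: "majority_env A n S x y \<rho>"
    note D = majority_envD[OF E]
    have eS: "\<rho> l = (if l \<in> S then x else y)" if "l \<in> set e" for l using D(6) that e0 e by auto
    define c where "c = bev f k x y"
    have vk: "eval f g \<rho> kt = c" using representsD[OF kt E] by (simp add: c_def)
    have const: "eval f g \<rho> s = bev f j X c" if X: "\<And>l. l \<in> set e \<Longrightarrow> \<rho> l = X" for X
    proof -
      have "hd e0 \<in> set e" using e e0 by simp
      then have "X \<in> A" using X D(3) by blast
      then have v: "eval f g \<rho> (\<sigma> l) = X" if "l \<in> set e" for l
        using star_val[OF D(3), of l X l] X[OF that] X bev_const[OF \<open>X \<in> A\<close>] by simp
      show ?thesis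
      proof (rule votesD[OF s D(3)])
        show "\<forall>s\<in>set ts. eval f g \<rho> s \<in> {X, c}" using v vk by (auto simp: ts_def)
        have "filter (\<lambda>l. eval f g \<rho> (\<sigma> l) = X) e = e" using v by (simp add: filter_id_conv)
        then have "length e \<le> length (filter (\<lambda>s. eval f g \<rho> s = X) ts)" by (simp add: ts_def filter_map o_def)
        then show "length ts < 2 * length (filter (\<lambda>s. eval f g \<rho> s = X) ts)" using tlen e by simp
        show "\<exists>s\<in>set ts. eval f g \<rho> s = c" using vk e by (auto simp: ts_def)
      qed
    qed
    consider "set e \<subseteq> S" | "set e \<inter> S = {}" "\<not> set e \<subseteq> S" | "\<not> set e \<subseteq> S" "set e \<inter> S \<noteq> {}" by blast
    then show "eval f g \<rho> s = bev f (?goal S) x y"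
    proof cases
      case 1
      then have "eval f g \<rho> s = bev f j x c" using eS by (intro const) auto
      then show ?thesis using 1 e by (simp add: c_def)
    next
      case 2
      then have "eval f g \<rho> s = bev f j y c" using eS by (intro const) auto
      then show ?thesis using 2 e by (simp add: c_def)
    next
      case 3
      then obtain l1 l2 where l: "l1 \<in> set e" "l1 \<in> S" "l2 \<in> set e" "l2 \<notin> S" by blast
      define d where "d = bev f k y x"
      have v: "eval f g \<rho> (\<sigma> l) = (if l \<in> S then c else d)" if "l \<in> set e" for l
      proof (cases "l \<in> S")
        case True
        have "eval f g \<rho> (\<sigma> l) = bev f k (\<rho> l) y" using eS l True that by (intro star_val[OF D(3), of _ _ l2]) auto
        then show ?thesis using True eS that by (simp add: c_def)
      next
        case False
        have "eval f g \<rho> (\<sigma> l) = bev f k (\<rho> l) x" using eS l False that by (intro star_val[OF D(3), of _ _ l1]) auto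
        then show ?thesis using False eS that by (simp add: d_def)
      qed
      have "eval f g \<rho> s = bev f j c d"
      proof (rule votesD[OF s D(3)])
        show "\<forall>s\<in>set ts. eval f g \<rho> s \<in> {c, d}" using v vk by (auto simp: ts_def)
        have "l1 \<in> set (filter (\<lambda>l. eval f g \<rho> (\<sigma> l) = c) e)" using l v by simp
        then have "1 \<le> length (filter (\<lambda>l. eval f g \<rho> (\<sigma> l) = c) e)" by (metis One_nat_def Suc_leI length_pos_if_in_set)
        moreover have "length (filter (\<lambda>s. eval f g \<rho> s = c) ts) = length (filter (\<lambda>l. eval f g \<rho> (\<sigma> l) = c) e) + (length e - 1)"
          using vk by (simp add: ts_def filter_map o_def)
        ultimately show "length ts < 2 * length (filter (\<lambda>s. eval f g \<rho> s = c) ts)" using tlen e by simp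
        show "\<exists>s\<in>set ts. eval f g \<rho> s = d" using v[OF l(3)] l by (auto simp: ts_def)
      qed
      moreover have "bev f j c d = c"
        using bev_yellow[of f c d j] ky[OF D(1,2)] leftmost_pat[OF j] f_idem bev_A D(1,2) by (simp add: c_def d_def)
      ultimately show ?thesis using 3 e by (simp add: c_def)
    qed
  qed
  then show "\<exists>t. represents n t ?goal" by blast
qed

lemma pat_App:
  assumes pq: "(p, q) \<in> pat" "(p', q') \<in> pat"
  shows "(App p p', App q q') \<in> pat"
proof (rule patI)
  show "leftmost (App p p')" using leftmost_pat[OF pq(1)] by simp
  fix n i :: nat assume n: "odd n" "3 \<le> n" "i < n"
  obtain t where t: "represents n t (\<lambda>S. if i \<in> S then p else q)" using pq(1) n by (rule patD)
  obtain t' where t': "represents n t' (\<lambda>S. if i \<in> S then p' else q')" using pq(2) n by (rule patD)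
  have "represents n (F t t') (\<lambda>S. if i \<in> S then App p p' else App q q')"
    using represents_F[OF t t'] by (rule represents_cong) simp
  then show "\<exists>t. represents n t (\<lambda>S. if i \<in> S then App p p' else App q q')" ..
qed

sublocale voting pat ex
proof
  show "(VX, VY) \<in> pat"
  proof (rule patI)
    fix n i :: nat assume "i < n"
    then have "represents n (Var i) (\<lambda>S. if i \<in> S then VX else VY)"
      using majority_envD(6) by (fastforce simp: represents_def)
    then show "\<exists>t. represents n t (\<lambda>S. if i \<in> S then VX else VY)" ..
  qed simp
next
  fix d assume d: "(d, d) \<in> pat"
  show "(d, d, d) \<in> ex"
  proof (rule ex_tripleI)
    fix n :: nat and e :: "nat list" assume n: "odd n" "3 \<le> n"
    obtain t where "represents n t (\<lambda>S. if 0 \<in> S then d else d)" using d n by (rule patD[of d d n 0]) (use n in linarith)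
    then have "represents n t (\<lambda>S. if set e \<subseteq> S then d else if set e \<inter> S = {} then d else d)"
      by (rule represents_cong) simp
    then show "\<exists>t. represents n t (\<lambda>S. if set e \<subseteq> S then d else if set e \<inter> S = {} then d else d)" ..
  qed (use d leftmost_pat in auto)
next
  fix w z v assume w: "(w, z, v) \<in> ex"
  show "(z, z) \<in> pat" using w by (simp add: ex_def)
  show "(w, v) \<in> pat"
  proof (rule patI)
    show "leftmost w" using w by (simp add: ex_def)
    fix n i :: nat assume n: "odd n" "3 \<le> n" "i < n"
    obtain t where "represents n t (\<lambda>S. if set [i] \<subseteq> S then w else if set [i] \<inter> S = {} then v else z)"
      using w n(1,2) by (rule ex_tripleD[of _ _ _ _ "[i]"]) (use n in auto)
    then have "represents n t (\<lambda>S. if i \<in> S then w else v)" by (rule represents_cong) simp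
    then show "\<exists>t. represents n t (\<lambda>S. if i \<in> S then w else v)" ..
  qed
next
  fix w z v w' z' v' assume w: "(w, z, v) \<in> ex" "(w', z', v') \<in> ex"
  show "(App w w', App z z', App v v') \<in> ex"
  proof (rule ex_tripleI)
    show "leftmost (App w w')" "(App z z', App z z') \<in> pat" using w pat_App by (auto simp: ex_def)
    fix n :: nat and e :: "nat list" assume n: "odd n" "3 \<le> n" "e \<noteq> []" "set e \<subseteq> {..<n}"
    obtain t where t: "represents n t (\<lambda>S. if set e \<subseteq> S then w else if set e \<inter> S = {} then v else z)"
      using w(1) n by (rule ex_tripleD)
    obtain t' where t': "represents n t' (\<lambda>S. if set e \<subseteq> S then w' else if set e \<inter> S = {} then v' else z')"
      using w(2) n by (rule ex_tripleD)
    have "represents n (F t t') (\<lambda>S. if set e \<subseteq> S then App w w' else if set e \<inter> S = {} then App v v' else App z z')"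
      using represents_F[OF t t'] by (rule represents_cong) simp
    then show "\<exists>t. represents n t (\<lambda>S. if set e \<subseteq> S then App w w' else if set e \<inter> S = {} then App v v' else App z z')" ..
  qed
qed (fact leftmost_pat pat_basic pat_App pat_sub pat_star ex_row ex_vote)+

end

section \<open>Terms and clones\<close>

lemma eval_cong: "(\<And>i. i \<in> vars t \<Longrightarrow> \<rho> i = \<tau> i) \<Longrightarrow> eval f g \<rho> t = eval f g \<tau> t"
  by (induction t) auto

lemma vars_tsub: "vars (tsub \<sigma> t) = (\<Union>i\<in>vars t. vars (\<sigma> i))"
  by (induction t) auto

lemma vars_trm_of: "vars (trm_of t p q) \<subseteq> vars p \<union> vars q"
  by (induction t) auto

lemma op3_operation:
  "(\<And>x y z. x \<in> A \<Longrightarrow> y \<in> A \<Longrightarrow> z \<in> A \<Longrightarrow> g x y z \<in> A) \<Longrightarrow> op3 A g \<in> operations A 3"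
  unfolding operations_def op3_def
  by (intro restrict_PiE_iff[THEN iffD2] ballI) (auto simp: tuples_def subset_iff)

lemma Clo_term:
  assumes "(n, p) \<in> Clo A {(3, op3 A g)}" and g: "\<And>x y z. x \<in> A \<Longrightarrow> y \<in> A \<Longrightarrow> z \<in> A \<Longrightarrow> g x y z \<in> A"
  shows "\<exists>t. vars t \<subseteq> {..<n} \<and> p = term_operation A f g n t"
  using assms(1)
proof (induction rule: Clo.induct)
  case (proj i n)
  then show ?case by (intro exI[of _ "Var i"]) (simp add: term_operation_def projection_def)
next
  case (comp k p qs n)
  then have k: "k = 3" "p = op3 A g" by auto
  then obtain q0 q1 q2 where qs: "qs = [q0, q1, q2]" using comp(2) by (auto simp: numeral_3_eq_3 length_Suc_conv)
  obtain t0 t1 t2 where t: "vars t0 \<subseteq> {..<n}" "q0 = term_operation A f g n t0"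
    "vars t1 \<subseteq> {..<n}" "q1 = term_operation A f g n t1" "vars t2 \<subseteq> {..<n}" "q2 = term_operation A f g n t2"
    using comp(3) unfolding qs by auto
  have ops: "q \<in> operations A n" if "q \<in> set qs" for q
    using comp(3) that g by (intro Clo_operations[of "{(3, op3 A g)}" A n q]) (auto intro: op3_operation)
  have "composition A n p qs = term_operation A f g n (G t0 t1 t2)"
  proof
    fix xs
    show "composition A n p qs xs = term_operation A f g n (G t0 t1 t2) xs"
    proof (cases "xs \<in> tuples A n")
      case True
      then have "q xs \<in> A" if "q \<in> set qs" for q using ops[OF that] by (auto simp: operations_def)
      then have "[q0 xs, q1 xs, q2 xs] \<in> tuples A 3" by (simp add: qs tuples_def)
      then show ?thesis using True t(2,4,6)
        by (simp add: composition_def term_operation_def qs k op3_def)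
    qed (simp add: composition_def term_operation_def)
  qed
  then show ?case using t(1,3,5) by (intro exI[of _ "G t0 t1 t2"]) simp
qed

lemma term_Clo:
  assumes f: "\<And>x y. x \<in> A \<Longrightarrow> y \<in> A \<Longrightarrow> f x y \<in> A" and g: "\<And>x y z. x \<in> A \<Longrightarrow> y \<in> A \<Longrightarrow> z \<in> A \<Longrightarrow> g x y z \<in> A"
    and fg: "\<And>x y. x \<in> A \<Longrightarrow> y \<in> A \<Longrightarrow> g x x y = f x y" and t: "vars t \<subseteq> {..<n}"
  shows "(n, term_operation A f g n t) \<in> Clo A {(3, op3 A g)}"
proof -
  have val: "eval f g ((!) xs) t \<in> A" if "xs \<in> tuples A n" "vars t \<subseteq> {..<n}" for xs t
    using that by (induction t) (auto simp: tuples_def intro!: f g)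
  show ?thesis
    using t
  proof (induction t)
    case (Var i)
    have "term_operation A f g n (Var i) = projection A n i" by (simp add: term_operation_def projection_def)
    then show ?case using Clo.proj[of i n] Var by simp
  next
    case (F s t)
    let ?S = "term_operation A f g n s" and ?T = "term_operation A f g n t"
    have "composition A n (op3 A g) [?S, ?S, ?T] = term_operation A f g n (F s t)"
    proof
      fix xs
      show "composition A n (op3 A g) [?S, ?S, ?T] xs = term_operation A f g n (F s t) xs"
      proof (cases "xs \<in> tuples A n")
        case True
        then have "eval f g ((!) xs) s \<in> A" "eval f g ((!) xs) t \<in> A" using val F(3) by simp_all
        then show ?thesis using True fg by (simp add: composition_def term_operation_def op3_def) (simp add: tuples_def)
      qed (simp add: composition_def term_operation_def)
    qed
    moreover have "(n, composition A n (op3 A g) [?S, ?S, ?T]) \<in> Clo A {(3, op3 A g)}"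
      using F by (intro Clo.comp[of 3]) auto
    ultimately show ?case by simp
  next
    case (G s t u)
    let ?S = "term_operation A f g n s" and ?T = "term_operation A f g n t" and ?U = "term_operation A f g n u"
    have "composition A n (op3 A g) [?S, ?T, ?U] = term_operation A f g n (G s t u)"
    proof
      fix xs
      show "composition A n (op3 A g) [?S, ?T, ?U] xs = term_operation A f g n (G s t u) xs"
      proof (cases "xs \<in> tuples A n")
        case True
        then have "eval f g ((!) xs) s \<in> A" "eval f g ((!) xs) t \<in> A" "eval f g ((!) xs) u \<in> A"
          using val G(4) by simp_all
        then show ?thesis using True by (simp add: composition_def term_operation_def op3_def) (simp add: tuples_def)
      qed (simp add: composition_def term_operation_def)
    qed
    moreover have "(n, composition A n (op3 A g) [?S, ?T, ?U]) \<in> Clo A {(3, op3 A g)}"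
      using G by (intro Clo.comp[of 3]) auto
    ultimately show ?case by simp
  qed
qed

section \<open>Minimality of the clone\<close>

locale minimal_majority_algebra = majority_algebra A f g
  for A :: "'a set" and f :: "'a \<Rightarrow> 'a \<Rightarrow> 'a" and g :: "'a \<Rightarrow> 'a \<Rightarrow> 'a \<Rightarrow> 'a" +
  assumes finA: "finite A" and gf: "x \<in> A \<Longrightarrow> y \<in> A \<Longrightarrow> g x x y = f x y"
    and minimal: "minimal_bounded_width_clone A (Clo A {(3, op3 A g)})"
begin

lemma majority_value:
  assumes t: "represents n t (\<lambda>S. k)" and xy: "x \<in> A" "y \<in> A" and \<rho>: "\<And>i. \<rho> i \<in> {x, y}"
    and T: "T \<subseteq> {..<n}" "\<And>i. i \<in> T \<Longrightarrow> \<rho> i = x" "n < 2 * card T" and y: "j < n" "\<rho> j = y"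
  shows "eval f g \<rho> t = bev f k x y"
proof (cases "x = y")
  case True
  then have "\<rho> = (\<lambda>_. x)" using \<rho> by auto
  then show ?thesis using True eval_const[OF xy(1)] bev_const[OF xy(1)] by simp
next
  case False
  let ?S = "{i. i < n \<and> \<rho> i = x}"
  have "card T \<le> card ?S" using T by (intro card_mono) auto
  moreover have "j \<notin> ?S" using y False by simp
  moreover have "range \<rho> \<subseteq> A" using \<rho> xy by force
  moreover have "\<forall>i<n. \<rho> i = (if i \<in> ?S then x else y)" using \<rho> by auto
  ultimately have "majority_env A n ?S x y \<rho>" using T xy y(1) unfolding majority_env_def by auto
  then show ?thesis using t by (rule representsD[rotated])
qed

lemma majority_fixed:
  assumes t: "represents n t (\<lambda>S. k)" and uv: "u \<in> A" "v \<in> A" "bev f k u v = u" and \<rho>: "\<And>i. \<rho> i \<in> {u, v}"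
    and T: "T \<subseteq> {..<n}" "\<And>i. i \<in> T \<Longrightarrow> \<rho> i = u" "n < 2 * card T" and n: "\<And>i. \<exists>j<n. \<rho> i = \<rho> j"
  shows "eval f g \<rho> t = u"
proof (cases "\<exists>j<n. \<rho> j = v")
  case True
  then show ?thesis using majority_value[OF t uv(1,2) \<rho> T] uv(3) by auto
next
  case False
  then have "\<rho> i = u" for i using n[of i] \<rho> by (metis insert_iff singletonD)
  then have "\<rho> = (\<lambda>_. u)" by blast
  then show ?thesis using eval_const[OF uv(1)] by simp
qed

text \<open>The terms that witness \<open>(k, k) \<in> pat\<close> for three and five variables yield operations of bounded
  width, so by minimality they generate \<open>g\<close>. If \<open>k\<close> is the first projection on \<open>{u, v}\<close>, they
  preserve \<open>{u, v}\<close> and commute with the transposition of \<open>u\<close> and \<open>v\<close>, hence so does \<open>g\<close>.\<close>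

lemma yellow_of_pat:
  assumes k: "(k, k) \<in> pat" and uv: "u \<in> A" "v \<in> A" "bev f k u v = u" "bev f k v u = v"
  shows "yellow f u v"
proof (cases "u = v")
  case True
  then show ?thesis using f_idem uv by (simp add: yellow_def)
next
  case neq: False
  obtain t3 where "represents 3 t3 (\<lambda>S. if 0 \<in> S then k else k)" using k by (rule patD[of k k 3 0]) auto
  then have t3: "represents 3 t3 (\<lambda>S. k)" by simp
  obtain t5 where "represents 5 t5 (\<lambda>S. if 0 \<in> S then k else k)" using k by (rule patD[of k k 5 0]) auto
  then have t5: "represents 5 t5 (\<lambda>S. k)" by simp
  define e3 where "e3 = (\<lambda>i::nat. if i < 3 then i else 0)"
  \<comment> \<open>Truncated subtraction sends the variables \<open>0\<close> and \<open>1\<close>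
    to the first argument. So a single dissenting argument among four fills at most two of five
    places, which leaves a majority of three.\<close>
  define e4 where "e4 = (\<lambda>i::nat. if i < 5 then i - 1 else 0)"
  have e3: "e3 i < 3" "\<exists>j<3. e3 i = e3 j" for i
    by (simp add: e3_def) (rule exI[of _ "if i < 3 then i else 0"], simp add: e3_def)
  have e4: "e4 i < 4" "\<exists>j<5. e4 i = e4 j" for i
    by (simp add: e4_def, linarith) (rule exI[of _ "if i < 5 then i else 0"], simp add: e4_def)
  define w3 where "w3 = term_operation A f g 3 (tsub (\<lambda>i. Var (e3 i)) t3)"
  define w4 where "w4 = term_operation A f g 4 (tsub (\<lambda>i. Var (e4 i)) t5)"
  have w3: "w3 xs = eval f g (\<lambda>i. xs ! e3 i) t3" if "xs \<in> tuples A 3" for xs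
    using that by (simp add: w3_def term_operation_def)
  have w4: "w4 xs = eval f g (\<lambda>i. xs ! e4 i) t5" if "xs \<in> tuples A 4" for xs
    using that by (simp add: w4_def term_operation_def)
  let ?C = "Clo A {(3, op3 A g)}" and ?W = "{(3, w3), (4, w4)}"
  have ops: "n = 3 \<Longrightarrow> p = op3 A g \<Longrightarrow> p \<in> operations A n" for n p using op3_operation g_closed by blast
  have C: "clone A ?C" using ops by (intro clone_Clo) auto
  have "(3, w3) \<in> ?C" "(4, w4) \<in> ?C"
    unfolding w3_def w4_def using e3 e4 by (auto intro!: term_Clo f_closed g_closed gf simp: vars_tsub)
  then have W: "?W \<subseteq> ?C" by simp
  then have W_ops: "(n, p) \<in> ?W \<Longrightarrow> p \<in> operations A n" for n p using C unfolding clone_def by blast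
  have D: "clone A (Clo A ?W)" and WD: "?W \<subseteq> Clo A ?W" using clone_Clo[of ?W A, OF W_ops] by simp_all
  have DC: "Clo A ?W \<subseteq> ?C" using C W by (rule Clo_least)
  have bwC: "bounded_width A ?C" using minimal by (simp add: minimal_bounded_width_clone_def)
  have val3: "w3 xs = bev f k x y"
    if xy: "x \<in> A" "y \<in> A" and xs: "length xs = 3" "set xs \<subseteq> {x, y}"
      and T: "T \<subseteq> {..<3}" "\<forall>i\<in>T. xs ! i = x" "3 < 2 * card T" and j: "j < 3" "xs ! j = y" for xs x y T j
  proof -
    have mem: "xs ! e3 i \<in> {x, y}" for i using xs(1) e3(1)[of i] by (intro subsetD[OF xs(2)] nth_mem) simp
    have "xs \<in> tuples A 3" using xs xy by (auto simp: tuples_def)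
    moreover have "eval f g (\<lambda>i. xs ! e3 i) t3 = bev f k x y"
      by (rule majority_value[OF t3 xy mem T(1) _ T(3) j(1)]) (use T j in \<open>auto simp: e3_def\<close>)
    ultimately show ?thesis using w3 by simp
  qed
  have val4: "w4 xs = bev f k x y"
    if xy: "x \<in> A" "y \<in> A" and xs: "length xs = 4" "set xs \<subseteq> {x, y}"
      and T: "T \<subseteq> {..<5}" "\<forall>i\<in>T. xs ! (i - 1) = x" "5 < 2 * card T" and j: "j < 4" "xs ! j = y" for xs x y T j
  proof -
    have mem: "xs ! e4 i \<in> {x, y}" for i using xs(1) e4(1)[of i] by (intro subsetD[OF xs(2)] nth_mem) simp
    have "xs \<in> tuples A 4" using xs xy by (auto simp: tuples_def)
    moreover have "eval f g (\<lambda>i. xs ! e4 i) t5 = bev f k x y"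
      by (rule majority_value[OF t5 xy mem T(1) _ T(3), where j = "Suc j"]) (use T j in \<open>auto simp: e4_def\<close>)
    ultimately show ?thesis using w4 by simp
  qed
  have "bounded_width A (Clo A ?W)"
    unfolding bounded_width_def
  proof (intro conjI)
    show "\<forall>n p. (n, p) \<in> Clo A ?W \<longrightarrow> (\<forall>x\<in>A. p (replicate n x) = x)"
      using bwC DC unfolding bounded_width_def by blast
    have "w3 [x, x, y] = bev f k x y" "w3 [x, y, x] = bev f k x y" "w3 [y, x, x] = bev f k x y"
      if xy: "x \<in> A" "y \<in> A" for x y
      by (rule val3[OF xy, of _ "{0, 1}" 2], simp_all)
        (rule val3[OF xy, of _ "{0, 2}" 1], simp_all,
         rule val3[OF xy, of _ "{1, 2}" 0], simp_all)
    moreover have "w4 [x, x, x, y] = bev f k x y" "w4 [x, x, y, x] = bev f k x y"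
      "w4 [x, y, x, x] = bev f k x y" "w4 [y, x, x, x] = bev f k x y"
      if xy: "x \<in> A" "y \<in> A" for x y
      by (rule val4[OF xy, of _ "{0, 1, 2, 3}" 3], simp_all)
        (rule val4[OF xy, of _ "{0, 1, 2, 4}" 2], simp_all,
         rule val4[OF xy, of _ "{0, 1, 3, 4}" 1], simp_all,
         rule val4[OF xy, of _ "{2, 3, 4}" 0], simp_all)
    ultimately show "\<exists>g0 h0. (3, g0) \<in> Clo A ?W \<and> (4, h0) \<in> Clo A ?W \<and> (\<forall>x\<in>A. \<forall>y\<in>A.
        g0 [x, x, y] = g0 [x, y, x] \<and> g0 [x, y, x] = g0 [y, x, x] \<and> g0 [y, x, x] = h0 [x, x, x, y] \<and>
        h0 [x, x, x, y] = h0 [x, x, y, x] \<and> h0 [x, x, y, x] = h0 [x, y, x, x] \<and>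
        h0 [x, y, x, x] = h0 [y, x, x, x])"
      using WD by (intro exI[of _ w3] exI[of _ w4]) auto
  qed (use finA D in auto)
  then have "\<not> Clo A ?W \<subset> ?C" using minimal D by (auto simp: minimal_bounded_width_clone_def)
  then have "Clo A ?W = ?C" using DC by blast
  moreover have "(3, op3 A g) \<in> ?C" using clone_Clo(2)[of "{(3, op3 A g)}" A] ops by auto
  ultimately have gD: "(3, op3 A g) \<in> Clo A ?W" by simp
  define \<sigma> where "\<sigma> = (\<lambda>z. if z = u then v else u)"
  \<comment> \<open>As \<open>n\<close> is odd, one of \<open>u\<close> and \<open>v\<close> holds a
    majority of the first \<open>n\<close> places, and the exchange of \<open>u\<close> and
    \<open>v\<close> hands this majority to the other. The condition on \<open>\<rho>\<close>
    ensures that no value occurs only beyond these places.\<close>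
  have equi: "eval f g \<rho> t \<in> {u, v} \<and> eval f g (\<lambda>i. \<sigma> (\<rho> i)) t = \<sigma> (eval f g \<rho> t)"
    if n: "odd n" and t: "represents n t (\<lambda>S. k)" and \<rho>: "\<And>i. \<rho> i \<in> {u, v}" and nn: "\<And>i. \<exists>j<n. \<rho> i = \<rho> j" for n t \<rho>
  proof -
    have nn': "\<exists>j<n. \<sigma> (\<rho> i) = \<sigma> (\<rho> j)" for i using nn[of i] by metis
    have \<rho>': "\<sigma> (\<rho> i) \<in> {u, v}" "\<sigma> (\<rho> i) \<in> {v, u}" "\<rho> i \<in> {v, u}" for i using \<rho>[of i] by (auto simp: \<sigma>_def)
    let ?U = "{i. i < n \<and> \<rho> i = u}" and ?V = "{i. i < n \<and> \<rho> i = v}"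
    have "?U \<inter> ?V = {}" using neq by auto
    then have "card ?U + card ?V = card (?U \<union> ?V)" by (simp add: card_Un_disjoint)
    also have "?U \<union> ?V = {..<n}" using \<rho> by auto
    finally have "card ?U + card ?V = n" by simp
    then have "n < 2 * card ?U \<or> n < 2 * card ?V" using n by presburger
    then show ?thesis
    proof
      assume U: "n < 2 * card ?U"
      have "eval f g \<rho> t = u"
        by (rule majority_fixed[OF t uv(1,2,3) \<rho> _ _ U nn]) auto
      moreover have "eval f g (\<lambda>i. \<sigma> (\<rho> i)) t = v"
        by (rule majority_fixed[OF t uv(2,1,4) \<rho>'(2) _ _ U nn']) (auto simp: \<sigma>_def)
      ultimately show ?thesis by (simp add: \<sigma>_def)
    next
      assume V: "n < 2 * card ?V"
      have "eval f g \<rho> t = v"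
        by (rule majority_fixed[OF t uv(2,1,4) \<rho>'(3) _ _ V nn]) auto
      moreover have "eval f g (\<lambda>i. \<sigma> (\<rho> i)) t = u"
        by (rule majority_fixed[OF t uv(1,2,3) \<rho>'(1) _ _ V nn']) (use neq in \<open>auto simp: \<sigma>_def\<close>)
      ultimately show ?thesis using neq by (simp add: \<sigma>_def)
    qed
  qed
  have \<sigma>uv: "\<sigma> z \<in> {u, v}" for z by (simp add: \<sigma>_def)
  have tupA: "xs \<in> tuples A n" if "xs \<in> tuples {u, v} n" for xs n using that uv by (auto simp: tuples_def)
  have tup\<sigma>: "map \<sigma> xs \<in> tuples {u, v} n" if "xs \<in> tuples {u, v} n" for xs n
    using that \<sigma>uv by (auto simp: tuples_def)
  have basic: "p xs \<in> {u, v} \<and> p (map \<sigma> xs) = \<sigma> (p xs)" if p: "(m, p) \<in> ?W" and xs: "xs \<in> tuples {u, v} m" for m p xs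
  proof -
    have nth: "xs ! i \<in> {u, v}" "map \<sigma> xs ! i = \<sigma> (xs ! i)" if "i < m" for i
    proof -
      have i: "i < length xs" "set xs \<subseteq> {u, v}" using xs that by (auto simp: tuples_def)
      show "xs ! i \<in> {u, v}" using i(2) nth_mem[OF i(1)] by (rule subsetD)
      show "map \<sigma> xs ! i = \<sigma> (xs ! i)" using i by simp
    qed
    consider "m = 3" "p = w3" | "m = 4" "p = w4" using p by auto
    then show ?thesis
    proof cases
      case 1
      have "eval f g (\<lambda>i. xs ! e3 i) t3 \<in> {u, v} \<and>
          eval f g (\<lambda>i. \<sigma> (xs ! e3 i)) t3 = \<sigma> (eval f g (\<lambda>i. xs ! e3 i) t3)"
        using nth(1) e3 1 by (intro equi[OF _ t3]) (simp, blast, metis)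
      then show ?thesis using 1 w3 tupA[OF xs] tupA[OF tup\<sigma>[OF xs]] nth(2) e3(1) by simp
    next
      case 2
      have "eval f g (\<lambda>i. xs ! e4 i) t5 \<in> {u, v} \<and>
          eval f g (\<lambda>i. \<sigma> (xs ! e4 i)) t5 = \<sigma> (eval f g (\<lambda>i. xs ! e4 i) t5)"
        using nth(1) e4 2 by (intro equi[OF _ t5]) (simp, blast, metis)
      then show ?thesis using 2 w4 tupA[OF xs] tupA[OF tup\<sigma>[OF xs]] nth(2) e4(1) by simp
    qed
  qed
  have all: "p xs \<in> {u, v} \<and> p (map \<sigma> xs) = \<sigma> (p xs)"
    if "(n, p) \<in> Clo A ?W" "xs \<in> tuples {u, v} n" for n p xs
    using that
  proof (induction arbitrary: xs rule: Clo.induct)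
    case (proj i n)
    have "i < length xs" "set xs \<subseteq> {u, v}" using proj by (auto simp: tuples_def)
    then have "xs ! i \<in> {u, v}" "map \<sigma> xs ! i = \<sigma> (xs ! i)" using nth_mem[of i xs] by (blast, simp)
    then show ?case using tupA[OF proj(2)] tupA[OF tup\<sigma>[OF proj(2)]] by (simp add: projection_def)
  next
    case (comp m p qs n)
    let ?ys = "map (\<lambda>q. q xs) qs"
    have IH: "q xs \<in> {u, v} \<and> q (map \<sigma> xs) = \<sigma> (q xs)" if "q \<in> set qs" for q using comp that by blast
    have ys: "?ys \<in> tuples {u, v} m" using comp(2) IH by (auto simp: tuples_def)
    have "map (\<lambda>q. q (map \<sigma> xs)) qs = map \<sigma> ?ys" using IH by simp
    then have "composition A n p qs (map \<sigma> xs) = p (map \<sigma> ?ys)" "composition A n p qs xs = p ?ys"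
      using tupA[OF comp(4)] tupA[OF tup\<sigma>[OF comp(4)]] by (simp_all only: composition_def restrict_apply' cong: if_cong)
    then show ?case using basic[OF comp(1) ys] by simp
  qed
  have g_op: "op3 A g [a, a, b] = f a b" if "a \<in> A" "b \<in> A" for a b using that gf by (simp add: op3_def tuples_def)
  have "[u, u, v] \<in> tuples {u, v} 3" by (simp add: tuples_def)
  from all[OF gD this] have "f u v \<in> {u, v}" "f v u = \<sigma> (f u v)" using g_op uv neq by (auto simp: \<sigma>_def)
  \<comment> \<open>The remaining possibility is that \<open>f\<close> is the second projection on
    \<open>{u, v}\<close>, which contradicts \<open>f(f(x, y), f(y, x)) = f(x, y)\<close>.\<close>
  then show ?thesis using f_yellow[OF uv(1,2)] neq by (auto simp: yellow_def \<sigma>_def)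
qed

end

section \<open>Standard pairs\<close>

text \<open>For odd \<open>n\<close> either a set or its complement has more than half of the
  points, so a set outside the family misses a member of it.\<close>

lemma maximal_intersecting_majority:
  assumes "odd n"
  shows "maximal_intersecting n {S. S \<subseteq> {1..n} \<and> n < 2 * card S}" (is "maximal_intersecting n ?M")
  unfolding maximal_intersecting_def
proof (intro conjI allI impI)
  have "X \<inter> Y \<noteq> {}" if "X \<in> ?M" "Y \<in> ?M" for X Y
  proof
    assume "X \<inter> Y = {}"
    moreover have "finite X" "finite Y" using that finite_subset[of _ "{1..n}"] by auto
    ultimately have "card X + card Y = card (X \<union> Y)" by (simp add: card_Un_disjoint)
    also have "\<dots> \<le> card {1..n}" using that by (intro card_mono) auto
    finally show False using that by auto
  qed
  then show "intersecting n ?M" unfolding intersecting_def by blast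
next
  fix F' assume F': "intersecting n F'" and sub: "?M \<subseteq> F'"
  have "S \<in> ?M" if "S \<in> F'" for S
  proof (rule ccontr)
    assume no: "S \<notin> ?M"
    have S: "S \<subseteq> {1..n}" using F' that by (auto simp: intersecting_def)
    then have c: "card ({1..n} - S) = n - card S" using finite_subset[OF S] by (simp add: card_Diff_subset)
    have "2 * card S \<le> n" using no S by simp
    then have "2 * card S < n" using assms by presburger
    then have "n < 2 * card ({1..n} - S)" using c by simp
    then have "{1..n} - S \<in> F'" using sub by blast
    then show False using F' that unfolding intersecting_def by blast
  qed
  then show "F' = ?M" using sub by blast
qed

lemma majority_sets_3: "{S. S \<subseteq> {1..3} \<and> 3 < 2 * card S} = {{1, 2}, {1, 3}, {2, 3}, {1, 2, 3::nat}}"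
proof -
  have "{1..3::nat} = {1, 2, 3}" by auto
  then have "{S. S \<subseteq> {1..3::nat} \<and> 3 < 2 * card S} = {S \<in> Pow {1, 2, 3}. 3 < 2 * card S}" by auto
  also have "\<dots> = {{1, 2}, {1, 3}, {2, 3}, {1, 2, 3}}" by (auto simp: Pow_insert)
  finally show ?thesis .
qed

lemma standard_pair_majority:
  assumes alg: "fg_algebra A f g" and sp: "standard_pair A f g" and n: "odd n" "3 \<le> n"
  shows "\<exists>t. \<forall>S x y \<rho>. majority_env A n S x y \<rho> \<longrightarrow> eval f g \<rho> t = f x y"
proof -
  let ?M = "{S. S \<subseteq> {1..n} \<and> n < 2 * card S}"
  have g: "g x y z \<in> A" if "x \<in> A" "y \<in> A" "z \<in> A" for x y z using alg that by (simp add: fg_algebra_def)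
  have "2 \<le> n" using n by simp
  then obtain p where p: "(n, p) \<in> Clo A {(3, op3 A g)}" "\<forall>x\<in>A. p (replicate n x) = x"
    "\<forall>x\<in>A. \<forall>y\<in>A. \<forall>as\<in>tuples A n. set as = {x, y} \<longrightarrow> {i \<in> {1..n}. as ! (i - 1) = x} \<in> ?M \<longrightarrow> p as = f x y"
    using sp maximal_intersecting_majority[OF n(1)] unfolding standard_pair_def by blast
  obtain t where t: "vars t \<subseteq> {..<n}" "p = term_operation A f g n t" using Clo_term[OF p(1) g] by blast
  have "eval f g \<rho> t = f x y" if E: "majority_env A n S x y \<rho>" for S x y \<rho>
  proof -
    have xy: "x \<in> A" "y \<in> A" and \<rho>: "range \<rho> \<subseteq> A" and S: "S \<subset> {..<n}" "n < 2 * card S"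
      and v: "\<And>i. i < n \<Longrightarrow> \<rho> i = (if i \<in> S then x else y)" using E by (auto simp: majority_env_def)
    define xs where "xs = map \<rho> [0..<n]"
    have tup: "xs \<in> tuples A n" using \<rho> by (auto simp: tuples_def xs_def)
    have "eval f g \<rho> t = eval f g ((!) xs) t" using t(1) by (intro eval_cong) (auto simp: xs_def)
    also have "\<dots> = p xs" using tup by (simp add: t(2) term_operation_def)
    also have "\<dots> = f x y"
    proof (cases "x = y")
      case True
      then have "xs = replicate n x" using v by (intro nth_equalityI) (auto simp: xs_def)
      then show ?thesis using p(2) xy True sp by (simp add: standard_pair_def)
    next
      case False
      \<comment> \<open>Places are counted from \<open>1\<close> in intersecting families and from
        \<open>0\<close> in environments, hence the shift by \<open>Suc\<close>.\<close>
      have "{i \<in> {1..n}. xs ! (i - 1) = x} = Suc ` S"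
      proof (intro equalityI subsetI)
        fix i assume "i \<in> {i \<in> {1..n}. xs ! (i - 1) = x}"
        then have "i - 1 \<in> S" "i = Suc (i - 1)" using v[of "i - 1"] False by (auto simp: xs_def split: if_splits)
        then show "i \<in> Suc ` S" by blast
      qed (use S v in \<open>auto simp: xs_def\<close>)
      moreover have "Suc ` S \<in> ?M" using S by (auto simp: card_image)
      moreover have "set xs = {x, y}"
      proof
        show "set xs \<subseteq> {x, y}" using v by (auto simp: xs_def)
        have "S \<noteq> {}" using S by auto
        then obtain i where "i \<in> S" by blast
        then have "i < n" "\<rho> i = x" using S v by auto
        moreover obtain j where "j < n" "j \<notin> S" using S by blast
        moreover from this have "\<rho> j = y" using v by simp
        ultimately show "{x, y} \<subseteq> set xs" by (auto simp: xs_def)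
      qed
      ultimately show ?thesis using p(3) xy tup by simp
    qed
    finally show ?thesis .
  qed
  then show ?thesis by blast
qed

text \<open>Because \<open>g\<close> is the operation of the majority family on three points, the
  clone generated by the \<open>h\<close> contains that of \<open>g\<close> and hence every
  \<open>f\<close>-term. The absorption property is then applied to the algebra itself, as a member
  of its own variety.\<close>

lemma standard_pair_absorption:
  assumes alg: "fg_algebra A f g" and sp: "standard_pair A f g" and xy: "x \<in> A" "y \<in> A" "x \<noteq> y"
    and t: "bev f t x y = y" "bev f t y x = y"
  shows "arrow f x y"
proof -
  have fA: "f x y \<in> A" if "x \<in> A" "y \<in> A" for x y using alg that by (simp add: fg_algebra_def)
  have gA: "g x y z \<in> A" if "x \<in> A" "y \<in> A" "z \<in> A" for x y z using alg that by (simp add: fg_algebra_def)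
  have gf: "g x x y = f x y" if "x \<in> A" "y \<in> A" for x y using sp that by (simp add: standard_pair_def fg_identities_def)
  obtain h where h: "\<And>n F. n \<ge> 2 \<Longrightarrow> maximal_intersecting n F \<Longrightarrow> (n, h n F) \<in> Clo A {(3, op3 A g)}"
    "h 3 {{1, 2}, {1, 3}, {2, 3}, {1, 2, 3}} = op3 A g"
    "binary_absorption TYPE(nat) A f g (Clo A {(n, h n F) | n F. n \<ge> 2 \<and> maximal_intersecting n F})"
    using sp unfolding standard_pair_def by blast
  let ?H = "{(n, h n F) | n F. n \<ge> 2 \<and> maximal_intersecting n F}"
  have H_ops: "p \<in> operations A n" if "(n, p) \<in> ?H" for n p
  proof -
    have "(n, p) \<in> Clo A {(3, op3 A g)}" using that h(1) by blast
    then show ?thesis by (intro Clo_operations[of "{(3, op3 A g)}" A n p]) (auto intro: op3_operation gA)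
  qed
  have H: "clone A (Clo A ?H)" "?H \<subseteq> Clo A ?H" using clone_Clo[of ?H A, OF H_ops] by simp_all
  have "(3, op3 A g) \<in> ?H"
    using maximal_intersecting_majority[of 3] h(2) unfolding majority_sets_3 by force
  then have sub: "Clo A {(3, op3 A g)} \<subseteq> Clo A ?H" using H by (intro Clo_least[OF H(1)]) blast
  define s where "s = trm_of t (Var 0) (Var 1)"
  have vs: "vars s \<subseteq> {..<2}" using vars_trm_of[of t "Var 0" "Var 1"] by (auto simp: s_def)
  have "(2, term_operation A f g 2 s) \<in> Clo A ?H" using sub term_Clo[of A f g s 2] fA gA gf vs by blast
  moreover have "binary_absorption TYPE('a) A f g (Clo A ?H)" using h(3) by (rule binary_absorption_any_type)
  moreover have "in_variety A f g A f g" using alg by (simp add: in_variety_def)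
  moreover have "eval f g ((!) [y, x]) s = y" "eval f g ((!) [x, y]) s = y" using t by (simp_all add: s_def)
  ultimately have "f y x = y \<and> f x y = y" using vs xy unfolding binary_absorption_def by blast
  then show ?thesis by (simp add: arrow_def)
qed

theorem theorem18:
  fixes A :: "'a set"
    and f :: "'a \<Rightarrow> 'a \<Rightarrow> 'a"
    and g :: "'a \<Rightarrow> 'a \<Rightarrow> 'a \<Rightarrow> 'a"
  assumes "minimal_bounded_width_algebra A f g"
    and "standard_pair A f g"
    and "minimal_bounded_width_clone A (Clo A {(3, op3 A g)})"
  shows "hereditarily_yellow_connected A f"
proof -
  have fin: "finite A" and alg: "fg_algebra A f g"
    using assms(1) by (auto simp: minimal_bounded_width_algebra_def)
  note sp = assms(2)
  interpret minimal_majority_algebra A f g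
  proof
    show "\<exists>t. \<forall>S x y \<rho>. majority_env A n S x y \<rho> \<longrightarrow> eval f g \<rho> t = f x y" if "odd n" "3 \<le> n" for n
      using alg sp that by (rule standard_pair_majority)
  qed (use alg sp fin assms(3) in \<open>auto simp: fg_algebra_def standard_pair_def fg_identities_def\<close>)
  have absorption: "arrow f x y" if "x \<in> A" "y \<in> A" "x \<noteq> y" "bev f t x y = y" "bev f t y x = y" for t x y
    using alg sp that by (rule standard_pair_absorption)
  have "\<exists>sg. psemilattice A f sg" using fin op_closed_A f_idem absorption by (rule ex_psemilattice)
  then obtain sg where sg: "psemilattice A f sg" ..
  interpret psemilattice A f sg by (rule sg)
  interpret bw_algebra pat ex A f sg
  proof
    show "yellow f (f x y) (f y x)" if "x \<in> A" "y \<in> A" for x y using f_yellow that by (simp add: yellow_def)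
  qed (fact absorption yellow_of_pat ex_yellow)+
  show ?thesis
    unfolding hereditarily_yellow_connected_def
  proof (intro allI impI)
    fix B assume "subalgebra A f B" "B \<noteq> {}"
    then show "yellow_connected f B" using all_yellow_connected[of B] by (auto simp: subalgebra_def op_closed_def)
  qed
qed

end
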